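(* For every partition $\lambda$ of $n$ we have $D^\lambda \cong D_{\lambda'}$ as $\mathbb{K}G$-modules, where $D^\lambda = S^\lambda/(S^\lambda\cap (S^\lambda)^\perp)$ is the module constructed from $\mathbb{F}_q^n$-tableaux, $D_{\lambda'}$ is James' module, and $\lambda'$ is the conjugate partition of $\lambda$. In particular, the modules $D^\lambda$ ($\lambda$ a partition of $n$) are, up to isomorphism, the irreducible unipotent $\mathbb{K}G$-modules.
   Context: Let $q$ be a power of a prime $p$, $\mathbb{F}_q$ the field with $q$ elements, $n$ a positive integer, $G=\mathrm{GL}_n(\mathbb{F}_q)$. Let $\mathbb{K}$ be a field containing a nontrivial $p$-th root of unity (so $\mathrm{char}(\mathbb{K})\neq p$), and fix a nontrivial homomorphism $\theta:\mathbb{F}_q^+\to\mathbb{K}^\times$ from the additive group of $\mathbb{F}_q$. Partitions: for a partition $\lambda=(\lambda_1\ge\lambda_2\ge\cdots)$ of $n$, the Young diagram of shape $\lambda$ is the left-justified array with $\lambda_i$ boxes in row $i$ (rows numbered from top to bottom). The conjugate $\lambda'$ is $\lambda'_i=|\{j\mid\lambda_j\ge i\}|$. Dominance order: $\lambda\succeq\mu$ iff $\sum_{i=1}^k\lambda_i\ge\sum_{i=1}^k\mu_i$ for all $k$ (missing parts are $0$). An $\mathbb{F}_q^n$-tableau $T$ of shape $\lambda$ is a filling of the $n$ boxes of the Young diagram of $\lambda$ with linearly independent vectors of $\mathbb{F}_q^n$; $G$ acts on such tableaux by left multiplication of the entries (column vectors). $\mathcal{B}(T)=\{v_1,\dots,v_n\}$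 is the ordered basis obtained by numbering the entries of $T$ from top to bottom in each column, columns taken left to right. "$v_j$ strictly left of $v_i$ in $T$" means the column of $v_j$ is strictly left of the column of $v_i$; "nonstrictly right" means in the same column or a column further to the right (rows are irrelevant). Put $$U(T)=\{g\in G\mid g v_i-v_i\in \mathbb{F}_q\text{-span}\{v_j\mid v_j\text{ strictly left of }v_i\text{ in }T\}\ \forall i\},$$ $$P(T)=\{g\in G\mid g v_i\in \mathbb{F}_q\text{-span}\{v_j\mid v_j\text{ nonstrictly right of }v_i\text{ in }T\}\ \forall i\}.$$ Let $X(T)$ be the set of pairs $(i,j)$ such that $v_i$ lies in the box directly to the left of $v_j$ (same row, adjacent column) in $T$. The linear character $\psi_T:U(T)\to\mathbb{K}^\times$ is $\psi_T(u)=\theta\big(\sum_{(i,j)\in X(T)}\text{the coefficient of }v_i\text{ in }uv_j\big)$ (coefficients with respect to $\mathcal{B}(T)$). In the permutation module $\mathbb{K}\text{-span}\{T\mid T\text{ an }\mathbb{F}_q^n\text{-tableau of shape }\lambda\}$ define $$m_T=\sum_{p\in P(T)}pT,\qquad e_T=\sum_{u\in U(T)}\psi_T(u^{-1})m_{uT},$$ and let $M^\lambda$ (resp. $S^\lambda$) be the $\mathbb{K}$-span of all $m_T$ (resp. all $e_T$), $T$ of shape $\lambda$; these are $G$-modules with $S^\lambda\subseteq M^\lambda$. Define a bilinear form on $M^\lambda$ by $[m_T,m_{T'}]=\delta_{m_T,m_{T'}}$ ($1$ if $m_T=m_{T'}$, $0$ otherwise), extended bilinearly, and let $(S^\lambda)^\perp=\{x\in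 M^\lambda\mid [x,s]=0\ \forall s\in S^\lambda\}$. Set $D^\lambda=S^\lambda/(S^\lambda\cap(S^\lambda)^\perp)$. For a partition $\lambda$, number the boxes of its Young diagram $1,\dots,n$ along rows left to right, rows from top to bottom; $P_\lambda=\{g\in G\mid g_{ij}=0\text{ if }i\text{ lies in a row strictly below that of }j\}$ (block upper triangular matrices with diagonal block sizes $\lambda_1,\lambda_2,\dots$). $B=P_{(1^n)}$ is the group of upper triangular matrices. $\mathbf{1}$ denotes the trivial module over $\mathbb{K}$. An irreducible $\mathbb{K}G$-module is unipotent if it is a composition factor of $\mathrm{Ind}_B^G(\mathbf{1})$. James' modules: James (1984) constructed irreducible $\mathbb{K}G$-modules $D_\lambda$, one for each partition $\lambda$ of $n$, with the following (known) properties: (1) the $D_\lambda$ are exactly the composition factors of $\mathrm{Ind}_B^G(\mathbf{1})$ up to isomorphism; (2) $D_\lambda\cong D_\mu$ implies $\lambda=\mu$; (3) $D_\lambda$ is a composition factor of $\mathrm{Ind}_{P_\lambda}^G(\mathbf{1})$; (4) every composition factor of $\mathrm{Ind}_{P_\mu}^G(\mathbf{1})$ is isomorphic to $D_\lambda$ for some $\lambda\succeq\mu$. The family $(D_\lambda)$ is uniquely characterized up to isomorphism by properties (2)–(4). *)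

theory Defs
  imports "HOL-Algebra.AbelCoset" "Jordan_Normal_Form.VS_Connect" "HOL-Computational_Algebra.Primes"
begin

section \<open>Partitions\<close>

definition is_partition :: "nat \<Rightarrow> nat list \<Rightarrow> bool" where
  "is_partition n lam \<longleftrightarrow> sorted_wrt (\<ge>) lam \<and> 0 \<notin> set lam \<and> sum_list lam = n"

text \<open>Parts are numbered from 0; missing parts are 0.\<close>

definition part :: "nat list \<Rightarrow> nat \<Rightarrow> nat" where
  "part lam i = (if i < length lam then lam ! i else 0)"

definition conj_partition :: "nat list \<Rightarrow> nat list" where
  "conj_partition lam = map (\<lambda>i. card {j. part lam j \<ge> Suc i}) [0..<part lam 0]"

definition dominates :: "nat list \<Rightarrow> nat list \<Rightarrow> bool" where
  "dominates lam mu \<longleftrightarrow> (\<forall>k. (\<Sum>i<k. part lam i) \<ge> (\<Sum>i<k. part mu i))"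

section \<open>Modules over a group algebra\<close>

text \<open>
  A module over the group algebra of \<open>G\<close> over a field \<open>'k\<close> is a vector space over \<open>'k\<close> with a
  linear action \<open>gact\<close> of \<open>G\<close>.  The fields \<open>mult\<close> and \<open>one\<close>, which \<^typ>\<open>('k, 'v) module\<close> inherits
  from rings, play no role.
\<close>

record ('k, 'v, 'g) gmodule = "('k, 'v) module" +
  gact :: "'g \<Rightarrow> 'v \<Rightarrow> 'v"

locale kg_module = G: group G + V: vectorspace class_ring V
  for G :: "('g, 'm) monoid_scheme" and V :: "('k::field, 'v, 'g, 'z) gmodule_scheme" +
  assumes gact_hom: "g \<in> carrier G \<Longrightarrow> gact V g \<in> LinearCombinations.module_hom class_ring V V"
    and gact_one: "v \<in> carrier V \<Longrightarrow> gact V \<one>\<^bsub>G\<^esub> v = v"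
    and gact_mult: "\<lbrakk>g \<in> carrier G; h \<in> carrier G; v \<in> carrier V\<rbrakk>
      \<Longrightarrow> gact V (g \<otimes>\<^bsub>G\<^esub> h) v = gact V g (gact V h v)"

definition kg_submodule ::
  "('g, 'm) monoid_scheme \<Rightarrow> ('k::field, 'v, 'g, 'z) gmodule_scheme \<Rightarrow> 'v set \<Rightarrow> bool" where
  "kg_submodule G V W \<longleftrightarrow> VectorSpace.subspace class_ring W V \<and> (\<forall>g\<in>carrier G. gact V g ` W \<subseteq> W)"

definition kg_iso ::
  "('g, 'm) monoid_scheme \<Rightarrow> ('k::field, 'v, 'g) gmodule \<Rightarrow> ('k, 'w, 'g) gmodule \<Rightarrow> bool" where
  "kg_iso G V W \<longleftrightarrow> kg_module G V \<and> kg_module G W \<and>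
     (\<exists>\<phi> \<in> LinearCombinations.module_hom class_ring V W. bij_betw \<phi> (carrier V) (carrier W) \<and>
        (\<forall>g\<in>carrier G. \<forall>v\<in>carrier V. \<phi> (gact V g v) = gact W g (\<phi> v)))"

text \<open>
  Quotient by a submodule, consisting of cosets.  The operations are written as unions,
  since for instance the pointwise scalar multiple of a coset by 0 need not be a coset.
\<close>

definition kg_quot ::
  "('k::field, 'v, 'g) gmodule \<Rightarrow> 'v set \<Rightarrow> ('k, 'v set, 'g) gmodule" where
  "kg_quot V W = \<lparr>carrier = a_rcosets\<^bsub>V\<^esub> W, mult = undefined, one = undefined,
     zero = W, add = set_add V,
     smult = (\<lambda>c X. \<Union>x\<in>X. W +>\<^bsub>V\<^esub> (c \<odot>\<^bsub>V\<^esub> x)),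
     gact = (\<lambda>g X. \<Union>x\<in>X. W +>\<^bsub>V\<^esub> (gact V g x))\<rparr>"

definition kg_irreducible ::
  "('g, 'm) monoid_scheme \<Rightarrow> ('k::field, 'v, 'g) gmodule \<Rightarrow> bool" where
  "kg_irreducible G V \<longleftrightarrow> kg_module G V \<and> carrier V \<noteq> {\<zero>\<^bsub>V\<^esub>} \<and>
     (\<forall>W. kg_submodule G V W \<longrightarrow> W = {\<zero>\<^bsub>V\<^esub>} \<or> W = carrier V)"

definition composition_series ::
  "('g, 'm) monoid_scheme \<Rightarrow> ('k::field, 'v, 'g) gmodule \<Rightarrow> 'v set list \<Rightarrow> bool" where
  "composition_series G V Ws \<longleftrightarrow> Ws \<noteq> [] \<and> hd Ws = {\<zero>\<^bsub>V\<^esub>} \<and> last Ws = carrier V \<and>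
     (\<forall>W\<in>set Ws. kg_submodule G V W) \<and>
     (\<forall>i. Suc i < length Ws \<longrightarrow> Ws ! i \<subseteq> Ws ! Suc i \<and>
        kg_irreducible G (kg_quot (V\<lparr>carrier := Ws ! Suc i\<rparr>) (Ws ! i)))"

definition composition_factors ::
  "('g, 'm) monoid_scheme \<Rightarrow> ('k::field, 'v, 'g) gmodule \<Rightarrow> ('k, 'v set, 'g) gmodule set" where
  "composition_factors G V = {kg_quot (V\<lparr>carrier := Ws ! Suc i\<rparr>) (Ws ! i) | Ws i.
     composition_series G V Ws \<and> Suc i < length Ws}"

section \<open>Induced and permutation modules\<close>

text \<open>
  \<open>Ind\<^sub>H\<^sup>G(W)\<close> for a subgroup \<open>H\<close> of a finite group \<open>G\<close>, as the space of functions \<open>f : G \<rightarrow> W\<close> with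
  \<open>f(gh) = h\<^sup>-\<^sup>1 f(g)\<close>, continued by 0 outside the carrier of \<open>G\<close>, with \<open>G\<close> acting by left translation.
\<close>

definition ind_module ::
  "('g, 'm) monoid_scheme \<Rightarrow> 'g set \<Rightarrow> ('k::field, 'v, 'g) gmodule \<Rightarrow> ('k, 'g \<Rightarrow> 'v, 'g) gmodule" where
  "ind_module G H W = \<lparr>
     carrier = {f. (\<forall>g\<in>carrier G. f g \<in> carrier W) \<and> (\<forall>g. g \<notin> carrier G \<longrightarrow> f g = \<zero>\<^bsub>W\<^esub>) \<and>
       (\<forall>g\<in>carrier G. \<forall>h\<in>H. f (g \<otimes>\<^bsub>G\<^esub> h) = gact W (inv\<^bsub>G\<^esub> h) (f g))},
     mult = undefined, one = undefined,
     zero = (\<lambda>g. \<zero>\<^bsub>W\<^esub>), add = (\<lambda>f f' g. f g \<oplus>\<^bsub>W\<^esub> f' g), smult = (\<lambda>c f g. c \<odot>\<^bsub>W\<^esub> f g),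
     gact = (\<lambda>x f g. if g \<in> carrier G then f (inv\<^bsub>G\<^esub> x \<otimes>\<^bsub>G\<^esub> g) else \<zero>\<^bsub>W\<^esub>)\<rparr>"

definition trivial_module :: "('k::field, 'k, 'g) gmodule" where
  "trivial_module = \<lparr>carrier = UNIV, mult = undefined, one = undefined, zero = 0, add = (+),
     smult = (*), gact = (\<lambda>g v. v)\<rparr>"

text \<open>
  The permutation module with basis a \<open>G\<close>-set \<open>X\<close>; the function \<open>f\<close> (zero outside \<open>X\<close>) stands for
  the formal linear combination \<open>\<Sum>x\<in>X. f x * x\<close> of elements of the finite set \<open>X\<close>.
\<close>

definition perm_module ::
  "('g, 'm) monoid_scheme \<Rightarrow> 'x set \<Rightarrow> ('g \<Rightarrow> 'x \<Rightarrow> 'x) \<Rightarrow> ('k::field, 'x \<Rightarrow> 'k, 'g) gmodule" where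
  "perm_module G X act = \<lparr>carrier = {f. \<forall>x. x \<notin> X \<longrightarrow> f x = 0},
     mult = undefined, one = undefined,
     zero = (\<lambda>x. 0), add = (\<lambda>f f' x. f x + f' x), smult = (\<lambda>c f x. c * f x),
     gact = (\<lambda>g f x. if x \<in> X then f (act (inv\<^bsub>G\<^esub> g) x) else 0)\<rparr>"

section \<open>General linear groups and unipotent modules\<close>

definition GL :: "nat \<Rightarrow> 'f::field mat monoid" where
  "GL n = units_of (ring_mat TYPE('f) n ())"

definition row_of_box :: "nat list \<Rightarrow> nat \<Rightarrow> nat" where
  "row_of_box lam i = (LEAST r. i < (\<Sum>j\<le>r. part lam j))"

definition parabolic :: "nat \<Rightarrow> nat list \<Rightarrow> 'f::field mat set" where
  "parabolic n lam = {g \<in> carrier (GL n).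
     \<forall>i<n. \<forall>j<n. row_of_box lam i > row_of_box lam j \<longrightarrow> g $$ (i, j) = 0}"

definition borel_subgroup :: "nat \<Rightarrow> 'f::field mat set" where
  "borel_subgroup n = parabolic n (replicate n 1)"

definition ind_trivial :: "nat \<Rightarrow> 'f::field mat set \<Rightarrow> ('k::field, 'f mat \<Rightarrow> 'k, 'f mat) gmodule" where
  "ind_trivial n H = ind_module (GL n) H trivial_module"

definition irreducible_unipotent :: "nat \<Rightarrow> ('k::field, 'v, 'f::field mat) gmodule \<Rightarrow> bool" where
  "irreducible_unipotent n V \<longleftrightarrow> kg_irreducible (GL n) V \<and>
     (\<exists>C \<in> composition_factors (GL n) (ind_trivial n (borel_subgroup n)). kg_iso (GL n) V C)"

text \<open>
  The properties that determine James' modules \<open>D\<^sub>\<lambda>\<close> uniquely up to isomorphism.  That they also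
  exhaust the irreducible unipotent modules is a consequence and is not assumed.
\<close>

definition james_modules :: "nat \<Rightarrow> (nat list \<Rightarrow> ('k::field, 'd, 'f::field mat) gmodule) \<Rightarrow> bool" where
  "james_modules n D \<longleftrightarrow>
     (\<forall>lam. is_partition n lam \<longrightarrow> kg_irreducible (GL n) (D lam)) \<and>
     (\<forall>lam mu. is_partition n lam \<and> is_partition n mu \<and> kg_iso (GL n) (D lam) (D mu) \<longrightarrow> lam = mu) \<and>
     (\<forall>lam. is_partition n lam \<longrightarrow>
        (\<exists>C \<in> composition_factors (GL n) (ind_trivial n (parabolic n lam)). kg_iso (GL n) (D lam) C)) \<and>
     (\<forall>mu. is_partition n mu \<longrightarrow>
        (\<forall>C \<in> composition_factors (GL n) (ind_trivial n (parabolic n mu)).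
           \<exists>lam. is_partition n lam \<and> dominates lam mu \<and> kg_iso (GL n) C (D lam)))"

section \<open>Tableaux\<close>

text \<open>
  A tableau is the list of its rows; the box \<open>(r, c)\<close> (row \<open>r\<close>, column \<open>c\<close>, both from 0) contains
  \<open>T ! r ! c\<close>.  The members of the ordered basis \<open>\<B>(T)\<close> are referred to by their boxes instead of
  their numbers.
\<close>

type_synonym 'f tableau = "'f vec list list"

definition boxes :: "'f tableau \<Rightarrow> (nat \<times> nat) set" where
  "boxes T = {(r, c). r < length T \<and> c < length (T ! r)}"

abbreviation entry :: "'f tableau \<Rightarrow> nat \<times> nat \<Rightarrow> 'f vec" where
  "entry T b \<equiv> T ! fst b ! snd b"

definition tableaux :: "nat \<Rightarrow> nat list \<Rightarrow> 'f::field tableau set" where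
  "tableaux n lam = {T. map length T = lam \<and> set (concat T) \<subseteq> carrier_vec n \<and>
     distinct (concat T) \<and>
     \<not> LinearCombinations.module.lin_dep class_ring (module_vec TYPE('f) n) (set (concat T))}"

definition tab_act :: "'f::field mat \<Rightarrow> 'f tableau \<Rightarrow> 'f tableau" where
  "tab_act g T = map (map (\<lambda>v. g *\<^sub>v v)) T"

definition vec_span :: "nat \<Rightarrow> 'f::field vec set \<Rightarrow> 'f vec set" where
  "vec_span n S = LinearCombinations.module.span class_ring (module_vec TYPE('f) n) S"

text \<open>The coefficient of \<open>entry T b\<close> in \<open>w\<close> with respect to the basis formed by the entries of \<open>T\<close>.\<close>

definition tab_coeff :: "nat \<Rightarrow> 'f::field tableau \<Rightarrow> nat \<times> nat \<Rightarrow> 'f vec \<Rightarrow> 'f" where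
  "tab_coeff n T b w = (THE c. \<exists>a.
     w = LinearCombinations.module.lincomb (module_vec TYPE('f) n) a (set (concat T)) \<and>
     c = a (entry T b))"

definition U_grp :: "nat \<Rightarrow> 'f::field tableau \<Rightarrow> 'f mat set" where
  "U_grp n T = {g \<in> carrier (GL n). \<forall>b \<in> boxes T.
     g *\<^sub>v entry T b - entry T b \<in> vec_span n {entry T b' | b'. b' \<in> boxes T \<and> snd b' < snd b}}"

definition P_grp :: "nat \<Rightarrow> 'f::field tableau \<Rightarrow> 'f mat set" where
  "P_grp n T = {g \<in> carrier (GL n). \<forall>b \<in> boxes T.
     g *\<^sub>v entry T b \<in> vec_span n {entry T b' | b'. b' \<in> boxes T \<and> snd b' \<ge> snd b}}"

definition psi :: "nat \<Rightarrow> ('f \<Rightarrow> 'k) \<Rightarrow> 'f::field tableau \<Rightarrow> 'f mat \<Rightarrow> 'k::field" where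
  "psi n \<theta> T u = \<theta> (\<Sum>(r, c) \<in> {(r, c). (r, c) \<in> boxes T \<and> (r, Suc c) \<in> boxes T}.
     tab_coeff n T (r, c) (u *\<^sub>v entry T (r, Suc c)))"

definition tab_module :: "nat \<Rightarrow> nat list \<Rightarrow> ('k::field, 'f::field tableau \<Rightarrow> 'k, 'f mat) gmodule" where
  "tab_module n lam = perm_module (GL n) (tableaux n lam) tab_act"

definition m_vec :: "nat \<Rightarrow> 'f::field tableau \<Rightarrow> 'f tableau \<Rightarrow> 'k::field" where
  "m_vec n T = (\<lambda>S. \<Sum>p \<in> P_grp n T. if S = tab_act p T then 1 else 0)"

definition e_vec :: "nat \<Rightarrow> ('f \<Rightarrow> 'k) \<Rightarrow> 'f::field tableau \<Rightarrow> 'f tableau \<Rightarrow> 'k::field" where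
  "e_vec n \<theta> T = (\<lambda>S. \<Sum>u \<in> U_grp n T. psi n \<theta> T (inv\<^bsub>GL n\<^esub> u) * m_vec n (tab_act u T) S)"

definition M_space :: "nat \<Rightarrow> nat list \<Rightarrow> ('f::field tableau \<Rightarrow> 'k::field) set" where
  "M_space n lam = LinearCombinations.module.span class_ring
     (tab_module n lam :: ('k, 'f tableau \<Rightarrow> 'k, 'f mat) gmodule) (m_vec n ` tableaux n lam)"

definition S_space :: "nat \<Rightarrow> ('f \<Rightarrow> 'k) \<Rightarrow> nat list \<Rightarrow> ('f::field tableau \<Rightarrow> 'k::field) set" where
  "S_space n \<theta> lam = LinearCombinations.module.span class_ring
     (tab_module n lam :: ('k, 'f tableau \<Rightarrow> 'k, 'f mat) gmodule) (e_vec n \<theta> ` tableaux n lam)"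

text \<open>
  The bilinear form on \<open>M\<^sup>\<lambda>\<close> for which the distinct \<open>m\<^sub>T\<close> are orthonormal.  The distinct \<open>m\<^sub>T\<close> form a
  basis of \<open>M\<^sup>\<lambda>\<close>, so the two conditions determine the form on \<open>M\<^sup>\<lambda>\<close>.
\<close>

definition is_tab_form ::
  "nat \<Rightarrow> nat list \<Rightarrow> (('f::field tableau \<Rightarrow> 'k::field) \<Rightarrow> ('f tableau \<Rightarrow> 'k) \<Rightarrow> 'k) \<Rightarrow> bool" where
  "is_tab_form n lam B \<longleftrightarrow>
     (\<forall>x \<in> M_space n lam. \<forall>y \<in> M_space n lam. \<forall>z \<in> M_space n lam. \<forall>a b.
        B (\<lambda>S. a * x S + b * y S) z = a * B x z + b * B y z \<and>
        B z (\<lambda>S. a * x S + b * y S) = a * B z x + b * B z y) \<and>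
     (\<forall>T \<in> tableaux n lam. \<forall>T' \<in> tableaux n lam.
        B (m_vec n T) (m_vec n T') = (if (m_vec n T :: _ \<Rightarrow> 'k) = m_vec n T' then 1 else 0))"

definition tab_form ::
  "nat \<Rightarrow> nat list \<Rightarrow> ('f::field tableau \<Rightarrow> 'k::field) \<Rightarrow> ('f tableau \<Rightarrow> 'k) \<Rightarrow> 'k" where
  "tab_form n lam = (SOME B. is_tab_form n lam B)"

definition S_perp :: "nat \<Rightarrow> ('f \<Rightarrow> 'k) \<Rightarrow> nat list \<Rightarrow> ('f::field tableau \<Rightarrow> 'k::field) set" where
  "S_perp n \<theta> lam = {x \<in> M_space n lam. \<forall>s \<in> S_space n \<theta> lam. tab_form n lam x s = 0}"

definition D_module ::
  "nat \<Rightarrow> ('f \<Rightarrow> 'k) \<Rightarrow> nat list \<Rightarrow> ('k::field, ('f::field tableau \<Rightarrow> 'k) set, 'f mat) gmodule" where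
  "D_module n \<theta> lam = kg_quot ((tab_module n lam)\<lparr>carrier := S_space n \<theta> lam\<rparr>)
     (S_space n \<theta> lam \<inter> S_perp n \<theta> lam)"

end

theory Submission
  imports Defs "HOL-Library.Function_Algebras" "HOL-Library.FuncSet" "HOL-Library.Infinite_Set"
begin

text \<open>
  Fix \<open>\<lambda>\<close> and let \<open>U\<close>, \<open>\<psi>\<close> be the group and the character of a tableau of shape \<open>\<lambda>\<close>.  The key point
  is a bound on flags: if \<open>\<psi>\<close> is trivial on the intersection of \<open>U\<close> with the stabiliser of a flag
  \<open>F\<close>, then testing \<open>\<psi>\<close> on transvections shows that the nilpotent map sending every box to its right
  neighbour lowers \<open>F\<close>, up to terms in columns further left.  Passing to leading indices attaches to
  each box a level that strictly decreases along rows, and the number of boxes of each level is a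
  block size of \<open>F\<close>.  Hence any \<open>k\<close> block sizes add up to at most the number of boxes in the first
  \<open>k\<close> columns.

  Consequently a subquotient of the functions on flags of type \<open>\<nu>\<close> contains a \<open>\<psi>\<close>-eigenvector only if
  \<open>\<lambda>' \<unrhd> \<nu>\<close>.  When \<open>F\<close> has the type of \<open>M\<^sup>\<lambda>\<close>, equality everywhere puts \<open>F\<close> into general position, so
  the \<open>\<psi>\<close>-eigenspace of \<open>M\<^sup>\<lambda>\<close> is the line spanned by \<open>e\<^sub>T\<close>.  This gives the submodule theorem and the
  irreducibility of \<open>D\<^sup>\<lambda>\<close>, which therefore is some James module \<open>D\<^bsub>f(\<lambda>)\<^esub>\<close>.  Since \<open>D\<^sup>\<lambda>\<close> has a
  \<open>\<psi>\<close>-eigenvector, \<open>\<lambda>' \<unrhd> f(\<lambda>)\<close> and \<open>f\<close> is injective.  So \<open>\<lambda> \<mapsto> f(\<lambda>')\<close> is an injective self-map of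
  a finite poset that never goes up; it must be the identity.
\<close>

text \<open>Three points behind these steps. The form is bilinear and \<psi> takes values in an
  arbitrary field, so pairing \<open>x\<close> with the translates of \<open>e_vec\<close> yields a
  function that transforms by the inverse of \<psi>. Conjugation by the diagonal matrix
  \<open>torus\<close> with entries (-1)^column inverts \<psi> and brings this function back to a
  \<psi>-eigenvector; the same matrix shows that the form does not vanish on \<open>S_space\<close>.
  Eigenvectors lift from quotients by averaging, since the order of \<open>U\<close> is a power of q
  and hence nonzero in the coefficient field. That \<open>D_module\<close> is a James module rests
  on its being a composition factor of Ind_B^G(1): tableaux correspond to invertible matrices and
  the \<open>m_vec\<close> to cosets of a parabolic subgroup that contains the upper triangular
  matrices. The factor that \<open>james_modules\<close> provides for the partition (1^n) brings a
  composition series along, and an irreducible subquotient is located inside this single series by a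
  butterfly argument.\<close>

section \<open>Isomorphisms of modules\<close>

definition kg_iso_map where
  "kg_iso_map G V W \<phi> \<longleftrightarrow> kg_module G V \<and> kg_module G W \<and> bij_betw \<phi> (carrier V) (carrier W) \<and>
     (\<forall>x\<in>carrier V. \<forall>y\<in>carrier V. \<phi> (x \<oplus>\<^bsub>V\<^esub> y) = \<phi> x \<oplus>\<^bsub>W\<^esub> \<phi> y) \<and>
     (\<forall>x\<in>carrier V. \<forall>c. \<phi> (c \<odot>\<^bsub>V\<^esub> x) = c \<odot>\<^bsub>W\<^esub> \<phi> x) \<and>
     (\<forall>g\<in>carrier G. \<forall>x\<in>carrier V. \<phi> (gact V g x) = gact W g (\<phi> x))"

lemma kg_iso_iff: "kg_iso G V W \<longleftrightarrow> (\<exists>\<phi>. kg_iso_map G V W \<phi>)"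
proof -
  have "kg_iso_map G V W \<phi> \<longleftrightarrow> kg_module G V \<and> kg_module G W \<and>
      \<phi> \<in> LinearCombinations.module_hom class_ring V W \<and> bij_betw \<phi> (carrier V) (carrier W) \<and>
      (\<forall>g\<in>carrier G. \<forall>v\<in>carrier V. \<phi> (gact V g v) = gact W g (\<phi> v))" for \<phi>
    unfolding kg_iso_map_def LinearCombinations.module_hom_def by (auto simp: bij_betw_def Pi_iff)
  then show ?thesis unfolding kg_iso_def by blast
qed

lemma kg_iso_mapD:
  assumes "kg_iso_map G V W \<phi>"
  shows "kg_module G V" "kg_module G W" "bij_betw \<phi> (carrier V) (carrier W)"
    "x \<in> carrier V \<Longrightarrow> y \<in> carrier V \<Longrightarrow> \<phi> (x \<oplus>\<^bsub>V\<^esub> y) = \<phi> x \<oplus>\<^bsub>W\<^esub> \<phi> y"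
    "x \<in> carrier V \<Longrightarrow> \<phi> (c \<odot>\<^bsub>V\<^esub> x) = c \<odot>\<^bsub>W\<^esub> \<phi> x"
    "g \<in> carrier G \<Longrightarrow> x \<in> carrier V \<Longrightarrow> \<phi> (gact V g x) = gact W g (\<phi> x)"
  using assms unfolding kg_iso_map_def by auto

lemma kg_isoI:
  assumes "kg_module G V" "kg_module G W" "bij_betw \<phi> (carrier V) (carrier W)"
    "\<And>x y. x \<in> carrier V \<Longrightarrow> y \<in> carrier V \<Longrightarrow> \<phi> (x \<oplus>\<^bsub>V\<^esub> y) = \<phi> x \<oplus>\<^bsub>W\<^esub> \<phi> y"
    "\<And>c x. x \<in> carrier V \<Longrightarrow> \<phi> (c \<odot>\<^bsub>V\<^esub> x) = c \<odot>\<^bsub>W\<^esub> \<phi> x"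
    "\<And>g x. g \<in> carrier G \<Longrightarrow> x \<in> carrier V \<Longrightarrow> \<phi> (gact V g x) = gact W g (\<phi> x)"
  shows "kg_iso G V W"
  unfolding kg_iso_iff kg_iso_map_def using assms by (intro exI[of _ \<phi>]) auto

lemma kg_module_closed:
  assumes "kg_module G V"
  shows "x \<in> carrier V \<Longrightarrow> y \<in> carrier V \<Longrightarrow> x \<oplus>\<^bsub>V\<^esub> y \<in> carrier V"
    and "x \<in> carrier V \<Longrightarrow> c \<odot>\<^bsub>V\<^esub> x \<in> carrier V"
    and "\<zero>\<^bsub>V\<^esub> \<in> carrier V"
    and "g \<in> carrier G \<Longrightarrow> x \<in> carrier V \<Longrightarrow> gact V g x \<in> carrier V"
    and "x \<in> carrier V \<Longrightarrow> 0 \<odot>\<^bsub>V\<^esub> x = \<zero>\<^bsub>V\<^esub>"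
proof -
  interpret kg_module G V by fact
  show "x \<in> carrier V \<Longrightarrow> y \<in> carrier V \<Longrightarrow> x \<oplus>\<^bsub>V\<^esub> y \<in> carrier V" by simp
  show "x \<in> carrier V \<Longrightarrow> c \<odot>\<^bsub>V\<^esub> x \<in> carrier V" by simp
  show "\<zero>\<^bsub>V\<^esub> \<in> carrier V" by simp
  show "g \<in> carrier G \<Longrightarrow> x \<in> carrier V \<Longrightarrow> gact V g x \<in> carrier V"
    using gact_hom unfolding LinearCombinations.module_hom_def by (auto simp: Pi_iff)
  show "x \<in> carrier V \<Longrightarrow> 0 \<odot>\<^bsub>V\<^esub> x = \<zero>\<^bsub>V\<^esub>" using V.smult_l_null by simp
qed

lemma kg_iso_sym:
  assumes "kg_iso G V W" shows "kg_iso G W V"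
proof -
  obtain \<phi> where "kg_iso_map G V W \<phi>" using assms unfolding kg_iso_iff ..
  note p = kg_iso_mapD[OF this]
  let ?f = "inv_into (carrier V) \<phi>"
  have inj: "inj_on \<phi> (carrier V)" and im: "\<phi> ` carrier V = carrier W"
    using p(3) by (auto simp: bij_betw_def)
  have fin: "?f y \<in> carrier V" and pf: "\<phi> (?f y) = y" if "y \<in> carrier W" for y
    using that im by (auto intro: inv_into_into f_inv_into_f)
  have fp: "?f y = x" if "x \<in> carrier V" "\<phi> x = y" for x y
    using that inj by auto
  note cl = kg_module_closed[OF p(1)]
  show ?thesis
  proof (rule kg_isoI[OF p(2,1), of ?f])
    show "bij_betw ?f (carrier W) (carrier V)" using p(3) by (rule bij_betw_inv_into)
  qed (auto intro!: fp simp: fin cl p pf)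
qed

lemma kg_iso_trans:
  assumes "kg_iso G V W" "kg_iso G W X" shows "kg_iso G V X"
proof -
  obtain \<phi> where "kg_iso_map G V W \<phi>" using assms(1) unfolding kg_iso_iff ..
  note p = kg_iso_mapD[OF this]
  obtain \<phi>' where "kg_iso_map G W X \<phi>'" using assms(2) unfolding kg_iso_iff ..
  note q = kg_iso_mapD[OF this]
  have m: "\<phi> x \<in> carrier W" if "x \<in> carrier V" for x using p(3) that by (auto simp: bij_betw_def)
  show ?thesis
    by (rule kg_isoI[OF p(1) q(2), of "\<phi>' \<circ> \<phi>"])
      (auto simp: m p q kg_module_closed[OF p(1)] intro: bij_betw_trans[OF p(3) q(3)])
qed

text \<open>Homogeneity suffices because zero is \<open>0\<close> times itself on both
  sides.\<close>

lemma kg_iso_zero: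
  assumes "kg_module G V" "kg_module G W"
    and "\<And>c x. x \<in> carrier V \<Longrightarrow> \<phi> (c \<odot>\<^bsub>V\<^esub> x) = c \<odot>\<^bsub>W\<^esub> \<phi> x"
    and "\<phi> \<zero>\<^bsub>V\<^esub> \<in> carrier W"
  shows "\<phi> \<zero>\<^bsub>V\<^esub> = \<zero>\<^bsub>W\<^esub>"
  using assms kg_module_closed[OF assms(1)] kg_module_closed[OF assms(2)] by metis

lemma kg_submoduleD:
  assumes "kg_submodule G V N"
  shows "N \<subseteq> carrier V" "\<zero>\<^bsub>V\<^esub> \<in> N" "x \<in> N \<Longrightarrow> y \<in> N \<Longrightarrow> x \<oplus>\<^bsub>V\<^esub> y \<in> N"
    "x \<in> N \<Longrightarrow> c \<odot>\<^bsub>V\<^esub> x \<in> N" "g \<in> carrier G \<Longrightarrow> x \<in> N \<Longrightarrow> gact V g x \<in> N"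
  using assms unfolding kg_submodule_def VectorSpace.subspace_def LinearCombinations.submodule_def
  by (auto simp: image_subset_iff)

lemma kg_submoduleI:
  assumes "kg_module G V" "N \<subseteq> carrier V" "\<zero>\<^bsub>V\<^esub> \<in> N"
    "\<And>x y. x \<in> N \<Longrightarrow> y \<in> N \<Longrightarrow> x \<oplus>\<^bsub>V\<^esub> y \<in> N"
    "\<And>c x. x \<in> N \<Longrightarrow> c \<odot>\<^bsub>V\<^esub> x \<in> N"
    "\<And>g x. g \<in> carrier G \<Longrightarrow> x \<in> N \<Longrightarrow> gact V g x \<in> N"
  shows "kg_submodule G V N"
proof -
  interpret kg_module G V by fact
  show ?thesis
    unfolding kg_submodule_def VectorSpace.subspace_def LinearCombinations.submodule_def
    using assms V.vectorspace_axioms V.module_axioms by auto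
qed

lemma kg_irreducible_iso:
  assumes "kg_iso G V W" "kg_irreducible G W" shows "kg_irreducible G V"
proof -
  obtain \<phi> where "kg_iso_map G V W \<phi>" using assms(1) unfolding kg_iso_iff ..
  note p = kg_iso_mapD[OF this]
  have inj: "inj_on \<phi> (carrier V)" and im: "\<phi> ` carrier V = carrier W"
    using p(3) by (auto simp: bij_betw_def)
  note cl = kg_module_closed[OF p(1)]
  have z: "\<phi> \<zero>\<^bsub>V\<^esub> = \<zero>\<^bsub>W\<^esub>"
    using im cl(3) by (intro kg_iso_zero[OF p(1,2,5)]) auto
  have "N = {\<zero>\<^bsub>V\<^esub>} \<or> N = carrier V" if N: "kg_submodule G V N" for N
  proof -
    note sub = kg_submoduleD[OF N]
    have s: "x \<in> N \<Longrightarrow> x \<in> carrier V" for x using sub(1) by auto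
    have "kg_submodule G W (\<phi> ` N)"
    proof (rule kg_submoduleI[OF p(2)])
      show "\<phi> ` N \<subseteq> carrier W" using sub(1) im by auto
      show "\<zero>\<^bsub>W\<^esub> \<in> \<phi> ` N" using sub(2) z by force
      show "x \<oplus>\<^bsub>W\<^esub> y \<in> \<phi> ` N" if "x \<in> \<phi> ` N" "y \<in> \<phi> ` N" for x y
        using that s p(4) sub(3) by (auto simp flip: p(4))
      show "c \<odot>\<^bsub>W\<^esub> x \<in> \<phi> ` N" if "x \<in> \<phi> ` N" for c x
        using that s sub(4) by (auto simp flip: p(5))
      show "gact W g x \<in> \<phi> ` N" if "g \<in> carrier G" "x \<in> \<phi> ` N" for g x
        using that s sub(5) by (auto simp flip: p(6))
    qed
    then have "\<phi> ` N = {\<zero>\<^bsub>W\<^esub>} \<or> \<phi> ` N = carrier W"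
      using assms(2) unfolding kg_irreducible_def by blast
    then have "\<phi> ` N = \<phi> ` {\<zero>\<^bsub>V\<^esub>} \<or> \<phi> ` N = \<phi> ` carrier V" using z im by simp
    then show ?thesis
      using inj_on_image_eq_iff[OF inj] sub(1) cl(3) by (metis empty_subsetI insert_subset order_refl)
  qed
  moreover have "carrier V \<noteq> {\<zero>\<^bsub>V\<^esub>}"
    using assms(2) im z unfolding kg_irreducible_def by auto
  ultimately show ?thesis using p(1) unfolding kg_irreducible_def by blast
qed

text \<open>The invariant that tells the modules apart; it will be used with the group and the
  character of a shape.\<close>

definition has_eigenvector ::
  "('k, 'v, 'g) gmodule \<Rightarrow> 'g set \<Rightarrow> ('g \<Rightarrow> 'k) \<Rightarrow> bool" where
  "has_eigenvector V U \<chi> \<longleftrightarrow>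
     (\<exists>v \<in> carrier V. v \<noteq> \<zero>\<^bsub>V\<^esub> \<and> (\<forall>u\<in>U. gact V u v = \<chi> u \<odot>\<^bsub>V\<^esub> v))"

lemma has_eigenvector_iso:
  assumes "kg_iso G V W" "U \<subseteq> carrier G" "has_eigenvector V U \<chi>"
  shows "has_eigenvector W U \<chi>"
proof -
  obtain \<phi> where "kg_iso_map G V W \<phi>" using assms(1) unfolding kg_iso_iff ..
  note p = kg_iso_mapD[OF this]
  have inj: "inj_on \<phi> (carrier V)" and im: "\<phi> ` carrier V = carrier W"
    using p(3) by (auto simp: bij_betw_def)
  note cl = kg_module_closed[OF p(1)]
  have z: "\<phi> \<zero>\<^bsub>V\<^esub> = \<zero>\<^bsub>W\<^esub>"
    using im cl(3) by (intro kg_iso_zero[OF p(1,2,5)]) auto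
  obtain v where v: "v \<in> carrier V" "v \<noteq> \<zero>\<^bsub>V\<^esub>" "\<And>u. u \<in> U \<Longrightarrow> gact V u v = \<chi> u \<odot>\<^bsub>V\<^esub> v"
    using assms(3) unfolding has_eigenvector_def by auto
  have "\<phi> v \<in> carrier W" using v im by auto
  moreover have "\<phi> v \<noteq> \<zero>\<^bsub>W\<^esub>" using inj v z cl(3) by (metis inj_onD)
  moreover have "gact W u (\<phi> v) = \<chi> u \<odot>\<^bsub>W\<^esub> \<phi> v" if "u \<in> U" for u
    using v p(5,6) that assms(2) by (metis subsetD)
  ultimately show ?thesis unfolding has_eigenvector_def by blast
qed

section \<open>Representations on spaces of functions\<close>

definition fscale :: "'k \<Rightarrow> ('x \<Rightarrow> 'k) \<Rightarrow> 'x \<Rightarrow> 'k::field" where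
  "fscale c f = (\<lambda>x. c * f x)"

lemma fscale_simps [simp]:
  "fscale c f x = c * f x"
  "fscale 0 f = 0" "fscale 1 f = f" "fscale c 0 = 0"
  "fscale c (fscale d f) = fscale (c * d) f"
  by (auto simp: fscale_def fun_eq_iff)

lemma fscale_add: "fscale c (f + g) = fscale c f + fscale c g"
  and fscale_diff: "fscale c (f - g) = fscale c f - fscale c g"
  and fscale_add_left: "fscale (c + d) f = fscale c f + fscale d f"
  by (auto simp: fun_eq_iff algebra_simps)

lemma fscale_minus1: "fscale (- 1) f = - f"
  by (auto simp: fun_eq_iff)

lemma fscale_sum: "fscale c (sum f A) = (\<Sum>a\<in>A. fscale c (f a))"
  by (induction A rule: infinite_finite_induct)
    (simp_all only: sum.insert sum.empty sum.infinite fscale_simps(4) fscale_add not_False_eq_True)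

lemma sum_fun_apply: "sum f A x = (\<Sum>a\<in>A. f a x)" for f :: "'a \<Rightarrow> 'x \<Rightarrow> 'k::comm_monoid_add"
  by (induction A rule: infinite_finite_induct) auto

text \<open>All concrete modules (functions on cosets, functions on tableaux, their submodules) have
  this form with pointwise operations, so passing to a submodule only changes the set
  \<open>W\<close>.\<close>

definition fun_gmod ::
  "('g \<Rightarrow> ('x \<Rightarrow> 'k) \<Rightarrow> 'x \<Rightarrow> 'k) \<Rightarrow> ('x \<Rightarrow> 'k::field) set \<Rightarrow> ('k, 'x \<Rightarrow> 'k, 'g) gmodule" where
  "fun_gmod act W = \<lparr>carrier = W, mult = undefined, one = undefined, zero = 0, add = (+),
     smult = fscale, gact = act\<rparr>"

lemma fun_gmod_simps [simp]:
  "carrier (fun_gmod act W) = W" "zero (fun_gmod act W) = 0" "add (fun_gmod act W) = (+)"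
  "smult (fun_gmod act W) = fscale" "gact (fun_gmod act W) = act"
  "(fun_gmod act W)\<lparr>carrier := W'\<rparr> = fun_gmod act W'"
  by (simp_all add: fun_gmod_def)

text \<open>The laws are required on \<open>W\<close> only: \<open>ltrans\<close> and
  \<open>tact\<close> cut functions off outside the group or the tableaux, so the unit law fails for
  arbitrary functions.\<close>

locale fun_rep = group G for G :: "('g, 'm) monoid_scheme" +
  fixes act :: "'g \<Rightarrow> ('x \<Rightarrow> 'k) \<Rightarrow> 'x \<Rightarrow> 'k::field" and W :: "('x \<Rightarrow> 'k) set"
  assumes zero_mem: "0 \<in> W"
    and add_mem: "x \<in> W \<Longrightarrow> y \<in> W \<Longrightarrow> x + y \<in> W"
    and scale_mem: "x \<in> W \<Longrightarrow> fscale c x \<in> W"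
    and act_mem: "g \<in> carrier G \<Longrightarrow> x \<in> W \<Longrightarrow> act g x \<in> W"
    and act_add: "g \<in> carrier G \<Longrightarrow> x \<in> W \<Longrightarrow> y \<in> W \<Longrightarrow> act g (x + y) = act g x + act g y"
    and act_scale: "g \<in> carrier G \<Longrightarrow> x \<in> W \<Longrightarrow> act g (fscale c x) = fscale c (act g x)"
    and act_one: "x \<in> W \<Longrightarrow> act \<one>\<^bsub>G\<^esub> x = x"
    and act_mult: "g \<in> carrier G \<Longrightarrow> h \<in> carrier G \<Longrightarrow> x \<in> W \<Longrightarrow>
      act (g \<otimes>\<^bsub>G\<^esub> h) x = act g (act h x)"
begin

lemma minus_mem: "x \<in> W \<Longrightarrow> - x \<in> W"
  using scale_mem[of x "- 1"] by (simp add: fscale_minus1)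

lemma diff_mem: "x \<in> W \<Longrightarrow> y \<in> W \<Longrightarrow> x - y \<in> W"
  using add_mem[of x "- y"] minus_mem[of y] by simp

lemma add_mem_iff: "x \<in> W \<Longrightarrow> x + y \<in> W \<longleftrightarrow> y \<in> W"
  using add_mem diff_mem by (metis add_diff_cancel_left')

lemma diff_mem_iff: "x - y \<in> W \<Longrightarrow> x \<in> W \<longleftrightarrow> y \<in> W"
  using add_mem_iff[of "x - y" y] by simp

lemma sum_mem: "(\<And>a. a \<in> A \<Longrightarrow> f a \<in> W) \<Longrightarrow> sum f A \<in> W"
  by (induction A rule: infinite_finite_induct) (auto simp: zero_mem add_mem)

lemma act_zero: "g \<in> carrier G \<Longrightarrow> act g 0 = 0"
  using act_scale[of g 0 0] zero_mem by simp

lemma act_diff: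
  "g \<in> carrier G \<Longrightarrow> x \<in> W \<Longrightarrow> y \<in> W \<Longrightarrow> act g (x - y) = act g x - act g y"
  using act_add[of g "x - y" y] by (simp add: diff_mem)

lemma act_sum:
  "g \<in> carrier G \<Longrightarrow> (\<And>a. a \<in> A \<Longrightarrow> f a \<in> W) \<Longrightarrow> act g (sum f A) = (\<Sum>a\<in>A. act g (f a))"
  by (induction A rule: infinite_finite_induct) (auto simp: act_zero act_add sum_mem)

lemma kg_module: "kg_module G (fun_gmod act W)"
proof -
  have "vectorspace class_ring (fun_gmod act W)"
    by (rule VectorSpace.vs_criteria)
      (auto simp: class_field zero_mem add_mem scale_mem fscale_add fscale_add_left
        algebra_simps intro!: bexI[OF _ minus_mem])
  then show ?thesis
    unfolding kg_module_def kg_module_axioms_def LinearCombinations.module_hom_def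
    using act_mem act_add act_scale act_one act_mult group_axioms by auto
qed

end

lemma fun_rep_subset:
  assumes "fun_rep G act V" "W \<subseteq> V" "0 \<in> W"
    and "\<And>x y. x \<in> W \<Longrightarrow> y \<in> W \<Longrightarrow> x + y \<in> W"
    and "\<And>c x. x \<in> W \<Longrightarrow> fscale c x \<in> W"
    and "\<And>g x. g \<in> carrier G \<Longrightarrow> x \<in> W \<Longrightarrow> act g x \<in> W"
  shows "fun_rep G act W"
proof -
  interpret fun_rep G act V by fact
  show ?thesis
    using assms by unfold_locales (auto simp: act_add act_scale act_one act_mult subsetD)
qed

lemma kg_submodule_fun_gmod:
  assumes "fun_rep G act V"
  shows "kg_submodule G (fun_gmod act V) W \<longleftrightarrow> W \<subseteq> V \<and> fun_rep G act W"
proof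
  assume a: "kg_submodule G (fun_gmod act V) W"
  then show "W \<subseteq> V \<and> fun_rep G act W"
    using kg_submoduleD[OF a] by (auto intro!: fun_rep_subset[OF assms])
next
  assume a: "W \<subseteq> V \<and> fun_rep G act W"
  then interpret W: fun_rep G act W by simp
  show "kg_submodule G (fun_gmod act V) W"
    using a W.zero_mem W.add_mem W.scale_mem W.act_mem fun_rep.kg_module[OF assms]
    by (intro kg_submoduleI) auto
qed

section \<open>Quotients of function representations\<close>

locale fun_subrep = V: fun_rep G act V + R: fun_rep G act R
  for G :: "('g, 'm) monoid_scheme" and act :: "'g \<Rightarrow> ('x \<Rightarrow> 'k) \<Rightarrow> 'x \<Rightarrow> 'k::field" and V R +
  assumes sub: "R \<subseteq> V"
begin

definition cs :: "('x \<Rightarrow> 'k) \<Rightarrow> ('x \<Rightarrow> 'k) set" where "cs x = {y. y - x \<in> R}"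

lemma mem_cs [simp]: "y \<in> cs x \<longleftrightarrow> y - x \<in> R"
  by (simp add: cs_def)

abbreviation Q where "Q \<equiv> kg_quot (fun_gmod act V) R"

lemma r_coset: "R +>\<^bsub>fun_gmod act V\<^esub> x = cs x"
  unfolding a_r_coset_def' by (auto simp: intro!: bexI[of _ "_ - x"])

lemma cs_eq: "cs x = cs y \<longleftrightarrow> x - y \<in> R"
proof
  assume "cs x = cs y"
  moreover have "x \<in> cs x" using R.zero_mem by simp
  ultimately show "x - y \<in> R" by auto
next
  assume a: "x - y \<in> R"
  have "z - x \<in> R \<longleftrightarrow> z - y \<in> R" for z
    using R.add_mem_iff[OF a, of "z - x"] by simp
  then show "cs x = cs y" by (auto simp: cs_def)
qed

lemma carrier_Q: "carrier Q = cs ` V"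
  unfolding kg_quot_def A_RCOSETS_def' by (auto simp: r_coset)

lemma zero_Q: "\<zero>\<^bsub>Q\<^esub> = R" "\<zero>\<^bsub>Q\<^esub> = cs 0"
  unfolding kg_quot_def by (auto simp: cs_def)

text \<open>The operations of \<open>kg_quot\<close> are unions over all representatives. If
  \<open>f\<close> respects congruence modulo \<open>R\<close>, all members of the union coincide,
  and any representative computes it.\<close>

lemma union_cs:
  assumes "\<And>y. y - x \<in> R \<Longrightarrow> f y - f x \<in> R"
  shows "(\<Union>y\<in>cs x. cs (f y)) = cs (f x)"
proof -
  have "cs (f y) = cs (f x)" if "y \<in> cs x" for y
    unfolding cs_eq using assms that by simp
  moreover have "x \<in> cs x" using R.zero_mem by simp
  ultimately show ?thesis by blast
qed

lemma add_Q:
  assumes "x \<in> V" "y \<in> V" shows "cs x \<oplus>\<^bsub>Q\<^esub> cs y = cs (x + y)"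
proof -
  have "set_add (fun_gmod act V) (cs x) (cs y) = cs (x + y)"
  proof (rule Set.set_eqI)
    fix z
    have "z - (x + y) \<in> R \<Longrightarrow> \<exists>a b. a - x \<in> R \<and> b - y \<in> R \<and> z = a + b"
      by (rule exI[of _ "z - y"], rule exI[of _ y]) (auto simp: algebra_simps R.zero_mem)
    moreover have "a + b - (x + y) \<in> R" if "a - x \<in> R" "b - y \<in> R" for a b
      using R.add_mem[OF that] by (simp add: algebra_simps)
    ultimately show "z \<in> set_add (fun_gmod act V) (cs x) (cs y) \<longleftrightarrow> z \<in> cs (x + y)"
      unfolding set_add_def' by (simp add: Bex_def) blast
  qed
  then show ?thesis unfolding kg_quot_def by simp
qed

lemma smult_Q:
  assumes "x \<in> V" shows "c \<odot>\<^bsub>Q\<^esub> cs x = cs (fscale c x)"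
proof -
  have "c \<odot>\<^bsub>Q\<^esub> cs x = (\<Union>y\<in>cs x. cs (fscale c y))"
    unfolding kg_quot_def by (simp add: r_coset)
  also have "\<dots> = cs (fscale c x)"
    by (rule union_cs) (auto simp flip: fscale_diff intro: R.scale_mem)
  finally show ?thesis .
qed

lemma gact_Q:
  assumes "x \<in> V" "g \<in> carrier G" shows "gact Q g (cs x) = cs (act g x)"
proof -
  have "gact Q g (cs x) = (\<Union>y\<in>cs x. cs (act g y))"
    unfolding kg_quot_def by (simp add: r_coset)
  also have "\<dots> = cs (act g x)"
  proof (rule union_cs)
    fix y assume "y - x \<in> R"
    then have "y \<in> V" using assms(1) V.add_mem[of "y - x" x] sub by auto
    then show "act g y - act g x \<in> R"
      using V.act_diff[OF assms(2) _ assms(1)] R.act_mem[OF assms(2) \<open>y - x \<in> R\<close>] by simp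
  qed
  finally show ?thesis .
qed

lemmas Q_simps = carrier_Q zero_Q(2) add_Q smult_Q gact_Q

lemma kg_module_Q: "kg_module G Q"
proof -
  have "vectorspace class_ring Q"
  proof (rule VectorSpace.vs_criteria)
    show "\<forall>v\<in>carrier Q. \<exists>neg_v\<in>carrier Q. v \<oplus>\<^bsub>Q\<^esub> neg_v = \<zero>\<^bsub>Q\<^esub>"
    proof
      fix v assume "v \<in> carrier Q"
      then obtain x where x: "x \<in> V" "v = cs x" by (auto simp: carrier_Q)
      then have "v \<oplus>\<^bsub>Q\<^esub> cs (- x) = \<zero>\<^bsub>Q\<^esub>"
        using add_Q[OF x(1) V.minus_mem[OF x(1)]] by (simp add: zero_Q(2))
      then show "\<exists>neg_v\<in>carrier Q. v \<oplus>\<^bsub>Q\<^esub> neg_v = \<zero>\<^bsub>Q\<^esub>"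
        unfolding carrier_Q using V.minus_mem[OF x(1)] by blast
    qed
  qed (auto simp: class_field Q_simps V.zero_mem V.add_mem V.scale_mem fscale_add fscale_add_left
        algebra_simps simp del: Collect_const)
  moreover have "gact Q g \<in> LinearCombinations.module_hom class_ring Q Q" if "g \<in> carrier G" for g
    using that unfolding LinearCombinations.module_hom_def
    by (auto simp: Q_simps V.act_mem V.add_mem V.scale_mem V.act_add V.act_scale)
  ultimately show ?thesis
    unfolding kg_module_def kg_module_axioms_def
    using V.group_axioms by (auto simp: Q_simps V.act_mem V.act_one V.act_mult)
qed

text \<open>\<open>N\<close> is recovered from its image in the quotient: since \<open>R\<close>
  lies in \<open>N\<close>, membership in \<open>N\<close> depends only on the coset.\<close>

lemma irreducible_quotD:
  assumes "kg_irreducible G Q" "fun_rep G act N" "R \<subseteq> N" "N \<subseteq> V"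
  shows "N = R \<or> N = V"
proof -
  interpret N: fun_rep G act N by fact
  have s: "x \<in> N \<Longrightarrow> x \<in> V" for x using assms(4) by auto
  have "kg_submodule G Q (cs ` N)"
  proof (rule kg_submoduleI[OF kg_module_Q])
    show "\<zero>\<^bsub>Q\<^esub> \<in> cs ` N" unfolding zero_Q(2) using N.zero_mem by (rule imageI)
  qed (auto simp: Q_simps s N.zero_mem N.add_mem N.scale_mem N.act_mem)
  then have "cs ` N = {cs 0} \<or> cs ` N = cs ` V"
    using assms(1) unfolding kg_irreducible_def by (simp add: Q_simps)
  then show ?thesis
  proof
    assume a: "cs ` N = {cs 0}"
    have "x \<in> R" if "x \<in> N" for x
    proof -
      have "cs x = cs 0" using a that by blast
      then show ?thesis by (simp add: cs_eq)
    qed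
    then show ?thesis using assms(3) by auto
  next
    assume a: "cs ` N = cs ` V"
    have "x \<in> N" if "x \<in> V" for x
    proof -
      have "cs x \<in> cs ` N" unfolding a using that by (rule imageI)
      then obtain y where "cs x = cs y" "y \<in> N" by (rule imageE)
      then show ?thesis using assms(3) N.diff_mem_iff[of x y] by (auto simp: cs_eq)
    qed
    then show ?thesis using assms(4) by auto
  qed
qed

end

lemma fun_subrep_iff:
  "fun_subrep G act V R \<longleftrightarrow> fun_rep G act V \<and> fun_rep G act R \<and> R \<subseteq> V"
  unfolding fun_subrep_def fun_subrep_axioms_def by auto

text \<open>A butterfly argument produces a correspondence rather than a map. Differences of related
  pairs are related, so \<open>iff\<close> makes the coset of any partner well defined and the
  induced map injective.\<close>

lemma kg_iso_quot_relation:
  assumes "fun_subrep G act1 V1 R1" "fun_subrep G act2 V2 R2"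
    and mem: "\<And>x y. rel x y \<Longrightarrow> x \<in> V1 \<and> y \<in> V2"
    and total: "\<And>x. x \<in> V1 \<Longrightarrow> \<exists>y. rel x y"
    and surj: "\<And>y. y \<in> V2 \<Longrightarrow> \<exists>x. rel x y"
    and add: "\<And>x y x' y'. rel x y \<Longrightarrow> rel x' y' \<Longrightarrow> rel (x + x') (y + y')"
    and scale: "\<And>c x y. rel x y \<Longrightarrow> rel (fscale c x) (fscale c y)"
    and act: "\<And>g x y. g \<in> carrier G \<Longrightarrow> rel x y \<Longrightarrow> rel (act1 g x) (act2 g y)"
    and iff: "\<And>x y. rel x y \<Longrightarrow> x \<in> R1 \<longleftrightarrow> y \<in> R2"
  shows "kg_iso G (kg_quot (fun_gmod act1 V1) R1) (kg_quot (fun_gmod act2 V2) R2)"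
proof -
  interpret A: fun_subrep G act1 V1 R1 by fact
  interpret B: fun_subrep G act2 V2 R2 by fact
  have rel_diff: "rel (x - x') (y - y')" if "rel x y" "rel x' y'" for x y x' y'
    using add[OF that(1) scale[OF that(2), of "- 1"]] by (simp add: fscale_minus1)
  define \<phi> where "\<phi> X = B.cs (SOME y. \<exists>x\<in>X. rel x y)" for X
  have \<phi>: "\<phi> (A.cs x) = B.cs y" if r: "rel x y" for x y
  proof -
    have "\<exists>y. \<exists>x'\<in>A.cs x. rel x' y"
      using r A.R.zero_mem by (intro exI[of _ y] bexI[of _ x]) auto
    then have "\<exists>x'\<in>A.cs x. rel x' (SOME y. \<exists>x'\<in>A.cs x. rel x' y)" by (rule someI_ex)
    then obtain x' where x': "x' - x \<in> R1" "rel x' (SOME y. \<exists>x'\<in>A.cs x. rel x' y)" by auto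
    then show ?thesis unfolding \<phi>_def B.cs_eq using iff[OF rel_diff[OF x'(2) r]] by simp
  qed
  define T where "T x = (SOME y. rel x y)" for x
  have T: "rel x (T x)" if "x \<in> V1" for x unfolding T_def using total[OF that] by (rule someI_ex)
  have T2: "T x \<in> V2" if "x \<in> V1" for x using mem[OF T[OF that]] by simp
  have \<phi>T: "\<phi> (A.cs x) = B.cs (T x)" if "x \<in> V1" for x using \<phi>[OF T[OF that]] .
  show ?thesis
  proof (rule kg_isoI[OF A.kg_module_Q B.kg_module_Q, of \<phi>])
    have "inj_on \<phi> (A.cs ` V1)"
    proof (rule inj_onI, clarify)
      fix x y assume xy: "x \<in> V1" "y \<in> V1" "\<phi> (A.cs x) = \<phi> (A.cs y)"
      then have "T x - T y \<in> R2" by (simp add: \<phi>T B.cs_eq)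
      then show "A.cs x = A.cs y"
        using iff[OF rel_diff[OF T[OF xy(1)] T[OF xy(2)]]] by (simp add: A.cs_eq)
    qed
    moreover have "\<phi> ` A.cs ` V1 = B.cs ` V2"
    proof
      show "\<phi> ` A.cs ` V1 \<subseteq> B.cs ` V2" using \<phi>T T2 by auto
      show "B.cs ` V2 \<subseteq> \<phi> ` A.cs ` V1"
      proof clarify
        fix y assume "y \<in> V2"
        then obtain x where "rel x y" using surj by auto
        then show "B.cs y \<in> \<phi> ` A.cs ` V1" using mem \<phi> by blast
      qed
    qed
    ultimately show "bij_betw \<phi> (carrier A.Q) (carrier B.Q)"
      by (simp add: bij_betw_def A.carrier_Q B.carrier_Q)
  next
    fix X Y assume "X \<in> carrier A.Q" "Y \<in> carrier A.Q"
    then obtain x y where xy: "X = A.cs x" "Y = A.cs y" "x \<in> V1" "y \<in> V1" by (auto simp: A.carrier_Q)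
    show "\<phi> (X \<oplus>\<^bsub>A.Q\<^esub> Y) = \<phi> X \<oplus>\<^bsub>B.Q\<^esub> \<phi> Y"
      using \<phi>[OF add[OF T[OF xy(3)] T[OF xy(4)]]] by (simp add: xy A.add_Q \<phi>T B.add_Q T2)
  next
    fix c X assume "X \<in> carrier A.Q"
    then obtain x where x: "X = A.cs x" "x \<in> V1" by (auto simp: A.carrier_Q)
    show "\<phi> (c \<odot>\<^bsub>A.Q\<^esub> X) = c \<odot>\<^bsub>B.Q\<^esub> \<phi> X"
      using \<phi>[OF scale[OF T[OF x(2)]]] by (simp add: x A.smult_Q \<phi>T B.smult_Q T2)
  next
    fix g X assume g: "g \<in> carrier G" and "X \<in> carrier A.Q"
    then obtain x where x: "X = A.cs x" "x \<in> V1" by (auto simp: A.carrier_Q)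
    show "\<phi> (gact A.Q g X) = gact B.Q g (\<phi> X)"
      using \<phi>[OF act[OF g T[OF x(2)]]] by (simp add: g x A.gact_Q \<phi>T B.gact_Q T2)
  qed
qed

text \<open>A one-sided form of Jordan-Hoelder: the subquotient \<open>S\<close> / \<open>R\<close>,
  carried into \<open>V\<close> by the injective map \<open>T\<close>, is found among the factors of
  one given series. Its irreducibility enters through intermediate submodules, which is the form
  that the submodule theorem delivers.\<close>

lemma irreducible_subquotient_composition_factor:
  fixes act1 :: "'g \<Rightarrow> ('x \<Rightarrow> 'k::field) \<Rightarrow> 'x \<Rightarrow> 'k" and act2 :: "'g \<Rightarrow> ('y \<Rightarrow> 'k) \<Rightarrow> 'y \<Rightarrow> 'k"
  assumes "fun_subrep G act1 S R" "R \<noteq> S"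
    and irr: "\<And>N. fun_rep G act1 N \<Longrightarrow> R \<subseteq> N \<Longrightarrow> N \<subseteq> S \<Longrightarrow> N = R \<or> N = S"
    and V: "fun_rep G act2 V"
    and T_mem: "\<And>x. x \<in> S \<Longrightarrow> T x \<in> V"
    and T_add: "\<And>x y. x \<in> S \<Longrightarrow> y \<in> S \<Longrightarrow> T (x + y) = T x + T y"
    and T_scale: "\<And>c x. x \<in> S \<Longrightarrow> T (fscale c x) = fscale c (T x)"
    and T_act: "\<And>g x. g \<in> carrier G \<Longrightarrow> x \<in> S \<Longrightarrow> T (act1 g x) = act2 g (T x)"
    and T_ker: "\<And>x. x \<in> S \<Longrightarrow> T x = 0 \<Longrightarrow> x = 0"
    and Ws: "composition_series G (fun_gmod act2 V) Ws"
  shows "\<exists>C \<in> composition_factors G (fun_gmod act2 V). kg_iso G (kg_quot (fun_gmod act1 S) R) C"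
proof -
  interpret S: fun_subrep G act1 S R by fact
  interpret V: fun_rep G act2 V by fact
  have T0: "T 0 = 0" using T_scale[of 0 0] S.V.zero_mem by simp
  have T_diff: "T (x - y) = T x - T y" if "x \<in> S" "y \<in> S" for x y
    using T_add[of "x - y" y] that S.V.diff_mem by (simp add: algebra_simps)
  have Wrep: "fun_rep G act2 W" "W \<subseteq> V" if "W \<in> set Ws" for W
    using Ws that unfolding composition_series_def kg_submodule_fun_gmod[OF V] by auto
  have R_S: "x \<in> R \<Longrightarrow> x \<in> S" for x using S.sub by auto
  \<comment> \<open>\<open>R\<close> together with the part of \<open>S\<close> that
    \<open>T\<close> sends into the \<open>i\<close>-th term; it grows with \<open>i\<close> from
    \<open>R\<close> to \<open>S\<close>.\<close>
  define N where "N i = {x\<in>S. \<exists>z\<in>S. T z \<in> Ws ! i \<and> x - z \<in> R}" for i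
  have N: "N i = R \<or> N i = S" if i: "i < length Ws" for i
  proof (rule irr)
    interpret W: fun_rep G act2 "Ws ! i" using Wrep(1) i by simp
    show "R \<subseteq> N i"
      using S.V.zero_mem S.R.zero_mem W.zero_mem R_S by (auto simp: N_def T0 intro!: bexI[of _ 0])
    then have 0: "0 \<in> N i" using S.R.zero_mem by auto
    show "N i \<subseteq> S" unfolding N_def by auto
    show "fun_rep G act1 (N i)"
    proof (rule fun_rep_subset[OF S.V.fun_rep_axioms \<open>N i \<subseteq> S\<close> 0])
      fix x y assume "x \<in> N i" "y \<in> N i"
      then obtain z z' where z: "x \<in> S" "z \<in> S" "T z \<in> Ws ! i" "x - z \<in> R"
        "y \<in> S" "z' \<in> S" "T z' \<in> Ws ! i" "y - z' \<in> R" unfolding N_def by auto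
      have "x + y - (z + z') \<in> R" using S.R.add_mem[OF z(4,8)] by (simp add: algebra_simps)
      then show "x + y \<in> N i" unfolding N_def using z
        by (auto simp: T_add S.V.add_mem W.add_mem intro!: bexI[of _ "z + z'"])
    next
      fix c x assume "x \<in> N i"
      then obtain z where z: "x \<in> S" "z \<in> S" "T z \<in> Ws ! i" "x - z \<in> R" unfolding N_def by auto
      then show "fscale c x \<in> N i" unfolding N_def using S.R.scale_mem[OF z(4), of c]
        by (auto simp: T_scale S.V.scale_mem W.scale_mem fscale_diff intro!: bexI[of _ "fscale c z"])
    next
      fix g x assume g: "g \<in> carrier G" and "x \<in> N i"
      then obtain z where z: "x \<in> S" "z \<in> S" "T z \<in> Ws ! i" "x - z \<in> R" unfolding N_def by auto
      then show "act1 g x \<in> N i" unfolding N_def using S.R.act_mem[OF g z(4)] g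
        by (auto simp: T_act S.V.act_mem W.act_mem S.V.act_diff intro!: bexI[of _ "act1 g z"])
    qed
  qed
  have hd: "Ws \<noteq> []" "Ws ! 0 = {0}" and lst: "Ws ! (length Ws - 1) = V"
    using Ws unfolding composition_series_def by (auto simp: hd_conv_nth last_conv_nth)
  have N0: "N 0 = R"
  proof -
    have "x \<in> R" if "x \<in> N 0" for x
      using that T_ker unfolding N_def hd by fastforce
    then show ?thesis using N[of 0] hd S.sub \<open>R \<noteq> S\<close> by auto
  qed
  have Nl: "N (length Ws - 1) = S"
    unfolding N_def lst using T_mem S.R.zero_mem by force
  \<comment> \<open>Butterfly argument: where the subspaces \<open>N i\<close> jump from \<open>R\<close> to \<open>S\<close>, the quotients \<open>S / R\<close> and
    \<open>Ws ! Suc i / Ws ! i\<close> are both quotients of the same subspace of \<open>S\<close>, by the same kernel.\<close>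
  define j where "j = (LEAST i. N i = S)"
  have j: "N j = S" unfolding j_def using Nl by (rule LeastI)
  have jle: "j \<le> length Ws - 1" unfolding j_def using Nl by (rule Least_le)
  have "j \<noteq> 0" using j N0 \<open>R \<noteq> S\<close> by auto
  then obtain i where i: "j = Suc i" by (cases j) auto
  then have il: "Suc i < length Ws" using jle hd by (cases Ws) auto
  have "N i \<noteq> S" using not_less_Least[of i "\<lambda>i. N i = S"] i unfolding j_def by auto
  then have NR: "N i = R" using N[of i] il by auto
  have NS: "N (Suc i) = S" using j i by simp
  define A B where "A = Ws ! i" and "B = Ws ! Suc i"
  have AB: "A \<subseteq> B" "kg_irreducible G (kg_quot (fun_gmod act2 B) A)"
    using Ws il unfolding composition_series_def A_def B_def by auto
  have rep: "fun_rep G act2 A" "fun_rep G act2 B" "B \<subseteq> V"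
    using Wrep il unfolding A_def B_def by auto
  interpret AB: fun_subrep G act2 B A using AB rep unfolding fun_subrep_iff by auto
  have NR': "z \<in> R" if "z \<in> S" "T z \<in> A" for z
  proof -
    have "z \<in> N i" unfolding N_def using that S.R.zero_mem unfolding A_def by force
    then show ?thesis using NR by simp
  qed
  have NS': "\<exists>z\<in>S. T z \<in> B \<and> x - z \<in> R" if "x \<in> S" for x
    using that NS unfolding N_def B_def by blast
  have proper: "\<exists>z\<in>S. T z \<in> B \<and> z \<notin> R"
  proof (rule ccontr)
    assume a: "\<not> ?thesis"
    have "x \<in> R" if x: "x \<in> S" for x
    proof -
      obtain z where "z \<in> S" "T z \<in> B" "x - z \<in> R" using NS'[OF x] by auto
      then show ?thesis using a S.R.diff_mem_iff by blast
    qed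
    then show False using \<open>R \<noteq> S\<close> S.sub by auto
  qed
  \<comment> \<open>The image of \<open>X\<close> in the irreducible quotient \<open>B\<close> /
    \<open>A\<close>. It will be everything for \<open>X = S\<close> and zero for
    \<open>X = R\<close>, which gives surjectivity and the right kernel.\<close>
  have image: "{y\<in>B. \<exists>z\<in>X. T z \<in> B \<and> y - T z \<in> A} \<in> {A, B}"
    if "fun_rep G act1 X" "X \<subseteq> S" for X
  proof -
    interpret X: fun_rep G act1 X by fact
    have XS: "x \<in> X \<Longrightarrow> x \<in> S" for x using that by auto
    let ?I = "{y\<in>B. \<exists>z\<in>X. T z \<in> B \<and> y - T z \<in> A}"
    have "A \<subseteq> ?I" using AB.sub X.zero_mem AB.V.zero_mem by (auto simp: T0 intro!: bexI[of _ 0])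
    have sub: "?I \<subseteq> B" by auto
    have "fun_rep G act2 ?I"
    proof (rule fun_rep_subset[OF rep(2) sub])
      show "0 \<in> ?I" using \<open>A \<subseteq> ?I\<close> AB.R.zero_mem by blast
    next
      fix x y assume "x \<in> ?I" "y \<in> ?I"
      then obtain z z' where z: "x \<in> B" "z \<in> X" "T z \<in> B" "x - T z \<in> A"
        "y \<in> B" "z' \<in> X" "T z' \<in> B" "y - T z' \<in> A" by auto
      have "x + y - (T z + T z') \<in> A" using AB.R.add_mem[OF z(4,8)] by (simp add: algebra_simps)
      then show "x + y \<in> ?I" using z
        by (auto simp: T_add XS X.add_mem AB.V.add_mem intro!: bexI[of _ "z + z'"])
    next
      fix c x assume "x \<in> ?I"
      then obtain z where z: "x \<in> B" "z \<in> X" "T z \<in> B" "x - T z \<in> A" by auto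
      then show "fscale c x \<in> ?I" using AB.R.scale_mem[OF z(4), of c]
        by (auto simp: T_scale XS X.scale_mem AB.V.scale_mem fscale_diff intro!: bexI[of _ "fscale c z"])
    next
      fix g x assume g: "g \<in> carrier G" and "x \<in> ?I"
      then obtain z where z: "x \<in> B" "z \<in> X" "T z \<in> B" "x - T z \<in> A" by auto
      then show "act2 g x \<in> ?I" using AB.R.act_mem[OF g z(4)] g
        by (auto simp: T_act XS X.act_mem AB.V.act_mem AB.V.act_diff intro!: bexI[of _ "act1 g z"])
    qed
    then show ?thesis using AB.irreducible_quotD[OF AB(2) _ \<open>A \<subseteq> ?I\<close> sub] by auto
  qed
  have imS: "\<exists>z\<in>S. T z \<in> B \<and> y - T z \<in> A" if y: "y \<in> B" for y
  proof -
    obtain z where z: "z \<in> S" "T z \<in> B" "z \<notin> R" using proper by auto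
    then have "T z \<notin> A" using NR' by auto
    moreover have "T z \<in> {y\<in>B. \<exists>z\<in>S. T z \<in> B \<and> y - T z \<in> A}"
      using z AB.R.zero_mem by force
    ultimately have "{y\<in>B. \<exists>z\<in>S. T z \<in> B \<and> y - T z \<in> A} = B"
      using image[OF S.V.fun_rep_axioms] by blast
    then show ?thesis using y by blast
  qed
  have imR: "T z \<in> A" if zR: "z \<in> R" and TzB: "T z \<in> B" for z
  proof -
    let ?I = "{y\<in>B. \<exists>z\<in>R. T z \<in> B \<and> y - T z \<in> A}"
    \<comment> \<open>If \<open>R\<close> filled \<open>B\<close> / \<open>A\<close>, then
      \<open>w\<close> would differ from an element of \<open>R\<close> by something that
      \<open>T\<close> sends into \<open>A\<close>; \<open>NR'\<close> puts this difference into
      \<open>R\<close>, against the choice of \<open>w\<close>.\<close>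
    have "?I \<noteq> B"
    proof
      assume I: "?I = B"
      obtain w where w: "w \<in> S" "T w \<in> B" "w \<notin> R" using proper by auto
      then obtain w' where w': "w' \<in> R" "T w' \<in> B" "T w - T w' \<in> A" using I by blast
      then have "w - w' \<in> R" using w R_S by (intro NR') (auto simp: T_diff S.V.diff_mem)
      then show False using w w' S.R.diff_mem_iff by blast
    qed
    then have "?I = A" using image[OF S.R.fun_rep_axioms S.sub] by blast
    moreover have "T z \<in> ?I" using zR TzB AB.R.zero_mem by force
    ultimately show ?thesis by simp
  qed
  define rel where "rel x y \<longleftrightarrow> x \<in> S \<and> y \<in> B \<and> (\<exists>z\<in>S. T z \<in> B \<and> x - z \<in> R \<and> y - T z \<in> A)" for x y
  have "kg_iso G (kg_quot (fun_gmod act1 S) R) (kg_quot (fun_gmod act2 B) A)"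
  proof (rule kg_iso_quot_relation[OF S.fun_subrep_axioms AB.fun_subrep_axioms, of rel])
    show "x \<in> S \<and> y \<in> B" if "rel x y" for x y using that unfolding rel_def by auto
    show "\<exists>y. rel x y" if x: "x \<in> S" for x
    proof -
      obtain z where "z \<in> S" "T z \<in> B" "x - z \<in> R" using NS'[OF x] by auto
      then have "rel x (T z)" unfolding rel_def using x AB.R.zero_mem by force
      then show ?thesis by blast
    qed
    show "\<exists>x. rel x y" if y: "y \<in> B" for y
    proof -
      obtain z where "z \<in> S" "T z \<in> B" "y - T z \<in> A" using imS[OF y] by auto
      then have "rel z y" unfolding rel_def using y S.R.zero_mem by force
      then show ?thesis by blast
    qed
    show "rel (x + x') (y + y')" if r: "rel x y" "rel x' y'" for x y x' y'
    proof -
      obtain z z' where z: "x \<in> S" "y \<in> B" "z \<in> S" "T z \<in> B" "x - z \<in> R" "y - T z \<in> A"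
        "x' \<in> S" "y' \<in> B" "z' \<in> S" "T z' \<in> B" "x' - z' \<in> R" "y' - T z' \<in> A"
        using r unfolding rel_def by auto
      have "x + x' - (z + z') \<in> R" "y + y' - (T z + T z') \<in> A"
        using S.R.add_mem[OF z(5,11)] AB.R.add_mem[OF z(6,12)] by (auto simp: algebra_simps)
      then show ?thesis unfolding rel_def using z
        by (auto simp: T_add S.V.add_mem AB.V.add_mem intro!: bexI[of _ "z + z'"])
    qed
    show "rel (fscale c x) (fscale c y)" if r: "rel x y" for c x y
    proof -
      obtain z where z: "x \<in> S" "y \<in> B" "z \<in> S" "T z \<in> B" "x - z \<in> R" "y - T z \<in> A"
        using r unfolding rel_def by auto
      then show ?thesis unfolding rel_def
        using S.R.scale_mem[OF z(5), of c] AB.R.scale_mem[OF z(6), of c]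
        by (auto simp: T_scale S.V.scale_mem AB.V.scale_mem fscale_diff intro!: bexI[of _ "fscale c z"])
    qed
    show "rel (act1 g x) (act2 g y)" if g: "g \<in> carrier G" and r: "rel x y" for g x y
    proof -
      obtain z where z: "x \<in> S" "y \<in> B" "z \<in> S" "T z \<in> B" "x - z \<in> R" "y - T z \<in> A"
        using r unfolding rel_def by auto
      then show ?thesis unfolding rel_def
        using S.R.act_mem[OF g z(5)] AB.R.act_mem[OF g z(6)] g
        by (auto simp: T_act S.V.act_mem AB.V.act_mem S.V.act_diff AB.V.act_diff
            intro!: bexI[of _ "act1 g z"])
    qed
    show "x \<in> R \<longleftrightarrow> y \<in> A" if r: "rel x y" for x y
    proof -
      obtain z where z: "x \<in> S" "y \<in> B" "z \<in> S" "T z \<in> B" "x - z \<in> R" "y - T z \<in> A"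
        using r unfolding rel_def by auto
      have "x \<in> R \<longleftrightarrow> z \<in> R" using z(5) by (rule S.R.diff_mem_iff)
      also have "\<dots> \<longleftrightarrow> T z \<in> A" using NR' imR z by blast
      also have "\<dots> \<longleftrightarrow> y \<in> A" using AB.R.diff_mem_iff[OF z(6)] by simp
      finally show ?thesis .
    qed
  qed
  moreover have "kg_quot (fun_gmod act2 B) A \<in> composition_factors G (fun_gmod act2 V)"
    unfolding composition_factors_def A_def B_def using Ws il by auto
  ultimately show ?thesis by blast
qed

section \<open>Eigenvectors of linear characters\<close>

locale lin_char = group G for G :: "('g, 'm) monoid_scheme" (structure) +
  fixes U :: "'g set" and \<chi> :: "'g \<Rightarrow> 'k::field"
  assumes subgroup_U: "subgroup U G"
    and finite_U: "finite U"
    and card_U: "of_nat (card U) \<noteq> (0::'k)"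
    and char_mult: "u \<in> U \<Longrightarrow> v \<in> U \<Longrightarrow> \<chi> (u \<otimes> v) = \<chi> u * \<chi> v"
    and char_nonzero: "u \<in> U \<Longrightarrow> \<chi> u \<noteq> 0"
begin

lemma U_closed [simp]:
  "\<one> \<in> U" "u \<in> U \<Longrightarrow> u \<in> carrier G" "u \<in> U \<Longrightarrow> inv u \<in> U"
  "u \<in> U \<Longrightarrow> v \<in> U \<Longrightarrow> u \<otimes> v \<in> U"
  using subgroup_U
  by (auto simp: subgroup.one_closed subgroup.mem_carrier subgroup.m_inv_closed subgroup.m_closed)

lemma char_one [simp]: "\<chi> \<one> = 1"
  using char_mult[of "\<one>" "\<one>"] char_nonzero[of "\<one>"] by simp

lemma char_inv: "u \<in> U \<Longrightarrow> \<chi> (inv u) = inverse (\<chi> u)"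
  using char_mult[of u "inv u"] by (auto dest: inverse_unique)

lemma sum_U_shift: "v \<in> U \<Longrightarrow> (\<Sum>u\<in>U. f (v \<otimes> u)) = sum f U"
  by (rule sum.reindex_bij_witness[of _ "\<lambda>u. inv v \<otimes> u" "\<lambda>u. v \<otimes> u"])
    (auto simp flip: m_assoc)

lemma sum_U_shift_right: "v \<in> U \<Longrightarrow> (\<Sum>u\<in>U. f (u \<otimes> v)) = sum f U"
  by (rule sum.reindex_bij_witness[of _ "\<lambda>u. u \<otimes> inv v" "\<lambda>u. u \<otimes> v"])
    (auto simp: m_assoc)

text \<open>Since the order of \<open>U\<close> is invertible, averaging lifts eigenvectors.\<close>

lemma eigenvector_lift:
  assumes "fun_subrep G act V R" "has_eigenvector (kg_quot (fun_gmod act V) R) U \<chi>"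
  shows "\<exists>x\<in>V. x \<noteq> 0 \<and> (\<forall>u\<in>U. act u x = fscale (\<chi> u) x)"
proof -
  interpret fun_subrep G act V R by fact
  obtain x where x: "x \<in> V" "x \<notin> R" and eig: "u \<in> U \<Longrightarrow> act u x - fscale (\<chi> u) x \<in> R" for u
  proof -
    obtain X where X: "X \<in> carrier Q" "X \<noteq> \<zero>\<^bsub>Q\<^esub>" "\<And>u. u \<in> U \<Longrightarrow> gact Q u X = \<chi> u \<odot>\<^bsub>Q\<^esub> X"
      using assms(2) unfolding has_eigenvector_def by auto
    obtain x where x: "x \<in> V" "X = cs x" using X(1) by (auto simp: carrier_Q)
    have "cs x \<noteq> cs 0" using X(2) x(2) unfolding zero_Q(2) by simp
    then have "x \<notin> R" unfolding cs_eq by simp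
    moreover have "act u x - fscale (\<chi> u) x \<in> R" if "u \<in> U" for u
      using X(3)[OF that] that by (simp add: x gact_Q smult_Q cs_eq)
    ultimately show thesis using x(1) that by blast
  qed
  let ?y = "\<Sum>u\<in>U. fscale (inverse (\<chi> u)) (act u x)"
  have "?y \<in> V" by (intro V.sum_mem V.scale_mem V.act_mem) (auto simp: x)
  moreover have "?y \<noteq> 0"
  proof
    assume y: "?y = 0"
    have "fscale (inverse (\<chi> u)) (act u x) - x \<in> R" if "u \<in> U" for u
      using R.scale_mem[OF eig[OF that], of "inverse (\<chi> u)"] char_nonzero[OF that]
      by (simp add: fscale_diff)
    then have "(\<Sum>u\<in>U. fscale (inverse (\<chi> u)) (act u x) - x) \<in> R" by (rule R.sum_mem)
    moreover have "(\<Sum>u\<in>U. fscale (inverse (\<chi> u)) (act u x) - x) = - fscale (of_nat (card U)) x"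
      unfolding sum_subtractf y by (simp add: fun_eq_iff)
    ultimately have "fscale (of_nat (card U)) x \<in> R" using R.minus_mem by fastforce
    then have "fscale (inverse (of_nat (card U))) (fscale (of_nat (card U)) x) \<in> R"
      by (rule R.scale_mem)
    then show False using x(2) card_U by simp
  qed
  moreover have "act v ?y = fscale (\<chi> v) ?y" if v: "v \<in> U" for v
  proof -
    have "act v ?y = (\<Sum>u\<in>U. fscale (inverse (\<chi> u)) (act (v \<otimes> u) x))"
      using v x by (subst V.act_sum) (auto simp: V.scale_mem V.act_mem V.act_scale V.act_mult)
    also have "\<dots> = (\<Sum>u\<in>U. fscale (\<chi> v * inverse (\<chi> (v \<otimes> u))) (act (v \<otimes> u) x))"
      using v char_nonzero[OF v] by (intro sum.cong refl) (simp add: char_mult flip: mult.assoc)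
    also have "\<dots> = (\<Sum>u\<in>U. fscale (\<chi> v * inverse (\<chi> u)) (act u x))"
      by (rule sum_U_shift[OF v])
    also have "\<dots> = fscale (\<chi> v) ?y" by (simp add: fscale_sum del: fscale_simps(1))
    finally show ?thesis .
  qed
  ultimately show ?thesis by blast
qed

end

section \<open>Functions on cosets\<close>

definition ltrans :: "('g, 'm) monoid_scheme \<Rightarrow> 'g \<Rightarrow> ('g \<Rightarrow> 'k) \<Rightarrow> 'g \<Rightarrow> 'k::zero" where
  "ltrans G g f = (\<lambda>h. if h \<in> carrier G then f (inv\<^bsub>G\<^esub> g \<otimes>\<^bsub>G\<^esub> h) else 0)"

text \<open>The functions on G/H, extended by 0 outside the carrier. For trivial coefficients the
  equivariance in \<open>ind_module\<close> is right invariance under \<open>H\<close>, so this is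
  the induced module itself.\<close>

definition coset_functions :: "('g, 'm) monoid_scheme \<Rightarrow> 'g set \<Rightarrow> ('g \<Rightarrow> 'k::zero) set" where
  "coset_functions G H = {f. (\<forall>g. g \<notin> carrier G \<longrightarrow> f g = 0) \<and>
     (\<forall>g\<in>carrier G. \<forall>h\<in>H. f (g \<otimes>\<^bsub>G\<^esub> h) = f g)}"

lemma fun_rep_coset_functions:
  assumes "group G" "H \<subseteq> carrier G"
  shows "fun_rep G (ltrans G) (coset_functions G H)"
proof -
  interpret group G by fact
  have [simp]: "inv\<^bsub>G\<^esub> g \<otimes>\<^bsub>G\<^esub> (x \<otimes>\<^bsub>G\<^esub> y) = inv\<^bsub>G\<^esub> g \<otimes>\<^bsub>G\<^esub> x \<otimes>\<^bsub>G\<^esub> y"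
    if "g \<in> carrier G" "x \<in> carrier G" "y \<in> carrier G" for g x y
    using that by (simp add: m_assoc)
  show ?thesis
    using assms(2)
    by unfold_locales
      (auto simp: coset_functions_def ltrans_def fun_eq_iff inv_mult_group subset_iff)
qed

lemma ind_module_trivial:
  "ind_module G H trivial_module = fun_gmod (ltrans G) (coset_functions G H)"
  unfolding ind_module_def trivial_module_def fun_gmod_def coset_functions_def ltrans_def fscale_def
  by (auto simp: fun_eq_iff)

text \<open>Take \<open>h\<close> in the support of \<open>f\<close>. If \<open>u\<close> fixes the
  coset of \<open>h\<close>, then \<open>f\<close> has the same value at \<open>h\<close> and at
  \<open>inv u \<otimes> h\<close>, while the eigenvector equation multiplies this value by
  \<open>\<chi> u\<close>.\<close>

lemma (in lin_char) eigenvector_coset_functions: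
  assumes "subgroup H G" "f \<in> coset_functions G H" "f \<noteq> 0"
    and eig: "\<And>u. u \<in> U \<Longrightarrow> ltrans G u f = fscale (\<chi> u) f"
  shows "\<exists>h\<in>carrier G. \<forall>u\<in>U. inv h \<otimes> u \<otimes> h \<in> H \<longrightarrow> \<chi> u = 1"
proof -
  obtain h where h: "f h \<noteq> 0" using assms(3) by (auto simp: fun_eq_iff)
  then have hG: "h \<in> carrier G" using assms(2) unfolding coset_functions_def by auto
  have "\<chi> u = 1" if u: "u \<in> U" and m: "inv h \<otimes> u \<otimes> h \<in> H" for u
  proof -
    have "inv (inv h \<otimes> u \<otimes> h) \<in> H" using assms(1) m by (rule subgroup.m_inv_closed)
    then have "f (h \<otimes> inv (inv h \<otimes> u \<otimes> h)) = f h"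
      using assms(2) hG unfolding coset_functions_def by auto
    moreover have "h \<otimes> inv (inv h \<otimes> u \<otimes> h) = inv u \<otimes> h"
      using hG u by (simp add: inv_mult_group) (simp flip: m_assoc)
    moreover have "f (inv u \<otimes> h) = \<chi> u * f h"
      using fun_cong[OF eig[OF u], of h] hG by (simp add: ltrans_def)
    ultimately show ?thesis using h by simp
  qed
  then show ?thesis using hG by auto
qed

text \<open>By the assumption \<open>cell\<close>, a \<open>\<chi>\<close>-eigenfunction on \<open>G/P\<close> is supported on \<open>UP\<close>, so the
  eigenspace is at most one-dimensional; conjugation by \<open>t\<close> passes to the inverse character.\<close>

locale char_cell = lin_char G U \<chi>
  for G :: "('g, 'm) monoid_scheme" (structure) and U :: "'g set" and \<chi> :: "'g \<Rightarrow> 'k::field" +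
  fixes P :: "'g set" and t :: 'g
  assumes subgroup_P: "subgroup P G"
    and U_P: "U \<inter> P = {\<one>}"
    and t_P: "t \<in> P" and t_t: "t \<otimes> t = \<one>"
    and t_U: "u \<in> U \<Longrightarrow> t \<otimes> u \<otimes> t \<in> U"
    and char_t: "u \<in> U \<Longrightarrow> \<chi> (t \<otimes> u \<otimes> t) * \<chi> u = 1"
    and cell: "h \<in> carrier G \<Longrightarrow> (\<And>u. u \<in> U \<Longrightarrow> inv h \<otimes> u \<otimes> h \<in> P \<Longrightarrow> \<chi> u = 1) \<Longrightarrow>
      \<exists>u\<in>U. \<exists>p\<in>P. h = u \<otimes> p"
begin

lemma P_closed [simp]:
  "\<one> \<in> P" "u \<in> P \<Longrightarrow> u \<in> carrier G" "u \<in> P \<Longrightarrow> inv u \<in> P"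
  "u \<in> P \<Longrightarrow> v \<in> P \<Longrightarrow> u \<otimes> v \<in> P"
  using subgroup_P
  by (auto simp: subgroup.one_closed subgroup.mem_carrier subgroup.m_inv_closed subgroup.m_closed)

lemma t_carrier [simp]: "t \<in> carrier G" "inv t = t"
  using t_P t_t by (auto intro: inv_equality)

lemma t_cancel: "h \<in> carrier G \<Longrightarrow> t \<otimes> (t \<otimes> h) = h"
  by (simp add: t_t flip: m_assoc)

lemma t_U_P: "u \<in> U \<Longrightarrow> p \<in> P \<Longrightarrow>
    t \<otimes> (u \<otimes> p) = (t \<otimes> u \<otimes> t) \<otimes> (t \<otimes> p)"
  by (simp add: m_assoc t_cancel)

text \<open>The \<chi>-eigenfunction on G/P that lives on the cell \<open>U P\<close>, with value
  \<open>inverse (\<chi> u)\<close> at \<open>u \<otimes> p\<close>. Since \<open>U\<close> meets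
  \<open>P\<close> trivially, at most one summand survives. It is \<open>e_vec\<close> read as a
  function on the group, see \<open>to_GL_e_vec\<close>.\<close>

definition cell_vec :: "'g \<Rightarrow> 'k" where
  "cell_vec h = (if h \<in> carrier G
     then \<Sum>u\<in>U. if inv u \<otimes> h \<in> P then inverse (\<chi> u) else 0 else 0)"

lemma cell_vec_eq:
  assumes "u \<in> U" "p \<in> P" shows "cell_vec (u \<otimes> p) = inverse (\<chi> u)"
proof -
  have "inv v \<otimes> (u \<otimes> p) \<in> P \<longleftrightarrow> v = u" if v: "v \<in> U" for v
  proof
    assume "inv v \<otimes> (u \<otimes> p) \<in> P"
    then have "inv v \<otimes> (u \<otimes> p) \<otimes> inv p \<in> P" using assms by simp
    also have "inv v \<otimes> (u \<otimes> p) \<otimes> inv p = inv v \<otimes> u"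
      using assms v by (simp add: m_assoc)
    finally have "inv v \<otimes> u \<in> P" .
    then have "inv v \<otimes> u \<in> U \<inter> P" using assms(1) v by simp
    then have "inv v \<otimes> u = \<one>" unfolding U_P by simp
    then have "v \<otimes> (inv v \<otimes> u) = v" using v by simp
    moreover have "v \<otimes> (inv v \<otimes> u) = u" using assms v by (simp flip: m_assoc)
    ultimately show "v = u" by simp
  next
    assume "v = u"
    then show "inv v \<otimes> (u \<otimes> p) \<in> P" using assms by (simp flip: m_assoc)
  qed
  then have "cell_vec (u \<otimes> p) = (\<Sum>v\<in>U. if v = u then inverse (\<chi> v) else 0)"
    unfolding cell_vec_def using assms by (auto intro!: sum.cong)
  then show ?thesis using assms finite_U by simp
qed

lemma cell_vec_zero:
  assumes "\<And>u p. u \<in> U \<Longrightarrow> p \<in> P \<Longrightarrow> h \<noteq> u \<otimes> p"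
  shows "cell_vec h = 0"
proof -
  have "inv u \<otimes> h \<notin> P" if "u \<in> U" "h \<in> carrier G" for u
    using assms[OF that(1), of "inv u \<otimes> h"] that by (auto simp flip: m_assoc)
  then show ?thesis unfolding cell_vec_def by simp
qed

lemma cell_vec_eigenvector:
  assumes v: "v \<in> U" shows "ltrans G v cell_vec = fscale (\<chi> v) cell_vec"
proof (rule ext)
  fix h
  show "ltrans G v cell_vec h = fscale (\<chi> v) cell_vec h"
  proof (cases "\<exists>u\<in>U. \<exists>p\<in>P. h = u \<otimes> p")
    case True
    then obtain u p where h: "u \<in> U" "p \<in> P" "h = u \<otimes> p" by auto
    have "inv v \<otimes> (u \<otimes> p) = (inv v \<otimes> u) \<otimes> p" using h v by (simp add: m_assoc)
    then show ?thesis using h v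
      by (simp add: ltrans_def cell_vec_eq char_mult char_inv)
  next
    case False
    have "cell_vec (inv v \<otimes> h) = 0" if hG: "h \<in> carrier G"
    proof (rule cell_vec_zero, rule notI)
      fix u p assume up: "u \<in> U" "p \<in> P" "inv v \<otimes> h = u \<otimes> p"
      have "h = v \<otimes> (inv v \<otimes> h)" using v hG by (simp flip: m_assoc)
      also have "\<dots> = (v \<otimes> u) \<otimes> p" unfolding up using up v by (simp add: m_assoc)
      finally show False using False up v by auto
    qed
    moreover have "cell_vec h = 0" using False by (intro cell_vec_zero) auto
    ultimately show ?thesis by (simp add: ltrans_def)
  qed
qed

text \<open>This pairs the eigenfunction with its translate by \<open>t\<close>. Without
  \<open>t\<close> the summands would be the squares of \<open>inverse (\<chi> u)\<close>, with sum
  zero unless the square of \<chi> is trivial; \<open>char_t\<close> turns every summand into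
  1.\<close>

lemma sum_cell_vec: "(\<Sum>u\<in>U. inverse (\<chi> u) * cell_vec (t \<otimes> u)) = of_nat (card U)"
proof -
  have "inverse (\<chi> u) * cell_vec (t \<otimes> u) = 1" if u: "u \<in> U" for u
  proof -
    have "cell_vec (t \<otimes> u) = cell_vec ((t \<otimes> u \<otimes> t) \<otimes> t)"
      using u by (simp add: m_assoc t_t)
    also have "\<dots> = inverse (\<chi> (t \<otimes> u \<otimes> t))" using u t_U t_P by (simp add: cell_vec_eq)
    also have "\<dots> = \<chi> u" using char_t[OF u] by (simp add: inverse_unique)
    finally show ?thesis using char_nonzero[OF u] by simp
  qed
  then show ?thesis by simp
qed

text \<open>The submodule theorem for functions on G/P. By \<open>nz\<close>, \<open>x\<close> is
  not orthogonal to some translate of \<open>cell_vec\<close>; averaging over \<open>U\<close> and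
  translating by \<open>t\<close> then produce a nonzero multiple of \<open>cell_vec\<close> inside
  \<open>N\<close>.\<close>

theorem cell_vec_mem:
  assumes "fun_rep G (ltrans G) N" "N \<subseteq> coset_functions G P" "x \<in> N" "g \<in> carrier G"
    and nz: "(\<Sum>u\<in>U. inverse (\<chi> u) * x (g \<otimes> u)) \<noteq> 0"
  shows "cell_vec \<in> N"
proof -
  interpret N: fun_rep G "ltrans G" N by fact
  \<comment> \<open>Translation moves \<open>g\<close> to the identity, so that the sum in
    \<open>nz\<close> becomes \<open>z \<one>\<close>.\<close>
  define y where "y = ltrans G (inv g) x"
  have yN: "y \<in> N" unfolding y_def using assms by (intro N.act_mem) auto
  \<comment> \<open>Up to the factor \<open>card U\<close>, the projection onto functions with
    \<open>z (v \<otimes> h) = \<chi> v * z h\<close>. Under left translation these transform by the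
    inverse of \<chi>, which is why \<open>t\<close> is applied afterwards.\<close>
  define z where "z = (\<Sum>u\<in>U. fscale (inverse (\<chi> u)) (ltrans G (inv u) y))"
  have zN: "z \<in> N" unfolding z_def using yN by (intro N.sum_mem N.scale_mem N.act_mem) auto
  have z: "z h = (\<Sum>u\<in>U. inverse (\<chi> u) * y (u \<otimes> h))" if "h \<in> carrier G" for h
  proof -
    show ?thesis
      using that unfolding z_def sum_fun_apply by (auto simp: ltrans_def intro!: sum.cong)
  qed
  have z_out: "z h = 0" if "h \<notin> carrier G" for h
    using that zN assms(2) unfolding coset_functions_def by auto
  have z_P: "z (h \<otimes> p) = z h" if "h \<in> carrier G" "p \<in> P" for h p
    using that zN assms(2) unfolding coset_functions_def by blast
  have z_U: "z (v \<otimes> h) = \<chi> v * z h" if "v \<in> U" "h \<in> carrier G" for v h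
  proof -
    have "z (v \<otimes> h) = (\<Sum>u\<in>U. inverse (\<chi> u) * y (u \<otimes> v \<otimes> h))"
      using that by (simp add: z m_assoc)
    also have "\<dots> = (\<Sum>u\<in>U. \<chi> v * inverse (\<chi> (u \<otimes> v)) * y (u \<otimes> v \<otimes> h))"
      using that char_nonzero by (intro sum.cong refl) (simp add: char_mult flip: mult.assoc)
    also have "\<dots> = (\<Sum>u\<in>U. \<chi> v * inverse (\<chi> u) * y (u \<otimes> h))"
      by (rule sum_U_shift_right[OF that(1)])
    finally show ?thesis using that by (simp add: z sum_distrib_left mult.assoc)
  qed
  have z1: "z \<one> \<noteq> 0"
    using nz assms(4) by (simp add: z y_def ltrans_def)
  define w where "w = ltrans G t z"
  have wN: "w \<in> N" unfolding w_def using zN by (intro N.act_mem) auto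
  have w: "w h = z (t \<otimes> h)" if "h \<in> carrier G" for h
    using that unfolding w_def ltrans_def by simp
  have "w = fscale (z \<one>) cell_vec"
  proof (rule ext)
    fix h
    show "w h = fscale (z \<one>) cell_vec h"
    proof (cases "\<exists>u\<in>U. \<exists>p\<in>P. h = u \<otimes> p")
      case True
      then obtain u p where h: "u \<in> U" "p \<in> P" "h = u \<otimes> p" by auto
      have "w h = z ((t \<otimes> u \<otimes> t) \<otimes> (t \<otimes> p))" using h by (simp add: w t_U_P)
      also have "\<dots> = \<chi> (t \<otimes> u \<otimes> t) * z (\<one> \<otimes> (t \<otimes> p))"
        using h t_U by (subst z_U) auto
      also have "z (\<one> \<otimes> (t \<otimes> p)) = z \<one>" using h t_P by (intro z_P) auto
      also have "\<chi> (t \<otimes> u \<otimes> t) = inverse (\<chi> u)"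
        using char_t[OF h(1)] by (metis inverse_unique mult.commute)
      finally show ?thesis using h by (simp add: cell_vec_eq)
    next
      case False
      \<comment> \<open>The premise of \<open>cell\<close> only asks where \<chi> equals 1, so it
        holds for the inverse character as well and confines \<open>z\<close> to \<open>U P\<close>;
        by \<open>t_U_P\<close> this set is preserved by \<open>t\<close>.\<close>
      have "z (t \<otimes> h) = 0" if hG: "h \<in> carrier G"
      proof (rule ccontr)
        assume nz: "z (t \<otimes> h) \<noteq> 0"
        let ?h = "t \<otimes> h"
        have "\<chi> u = 1" if u: "u \<in> U" "inv ?h \<otimes> u \<otimes> ?h \<in> P" for u
        proof -
          have "u \<otimes> ?h = ?h \<otimes> (inv ?h \<otimes> u \<otimes> ?h)"
            using hG u(1) by (simp flip: m_assoc del: inv_mult_group)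
          then have "z (u \<otimes> ?h) = z ?h" using z_P[OF _ u(2)] hG by simp
          then show ?thesis using z_U[OF u(1), of ?h] nz hG by simp
        qed
        then obtain u p where up: "u \<in> U" "p \<in> P" "?h = u \<otimes> p" using cell[of ?h] hG by auto
        have "h = t \<otimes> (u \<otimes> p)" using t_cancel[OF hG] up(3) by simp
        also have "\<dots> = (t \<otimes> u \<otimes> t) \<otimes> (t \<otimes> p)" by (rule t_U_P) fact+
        finally show False using False t_U[OF up(1)] P_closed(4)[OF t_P up(2)] by blast
      qed
      then have "w h = 0"
        using wN assms(2) w unfolding coset_functions_def by (cases "h \<in> carrier G") auto
      moreover have "cell_vec h = 0" using False by (intro cell_vec_zero) auto
      ultimately show ?thesis by simp
    qed
  qed
  then have "cell_vec = fscale (inverse (z \<one>)) w" using z1 by simp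
  then show ?thesis using N.scale_mem[OF wN] by simp
qed

end

section \<open>Matrix groups\<close>

lemma carrier_GL_iff:
  "g \<in> carrier (GL n :: 'f::field mat monoid) \<longleftrightarrow>
     g \<in> carrier_mat n n \<and> (\<exists>h\<in>carrier_mat n n. h * g = 1\<^sub>m n \<and> g * h = 1\<^sub>m n)"
  by (auto simp: GL_def units_of_def Units_def ring_mat_simps)

lemma GL_simps [simp]: "mult (GL n) = (*)" "one (GL n) = 1\<^sub>m n"
  by (simp_all add: GL_def units_of_def ring_mat_simps)

lemma group_GL: "group (GL n :: 'f::field mat monoid)"
  unfolding GL_def using ring.is_monoid[OF ring_mat] by (rule monoid.units_group)

lemma carrier_GL_mat: "g \<in> carrier (GL n) \<Longrightarrow> g \<in> carrier_mat n n"
  by (simp add: carrier_GL_iff)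

lemma inv_GL:
  assumes "g \<in> carrier (GL n)"
  shows "inv\<^bsub>GL n\<^esub> g \<in> carrier_mat n n" "inv\<^bsub>GL n\<^esub> g * g = 1\<^sub>m n" "g * inv\<^bsub>GL n\<^esub> g = 1\<^sub>m n"
  using group.inv_closed[OF group_GL assms] group.l_inv[OF group_GL assms]
    group.r_inv[OF group_GL assms] by (auto simp: carrier_GL_mat)

lemma carrier_GL_det: "g \<in> carrier (GL n) \<longleftrightarrow> g \<in> carrier_mat n n \<and> det g \<noteq> 0"
  using det_non_zero_imp_unit[of g n "()"] unit_imp_det_non_zero[of g n "()"] carrier_GL_mat[of g n]
  by (auto simp: GL_def units_of_def)

text \<open>Dimensions are compared through cardinalities; a coordinate subspace has
  \<open>card D\<close> free entries.\<close>

lemma card_vec_supported: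
  fixes D :: "nat set"
  assumes "D \<subseteq> {..<n}"
  defines "E \<equiv> {y :: 'f::{field,finite} vec. y \<in> carrier_vec n \<and> (\<forall>j<n. j \<notin> D \<longrightarrow> y $ j = 0)}"
  shows "card E = card (UNIV :: 'f set) ^ card D" and "finite E"
proof -
  let ?E = "{y :: 'f vec. y \<in> carrier_vec n \<and> (\<forall>j<n. j \<notin> D \<longrightarrow> y $ j = 0)}"
  let ?h = "\<lambda>f. vec n (\<lambda>j. if j \<in> D then f j else 0) :: 'f vec"
  have fin: "finite D" using assms finite_subset by blast
  have bij: "bij_betw ?h (D \<rightarrow>\<^sub>E UNIV) ?E"
  proof (rule bij_betwI[of _ _ _ "\<lambda>y. restrict (\<lambda>j. y $ j) D"])
    show "?h (restrict (\<lambda>j. y $ j) D) = y" if "y \<in> ?E" for y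
      using that by (intro eq_vecI) auto
    show "restrict (\<lambda>j. ?h f $ j) D = f" if "f \<in> D \<rightarrow>\<^sub>E UNIV" for f
      using that assms by (auto simp: PiE_def extensional_def fun_eq_iff)
  qed auto
  show "card E = card (UNIV :: 'f set) ^ card D"
    unfolding E_def using bij_betw_same_card[OF bij] card_funcsetE[OF fin, of "UNIV :: 'f set"] by simp
  show "finite E"
    unfolding E_def using bij_betw_finite[OF bij] finite_PiE[OF fin, of "\<lambda>_. UNIV :: 'f set"] by simp
qed

lemma finite_carrier_vec: "finite (carrier_vec n :: 'f::{field,finite} vec set)"
proof -
  have "carrier_vec n = {y :: 'f vec. y \<in> carrier_vec n \<and> (\<forall>j<n. j \<notin> {..<n} \<longrightarrow> y $ j = 0)}"
    by auto
  then show ?thesis using card_vec_supported(2)[of "{..<n}" n] by simp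
qed

lemma finite_GL: "finite (carrier (GL n :: 'f::{field,finite} mat monoid))"
proof (rule finite_subset)
  let ?F = "({..<n} \<times> {..<n}) \<rightarrow>\<^sub>E (UNIV :: 'f set)"
  show "finite ((\<lambda>f. mat n n f) ` ?F)" by (intro finite_imageI finite_PiE) auto
  show "carrier (GL n) \<subseteq> (\<lambda>f. mat n n f) ` ?F"
  proof
    fix g :: "'f mat" assume "g \<in> carrier (GL n)"
    then have "g \<in> carrier_mat n n" by (rule carrier_GL_mat)
    then have "g = mat n n (restrict (\<lambda>ij. g $$ ij) ({..<n} \<times> {..<n}))" by (intro eq_matI) auto
    moreover have "restrict (\<lambda>ij. g $$ ij) ({..<n} \<times> {..<n}) \<in> ?F" by auto
    ultimately show "g \<in> (\<lambda>f. mat n n f) ` ?F" by (rule image_eqI)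
  qed
qed

text \<open>Left multiplication by \<open>x\<close> is injective on the finite set \<open>H\<close>
  and hence reaches the identity. This avoids inverting block triangular matrices.\<close>

lemma subgroup_finiteI:
  assumes "group G" "finite H" "H \<subseteq> carrier G" "\<one>\<^bsub>G\<^esub> \<in> H"
    and "\<And>x y. x \<in> H \<Longrightarrow> y \<in> H \<Longrightarrow> x \<otimes>\<^bsub>G\<^esub> y \<in> H"
  shows "subgroup H G"
proof -
  interpret group G by fact
  show ?thesis
  proof (rule subgroupI)
    fix x assume x: "x \<in> H"
    have xc: "x \<in> carrier G" using x assms(3) by auto
    have "inj_on (\<lambda>y. x \<otimes>\<^bsub>G\<^esub> y) H"
      using xc assms(3) by (auto simp: inj_on_def subset_iff)
    moreover have "(\<lambda>y. x \<otimes>\<^bsub>G\<^esub> y) ` H \<subseteq> H" using assms(5)[OF x] by auto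
    ultimately have "(\<lambda>y. x \<otimes>\<^bsub>G\<^esub> y) ` H = H" using endo_inj_surj[OF assms(2)] by auto
    then obtain y where y: "y \<in> H" "\<one>\<^bsub>G\<^esub> = x \<otimes>\<^bsub>G\<^esub> y" using assms(4) by (metis imageE)
    have yc: "y \<in> carrier G" using y(1) assms(3) by auto
    have "inv\<^bsub>G\<^esub> x = inv\<^bsub>G\<^esub> x \<otimes>\<^bsub>G\<^esub> (x \<otimes>\<^bsub>G\<^esub> y)" using xc unfolding y(2)[symmetric] by simp
    also have "\<dots> = y" using xc yc by (simp flip: m_assoc)
    finally have "inv\<^bsub>G\<^esub> x = y" .
    then show "inv\<^bsub>G\<^esub> x \<in> H" using y by simp
  qed (use assms in auto)
qed

text \<open>\<open>\<kappa>\<close> sends an index to the number of its block. This covers both the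
  row blocks of \<open>parabolic\<close> and the column blocks that stabilise an
  \<open>m_vec\<close>.\<close>

definition block_parabolic :: "nat \<Rightarrow> (nat \<Rightarrow> nat) \<Rightarrow> 'f::field mat set" where
  "block_parabolic n \<kappa> = {g \<in> carrier (GL n). \<forall>i<n. \<forall>j<n. \<kappa> j < \<kappa> i \<longrightarrow> g $$ (i, j) = 0}"

lemma parabolic_block: "parabolic n lam = block_parabolic n (row_of_box lam)"
  by (simp add: parabolic_def block_parabolic_def)

lemma subgroup_block_parabolic:
  "subgroup (block_parabolic n \<kappa> :: 'f::{field,finite} mat set) (GL n)"
proof (rule subgroup_finiteI[OF group_GL])
  show "finite (block_parabolic n \<kappa> :: 'f mat set)"
    by (rule finite_subset[OF _ finite_GL[of n]]) (auto simp: block_parabolic_def)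
  show "\<one>\<^bsub>GL n\<^esub> \<in> (block_parabolic n \<kappa> :: 'f mat set)"
    using group.is_monoid[OF group_GL, of n, THEN monoid.one_closed]
    by (auto simp: block_parabolic_def)
  fix x y :: "'f mat" assume x: "x \<in> block_parabolic n \<kappa>" and y: "y \<in> block_parabolic n \<kappa>"
  have c: "x \<in> carrier (GL n)" "y \<in> carrier (GL n)" using x y by (auto simp: block_parabolic_def)
  have "x \<otimes>\<^bsub>GL n\<^esub> y \<in> carrier (GL n)"
    using c group.is_monoid[OF group_GL, of n] by (rule monoid.m_closed[rotated 1])
  moreover have "(x * y) $$ (i, j) = 0" if "i < n" "j < n" "\<kappa> j < \<kappa> i" for i j
  proof -
    have "x $$ (i, k) * y $$ (k, j) = 0" if k: "k < n" for k
      using x y k \<open>i < n\<close> \<open>j < n\<close> \<open>\<kappa> j < \<kappa> i\<close> by (cases "\<kappa> k < \<kappa> i") (auto simp: block_parabolic_def)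
    then show ?thesis
      using that carrier_GL_mat[OF c(1)] carrier_GL_mat[OF c(2)]
      by (auto simp: scalar_prod_def intro!: sum.neutral)
  qed
  ultimately show "x \<otimes>\<^bsub>GL n\<^esub> y \<in> block_parabolic n \<kappa>" by (simp add: block_parabolic_def)
qed (auto simp: block_parabolic_def)

section \<open>Subspaces, functionals and leading indices\<close>

definition vec_subspace :: "nat \<Rightarrow> 'f::field vec set \<Rightarrow> bool" where
  "vec_subspace n W \<longleftrightarrow> W \<subseteq> carrier_vec n \<and> 0\<^sub>v n \<in> W \<and>
     (\<forall>x\<in>W. \<forall>y\<in>W. x + y \<in> W) \<and> (\<forall>c. \<forall>x\<in>W. c \<cdot>\<^sub>v x \<in> W)"

lemma exists_annihilator:
  fixes z :: "'f::{field,finite} vec"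
  assumes W: "vec_subspace n W" and z: "z \<in> carrier_vec n" "z \<notin> W"
  shows "\<exists>w\<in>carrier_vec n. (\<forall>x\<in>W. w \<bullet> x = 0) \<and> w \<bullet> z \<noteq> 0"
proof -
  \<comment> \<open>A subspace maximal among those avoiding \<open>z\<close> is a hyperplane, hence the kernel of a functional.\<close>
  define S where "S = {M. vec_subspace n M \<and> W \<subseteq> M \<and> z \<notin> M}"
  have "S \<subseteq> Pow (carrier_vec n)" unfolding S_def vec_subspace_def by auto
  then have "finite S" using finite_carrier_vec finite_subset by (metis finite_Pow_iff)
  moreover have "W \<in> S" using W z unfolding S_def by auto
  ultimately obtain M where M: "M \<in> S" "W \<subseteq> M" and max: "\<And>M'. M' \<in> S \<Longrightarrow> M \<subseteq> M' \<Longrightarrow> M = M'"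
    using finite_has_maximal2[of S W] by metis
  have Ms: "M \<subseteq> carrier_vec n" "0\<^sub>v n \<in> M" "\<And>x y. x \<in> M \<Longrightarrow> y \<in> M \<Longrightarrow> x + y \<in> M"
    "\<And>c x. x \<in> M \<Longrightarrow> c \<cdot>\<^sub>v x \<in> M" and zM: "z \<notin> M"
    using M unfolding S_def vec_subspace_def by auto
  have Mc: "x \<in> M \<Longrightarrow> x \<in> carrier_vec n" for x using Ms(1) by auto
  have ex: "\<exists>c. v - c \<cdot>\<^sub>v z \<in> M" if v: "v \<in> carrier_vec n" for v
  proof (cases "v \<in> M")
    case True
    have "v - 0 \<cdot>\<^sub>v z = v" using v z by (intro eq_vecI) auto
    then show ?thesis using True by metis
  next
    case False
    let ?M = "{m + c \<cdot>\<^sub>v v | m c. m \<in> M}"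
    have "vec_subspace n ?M"
      unfolding vec_subspace_def
    proof (intro conjI ballI allI)
      show "?M \<subseteq> carrier_vec n" using Mc v by auto
      have "0\<^sub>v n = 0\<^sub>v n + 0 \<cdot>\<^sub>v v" using v by (intro eq_vecI) auto
      then show "0\<^sub>v n \<in> ?M" using Ms(2) by blast
    next
      fix x y assume "x \<in> ?M" "y \<in> ?M"
      then obtain m c m' c' where *: "x = m + c \<cdot>\<^sub>v v" "y = m' + c' \<cdot>\<^sub>v v" "m \<in> M" "m' \<in> M" by auto
      have "x + y = (m + m') + (c + c') \<cdot>\<^sub>v v"
        unfolding * using v Mc[OF *(3)] Mc[OF *(4)] by (intro eq_vecI) (auto simp: algebra_simps)
      then show "x + y \<in> ?M" using Ms(3)[OF *(3,4)] by blast
    next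
      fix a x assume "x \<in> ?M"
      then obtain m c where *: "x = m + c \<cdot>\<^sub>v v" "m \<in> M" by auto
      have "a \<cdot>\<^sub>v x = a \<cdot>\<^sub>v m + (a * c) \<cdot>\<^sub>v v"
        unfolding * using v Mc[OF *(2)] by (intro eq_vecI) (auto simp: algebra_simps)
      then show "a \<cdot>\<^sub>v x \<in> ?M" using Ms(4)[OF *(2)] by blast
    qed
    moreover have "M \<subseteq> ?M"
    proof
      fix m assume "m \<in> M"
      moreover have "m = m + 0 \<cdot>\<^sub>v v" using v Mc[OF calculation] by (intro eq_vecI) auto
      ultimately show "m \<in> ?M" by blast
    qed
    moreover have "v \<in> ?M"
    proof -
      have "v = 0\<^sub>v n + 1 \<cdot>\<^sub>v v" using v by (intro eq_vecI) auto
      then show ?thesis using Ms(2) by blast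
    qed
    ultimately have "z \<in> ?M" using max[of ?M] M(2) False unfolding S_def by blast
    then obtain m c where *: "z = m + c \<cdot>\<^sub>v v" "m \<in> M" by auto
    have "c \<noteq> 0"
    proof
      assume "c = 0"
      then have "z = m" unfolding *(1) using v Mc[OF *(2)] by (intro eq_vecI) auto
      then show False using zM *(2) by simp
    qed
    have "v - inverse c \<cdot>\<^sub>v z = (- inverse c) \<cdot>\<^sub>v m"
      unfolding *(1) using v Mc[OF *(2)] \<open>c \<noteq> 0\<close> by (intro eq_vecI) (auto simp: algebra_simps)
    then show ?thesis using Ms(4)[OF *(2)] by metis
  qed
  \<comment> \<open>Coordinate \<open>i\<close> of \<open>w\<close> is the coefficient of
    \<open>z\<close> in the \<open>i\<close>-th unit vector modulo the hyperplane
    \<open>M\<close>.\<close>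
  define w where "w = vec n (\<lambda>i. SOME c. unit_vec n i - c \<cdot>\<^sub>v z \<in> M)"
  have wc: "w \<in> carrier_vec n" unfolding w_def by simp
  have w: "unit_vec n i - (w $ i) \<cdot>\<^sub>v z \<in> M" if "i < n" for i
    using someI_ex[OF ex[of "unit_vec n i"]] that unfolding w_def by simp
  have proj: "v - (w \<bullet> v) \<cdot>\<^sub>v z \<in> M" if v: "v \<in> carrier_vec n" for v
  proof -
    \<comment> \<open>Induction on the number of coordinates of \<open>v\<close> that are kept
      extends the property from unit vectors to \<open>v\<close>.\<close>
    have "vec n (\<lambda>i. if i < k then v $ i else 0) - (\<Sum>i<k. w $ i * v $ i) \<cdot>\<^sub>v z \<in> M" if "k \<le> n" for k
      using that
    proof (induction k)
      case 0
      have "vec n (\<lambda>i. if i < 0 then v $ i else 0) - (\<Sum>i<0. w $ i * v $ i) \<cdot>\<^sub>v z = 0\<^sub>v n"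
        using z by (intro eq_vecI) auto
      then show ?case using Ms(2) by simp
    next
      case (Suc k)
      let ?a = "vec n (\<lambda>i. if i < k then v $ i else 0) - (\<Sum>i<k. w $ i * v $ i) \<cdot>\<^sub>v z"
      have "vec n (\<lambda>i. if i < Suc k then v $ i else 0) - (\<Sum>i<Suc k. w $ i * v $ i) \<cdot>\<^sub>v z
        = ?a + (v $ k) \<cdot>\<^sub>v (unit_vec n k - (w $ k) \<cdot>\<^sub>v z)"
        using z Suc.prems by (intro eq_vecI) (auto simp: algebra_simps less_Suc_eq)
      moreover have "?a + (v $ k) \<cdot>\<^sub>v (unit_vec n k - (w $ k) \<cdot>\<^sub>v z) \<in> M"
        using Suc by (intro Ms(3,4) w) auto
      ultimately show ?case by simp
    qed
    from this[of n] have "vec n (\<lambda>i. if i < n then v $ i else 0) - (\<Sum>i<n. w $ i * v $ i) \<cdot>\<^sub>v z \<in> M"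
      by simp
    moreover have "vec n (\<lambda>i. if i < n then v $ i else 0) = v" using v by (intro eq_vecI) auto
    moreover have "(\<Sum>i<n. w $ i * v $ i) = w \<bullet> v"
      using v by (auto simp: scalar_prod_def intro: sum.cong)
    ultimately show ?thesis by simp
  qed
  have uniq: "c = d" if "v \<in> carrier_vec n" "v - c \<cdot>\<^sub>v z \<in> M" "v - d \<cdot>\<^sub>v z \<in> M" for v c d
  proof (rule ccontr)
    assume "c \<noteq> d"
    have "(a - c * b) - (a - d * b) = (d - c) * b" for a b :: 'f by (simp add: algebra_simps)
    then have "z = inverse (d - c) \<cdot>\<^sub>v ((v - c \<cdot>\<^sub>v z) + (- 1) \<cdot>\<^sub>v (v - d \<cdot>\<^sub>v z))"
      using that(1) z \<open>c \<noteq> d\<close> by (intro eq_vecI) auto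
    moreover have "inverse (d - c) \<cdot>\<^sub>v ((v - c \<cdot>\<^sub>v z) + (- 1) \<cdot>\<^sub>v (v - d \<cdot>\<^sub>v z)) \<in> M"
      using that(2,3) by (intro Ms(3,4))
    ultimately have "z \<in> M" by simp
    then show False using zM by simp
  qed
  have "w \<bullet> x = 0" if x: "x \<in> W" for x
  proof (rule uniq[OF _ proj])
    show "x \<in> carrier_vec n" "x \<in> carrier_vec n" using x M(2) Mc by auto
    have "x - 0 \<cdot>\<^sub>v z = x" using \<open>x \<in> carrier_vec n\<close> z by (intro eq_vecI) auto
    then show "x - 0 \<cdot>\<^sub>v z \<in> M" using x M(2) by auto
  qed
  moreover have "w \<bullet> z = 1"
  proof (rule uniq[OF _ proj])
    have "z - 1 \<cdot>\<^sub>v z = 0\<^sub>v n" using z by (intro eq_vecI) auto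
    then show "z - 1 \<cdot>\<^sub>v z \<in> M" using Ms(2) by simp
  qed (rule z)+
  ultimately show ?thesis using wc by (metis one_neq_zero)
qed

text \<open>The span of the columns of \<open>g\<close> with index in \<open>D\<close>. With
  \<open>D\<close> of the form \<open>\<kappa> j \<le> a\<close> these are the steps of the flag
  that is stabilised by the conjugate of \<open>block_parabolic n \<kappa>\<close> under
  \<open>g\<close>.\<close>

definition flag :: "nat \<Rightarrow> 'f::field mat \<Rightarrow> (nat \<Rightarrow> bool) \<Rightarrow> 'f vec set" where
  "flag n g D = {g *\<^sub>v y | y. y \<in> carrier_vec n \<and> (\<forall>j<n. \<not> D j \<longrightarrow> y $ j = 0)}"

text \<open>The pivot positions of an echelon basis of \<open>F\<close>. Once boxes are numbered
  from the rightmost column, the leading entry of a vector lies in the rightmost column of its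
  support.\<close>

definition lead_index :: "nat \<Rightarrow> 'f::field vec set \<Rightarrow> nat \<Rightarrow> bool" where
  "lead_index n F i \<longleftrightarrow> i < n \<and> (\<exists>v\<in>F. v $ i \<noteq> 0 \<and> (\<forall>k<i. v $ k = 0))"

lemma flag_mono: "(\<And>j. j < n \<Longrightarrow> D j \<Longrightarrow> D' j) \<Longrightarrow> flag n g D \<subseteq> flag n g D'"
  unfolding flag_def by blast

lemma flag_cong: "(\<And>j. j < n \<Longrightarrow> D j = D' j) \<Longrightarrow> flag n g D = flag n g D'"
  by (intro equalityI flag_mono) auto

lemma lead_index_mono: "F \<subseteq> F' \<Longrightarrow> lead_index n F i \<Longrightarrow> lead_index n F' i"
  unfolding lead_index_def by blast

lemma vec_subspace_flag:
  fixes g :: "'f::field mat"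
  assumes g: "g \<in> carrier_mat n n"
  shows "vec_subspace n (flag n g D)"
  unfolding vec_subspace_def
proof (intro conjI ballI allI)
  show "flag n g D \<subseteq> carrier_vec n" unfolding flag_def using g by auto
  have "g *\<^sub>v 0\<^sub>v n = 0\<^sub>v n" using g by (intro eq_vecI) auto
  then show "0\<^sub>v n \<in> flag n g D" unfolding flag_def by (auto intro!: exI[of _ "0\<^sub>v n"])
next
  fix x y assume "x \<in> flag n g D" "y \<in> flag n g D"
  then obtain a b where *: "x = g *\<^sub>v a" "y = g *\<^sub>v b" "a \<in> carrier_vec n" "b \<in> carrier_vec n"
    "\<forall>j<n. \<not> D j \<longrightarrow> a $ j = 0" "\<forall>j<n. \<not> D j \<longrightarrow> b $ j = 0" unfolding flag_def by auto
  then show "x + y \<in> flag n g D"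
    unfolding flag_def using mult_add_distrib_mat_vec[OF g *(3,4)]
    by (auto intro!: exI[of _ "a + b"])
next
  fix c x assume "x \<in> flag n g D"
  then obtain a where *: "x = g *\<^sub>v a" "a \<in> carrier_vec n" "\<forall>j<n. \<not> D j \<longrightarrow> a $ j = 0"
    unfolding flag_def by auto
  then show "c \<cdot>\<^sub>v x \<in> flag n g D"
    unfolding flag_def using mult_mat_vec[OF g *(2), of c]
    by (auto intro!: exI[of _ "c \<cdot>\<^sub>v a"])
qed

lemma flag_UNIV:
  fixes g :: "'f::field mat"
  assumes "g \<in> carrier (GL n)" shows "flag n g (\<lambda>_. True) = carrier_vec n"
proof
  have g: "g \<in> carrier_mat n n" using assms by (rule carrier_GL_mat)
  show "flag n g (\<lambda>_. True) \<subseteq> carrier_vec n"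
    using vec_subspace_flag[OF g] unfolding vec_subspace_def by auto
  show "carrier_vec n \<subseteq> flag n g (\<lambda>_. True)"
  proof
    fix v :: "'f vec" assume v: "v \<in> carrier_vec n"
    then have "v = g *\<^sub>v (inv\<^bsub>GL n\<^esub> g *\<^sub>v v)"
      using inv_GL[OF assms] g by (simp flip: assoc_mult_mat_vec)
    then show "v \<in> flag n g (\<lambda>_. True)" unfolding flag_def using v inv_GL(1)[OF assms] by auto
  qed
qed

lemma flag_inv:
  assumes "g \<in> carrier (GL n)" "v \<in> flag n g D"
  shows "v \<in> carrier_vec n" "j < n \<Longrightarrow> \<not> D j \<Longrightarrow> (inv\<^bsub>GL n\<^esub> g *\<^sub>v v) $ j = 0"
proof -
  have g: "g \<in> carrier_mat n n" using assms(1) by (rule carrier_GL_mat)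
  obtain y where y: "v = g *\<^sub>v y" "y \<in> carrier_vec n" "\<forall>j<n. \<not> D j \<longrightarrow> y $ j = 0"
    using assms(2) unfolding flag_def by auto
  then show "v \<in> carrier_vec n" using g by simp
  have "inv\<^bsub>GL n\<^esub> g *\<^sub>v v = y"
    using inv_GL[OF assms(1)] g y by (simp flip: assoc_mult_mat_vec)
  then show "j < n \<Longrightarrow> \<not> D j \<Longrightarrow> (inv\<^bsub>GL n\<^esub> g *\<^sub>v v) $ j = 0" using y(3) by simp
qed

text \<open>A subspace has as many pivots as its dimension. Both inequalities come from injections
  between finite sets whose sizes are powers of q.\<close>

lemma card_lead_index:
  fixes g :: "'f::{field,finite} mat"
  assumes G: "g \<in> carrier (GL n)"
  shows "card {i. lead_index n (flag n g D) i} = card {j. j < n \<and> D j}"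
proof -
  have g: "g \<in> carrier_mat n n" using G by (rule carrier_GL_mat)
  let ?F = "flag n g D" and ?J = "{i. lead_index n (flag n g D) i}" and ?D = "{j. j < n \<and> D j}"
  let ?E = "{y :: 'f vec. y \<in> carrier_vec n \<and> (\<forall>j<n. j \<notin> ?D \<longrightarrow> y $ j = 0)}"
  have finJ: "finite ?J" by (rule finite_subset[of _ "{..<n}"]) (auto simp: lead_index_def)
  have cardE: "card ?E = card (UNIV :: 'f set) ^ card ?D" "finite ?E" by (rule card_vec_supported; auto)+
  have F: "?F = (\<lambda>y. g *\<^sub>v y) ` ?E" unfolding flag_def by auto
  have inj: "inj_on (\<lambda>y. g *\<^sub>v y) ?E"
  proof (rule inj_onI)
    fix x y assume "x \<in> ?E" "y \<in> ?E" "g *\<^sub>v x = g *\<^sub>v y"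
    then have "inv\<^bsub>GL n\<^esub> g *\<^sub>v (g *\<^sub>v x) = inv\<^bsub>GL n\<^esub> g *\<^sub>v (g *\<^sub>v y)" "x \<in> carrier_vec n" "y \<in> carrier_vec n"
      by auto
    then show "x = y" using inv_GL[OF G] g by (simp flip: assoc_mult_mat_vec)
  qed
  have cardF: "card ?F = card (UNIV :: 'f set) ^ card ?D" and finF: "finite ?F"
    unfolding F using card_image[OF inj] cardE by auto
  have cardJ: "card (?J \<rightarrow>\<^sub>E (UNIV :: 'f set)) = card (UNIV :: 'f set) ^ card ?J"
    using finJ by (simp add: card_funcsetE)
  have finE: "finite (?J \<rightarrow>\<^sub>E (UNIV :: 'f set))" using finJ by (simp add: finite_PiE)
  have q: "1 < card (UNIV :: 'f set)"
    using card_mono[of "UNIV :: 'f set" "{0, 1}"] by simp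
  \<comment> \<open>A nonzero difference of two members of the flag leads at a pivot, so each member
    is determined by its pivot coordinates.\<close>
  have "card ?F \<le> card (?J \<rightarrow>\<^sub>E (UNIV :: 'f set))"
  proof (rule card_inj_on_le[OF _ _ finE])
    show "inj_on (\<lambda>v. restrict (\<lambda>i. v $ i) ?J) ?F"
    proof (rule inj_onI, rule ccontr)
      fix x y assume xy: "x \<in> ?F" "y \<in> ?F" "restrict (\<lambda>i. x $ i) ?J = restrict (\<lambda>i. y $ i) ?J" "x \<noteq> y"
      let ?d = "x + (- 1) \<cdot>\<^sub>v y"
      have d: "?d \<in> ?F" using vec_subspace_flag[OF g, of D] xy unfolding vec_subspace_def by auto
      have c: "x \<in> carrier_vec n" "y \<in> carrier_vec n" using flag_inv(1)[OF G] xy by auto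
      have "\<exists>i. i < n \<and> ?d $ i \<noteq> 0"
      proof (rule ccontr)
        assume "\<not> ?thesis"
        then have "x = y" using c by (intro eq_vecI) auto
        then show False using xy by simp
      qed
      then obtain i where i: "i < n" "?d $ i \<noteq> 0" "\<And>k. k < i \<Longrightarrow> \<not> (k < n \<and> ?d $ k \<noteq> 0)"
        using exists_least_iff[of "\<lambda>i. i < n \<and> ?d $ i \<noteq> 0"] by auto
      then have "i \<in> ?J" using d unfolding lead_index_def by (auto intro!: bexI[of _ ?d])
      then have "x $ i = y $ i" using fun_cong[OF xy(3), of i] by simp
      then show False using i c by simp
    qed
  qed (auto split: if_splits)
  then have 1: "card ?D \<le> card ?J" using q by (simp add: cardF cardJ)
  have "\<exists>y. y \<in> ?E \<and> (g *\<^sub>v y) $ i \<noteq> 0 \<and> (\<forall>k<i. (g *\<^sub>v y) $ k = 0)" if "i \<in> ?J" for i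
    using that unfolding lead_index_def F by auto
  then have "\<forall>i\<in>?J. \<exists>y. y \<in> ?E \<and> (g *\<^sub>v y) $ i \<noteq> 0 \<and> (\<forall>k<i. (g *\<^sub>v y) $ k = 0)" by blast
  from bchoice[OF this] obtain y where
    "\<forall>i\<in>?J. y i \<in> ?E \<and> (g *\<^sub>v y i) $ i \<noteq> 0 \<and> (\<forall>k<i. (g *\<^sub>v y i) $ k = 0)" by blast
  then have y: "\<And>i. i \<in> ?J \<Longrightarrow> y i \<in> ?E" "\<And>i. i \<in> ?J \<Longrightarrow> (g *\<^sub>v y i) $ i \<noteq> 0"
    "\<And>i k. i \<in> ?J \<Longrightarrow> k < i \<Longrightarrow> (g *\<^sub>v y i) $ k = 0" by blast+
  have yc: "i \<in> ?J \<Longrightarrow> dim_vec (y i) = n" for i using y(1)[of i] by auto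
  \<comment> \<open>Combinations of coordinate vectors \<open>y i\<close> whose images lead at
    \<open>i\<close>. The first pivot at which \<open>a\<close> and \<open>b\<close> differ is
    visible in the image, whence injectivity.\<close>
  define \<Psi> where "\<Psi> a = vec n (\<lambda>j. \<Sum>i\<in>?J. a i * y i $ j)" for a
  have g\<Psi>: "(g *\<^sub>v \<Psi> a) $ k = (\<Sum>i\<in>?J. a i * (g *\<^sub>v y i) $ k)" if k: "k < n" for a k
  proof -
    have "(g *\<^sub>v \<Psi> a) $ k = (\<Sum>j<n. g $$ (k, j) * (\<Sum>i\<in>?J. a i * y i $ j))"
      using k g unfolding \<Psi>_def by (auto simp: scalar_prod_def lessThan_atLeast0 intro!: sum.cong)
    also have "\<dots> = (\<Sum>i\<in>?J. a i * (\<Sum>j<n. g $$ (k, j) * y i $ j))"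
      unfolding sum_distrib_left by (subst sum.swap) (simp add: mult_ac)
    also have "\<dots> = (\<Sum>i\<in>?J. a i * (g *\<^sub>v y i) $ k)"
      using k g yc by (auto simp: scalar_prod_def lessThan_atLeast0 intro!: sum.cong)
    finally show ?thesis .
  qed
  have "card (?J \<rightarrow>\<^sub>E (UNIV :: 'f set)) \<le> card ?E"
  proof (rule card_inj_on_le[OF _ _ cardE(2)])
    show "inj_on \<Psi> (?J \<rightarrow>\<^sub>E UNIV)"
    proof (rule inj_onI, rule ccontr)
      fix a b assume ab: "a \<in> ?J \<rightarrow>\<^sub>E UNIV" "b \<in> ?J \<rightarrow>\<^sub>E UNIV" "\<Psi> a = \<Psi> b" "a \<noteq> b"
      have "\<exists>i. i \<in> ?J \<and> a i \<noteq> b i"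
        using ab by (metis PiE_ext)
      then obtain i where i: "i \<in> ?J" "a i \<noteq> b i" "\<And>k. k < i \<Longrightarrow> \<not> (k \<in> ?J \<and> a k \<noteq> b k)"
        using exists_least_iff[of "\<lambda>i. i \<in> ?J \<and> a i \<noteq> b i"] by auto
      have "i < n" using i(1) unfolding lead_index_def by simp
      have "0 = (g *\<^sub>v \<Psi> a) $ i - (g *\<^sub>v \<Psi> b) $ i" using ab(3) by simp
      also have "\<dots> = (\<Sum>k\<in>?J. (a k - b k) * (g *\<^sub>v y k) $ i)"
        unfolding g\<Psi>[OF \<open>i < n\<close>] by (simp add: sum_subtractf left_diff_distrib)
      also have "\<dots> = (\<Sum>k\<in>?J. if k = i then (a i - b i) * (g *\<^sub>v y i) $ i else 0)"
      proof (rule sum.cong[OF refl])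
        fix k assume k: "k \<in> ?J"
        show "(a k - b k) * (g *\<^sub>v y k) $ i = (if k = i then (a i - b i) * (g *\<^sub>v y i) $ i else 0)"
          using i(3)[of k] k y(3)[OF k, of i] by (cases k i rule: linorder_cases) auto
      qed
      also have "\<dots> = (a i - b i) * (g *\<^sub>v y i) $ i" using i(1) finJ by simp
      finally show False using i y(2)[OF i(1)] by simp
    qed
    show "\<Psi> ` (?J \<rightarrow>\<^sub>E UNIV) \<subseteq> ?E"
      using y(1) unfolding \<Psi>_def by (auto intro!: sum.neutral)
  qed
  then have "card ?J \<le> card ?D" using q unfolding cardE cardJ by simp
  then show ?thesis using 1 by simp
qed

text \<open>The set is \<open>F\<close> plus all vectors supported outside \<open>R\<close>; it
  expresses membership in \<open>F\<close> up to terms in columns further left.\<close>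

lemma vec_subspace_modify:
  assumes F: "vec_subspace n F"
  shows "vec_subspace n {v \<in> carrier_vec n. \<exists>y\<in>F. \<forall>k<n. R k \<longrightarrow> y $ k = v $ k}"
    (is "vec_subspace n ?W")
  unfolding vec_subspace_def
proof (intro conjI ballI allI)
  show "0\<^sub>v n \<in> ?W" using F unfolding vec_subspace_def by (auto intro!: bexI[of _ "0\<^sub>v n"])
next
  fix v w assume "v \<in> ?W" "w \<in> ?W"
  then obtain y y' where y: "v \<in> carrier_vec n" "w \<in> carrier_vec n" "y \<in> F" "y' \<in> F"
    "\<forall>k<n. R k \<longrightarrow> y $ k = v $ k" "\<forall>k<n. R k \<longrightarrow> y' $ k = w $ k" by auto
  then have "y + y' \<in> F" "y \<in> carrier_vec n" "y' \<in> carrier_vec n"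
    using F unfolding vec_subspace_def by auto
  then show "v + w \<in> ?W" using y by (auto intro!: bexI[of _ "y + y'"])
next
  fix s v assume "v \<in> ?W"
  then obtain y where y: "v \<in> carrier_vec n" "y \<in> F" "\<forall>k<n. R k \<longrightarrow> y $ k = v $ k" by auto
  then have "s \<cdot>\<^sub>v y \<in> F" "y \<in> carrier_vec n" using F unfolding vec_subspace_def by auto
  then show "s \<cdot>\<^sub>v v \<in> ?W" using y by (auto intro!: bexI[of _ "s \<cdot>\<^sub>v y"])
qed auto

section \<open>Tableaux numbered by columns from right to left\<close>

text \<open>The boxes \<open>(rw i, cl i)\<close> of the diagram are numbered column by column from right to left, and
  from top to bottom inside each column.  Then \<open>U\<close> consists of lower unitriangular matrices and \<open>P\<close>
  contains the upper triangular ones.\<close>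

locale young_boxes =
  fixes n :: nat and lam :: "nat list" and rw cl :: "nat \<Rightarrow> nat"
  assumes boxes_bij: "bij_betw (\<lambda>i. (rw i, cl i)) {..<n} {(r, c). c < part lam r}"
    and boxes_order: "\<And>i j. i < j \<Longrightarrow> j < n \<Longrightarrow> cl j < cl i \<or> cl j = cl i \<and> rw i < rw j"
begin

lemma box_in: "i < n \<Longrightarrow> cl i < part lam (rw i)"
  using boxes_bij by (auto simp: bij_betw_def)

lemma box_inj: "i < n \<Longrightarrow> j < n \<Longrightarrow> rw i = rw j \<Longrightarrow> cl i = cl j \<Longrightarrow> i = j"
  using boxes_bij by (auto simp: bij_betw_def inj_on_def)

lemma box_ex: "c < part lam r \<Longrightarrow> \<exists>i<n. rw i = r \<and> cl i = c"
proof -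
  assume "c < part lam r"
  then have "(r, c) \<in> (\<lambda>i. (rw i, cl i)) ` {..<n}" using boxes_bij by (auto simp: bij_betw_def)
  then show ?thesis by auto
qed

definition idx :: "nat \<Rightarrow> nat \<Rightarrow> nat" where
  "idx r c = (THE i. i < n \<and> rw i = r \<and> cl i = c)"

lemma idx:
  assumes "c < part lam r" shows "idx r c < n" "rw (idx r c) = r" "cl (idx r c) = c"
proof -
  obtain i where i: "i < n" "rw i = r" "cl i = c" using box_ex[OF assms] by auto
  have "\<exists>!i. i < n \<and> rw i = r \<and> cl i = c"
  proof (rule ex1I[of _ i])
    fix j assume "j < n \<and> rw j = r \<and> cl j = c"
    then show "j = i" using box_inj[of j i] i by simp
  qed (use i in simp)
  then have "idx r c < n \<and> rw (idx r c) = r \<and> cl (idx r c) = c" unfolding idx_def by (rule theI')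
  then show "idx r c < n" "rw (idx r c) = r" "cl (idx r c) = c" by simp_all
qed

lemma idx_box:
  assumes "i < n" shows "idx (rw i) (cl i) = i"
  using box_inj[OF idx(1) assms idx(2,3)] box_in[OF assms] by simp

text \<open>The left neighbour. For a box in column 0 the truncated subtraction returns the box
  itself, so sums over neighbours are restricted to \<open>0 < cl k\<close>.\<close>

definition lft :: "nat \<Rightarrow> nat" where "lft k = idx (rw k) (cl k - 1)"

lemma lft:
  assumes "k < n" shows "lft k < n" "rw (lft k) = rw k" "cl (lft k) = cl k - 1"
  unfolding lft_def using idx[of "cl k - 1" "rw k"] box_in[OF assms] by auto

text \<open>A move by one column preserves the comparison of columns and leaves the rows alone. By
  \<open>0 < cl k\<close> the subtraction is not truncated, also for \<open>k'\<close>, whose column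
  is not further left.\<close>

lemma lft_order:
  assumes "k < n" "k' < n" "0 < cl k" "k' < k" shows "lft k' < lft k"
proof (rule ccontr)
  assume "\<not> ?thesis"
  then consider "lft k = lft k'" | "lft k < lft k'" by linarith
  then show False
  proof cases
    case 1
    then have "rw k = rw k'" "cl k - 1 = cl k' - 1" using lft assms by metis+
    then show ?thesis using boxes_order[OF assms(4,1)] assms(3) by auto
  next
    case 2
    then show ?thesis
      using boxes_order[OF 2 lft(1)[OF assms(2)]] boxes_order[OF assms(4,1)] assms by (auto simp: lft)
  qed
qed

definition U :: "'f::field mat set" where
  "U = {u \<in> carrier (GL n). \<forall>i<n. \<forall>j<n. \<not> cl i < cl j \<longrightarrow> u $$ (i, j) = (if i = j then 1 else 0)}"

lemma U_I:
  fixes u :: "'f::field mat"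
  assumes "u \<in> carrier_mat n n"
    and "\<And>i j. i < n \<Longrightarrow> j < n \<Longrightarrow> \<not> cl i < cl j \<Longrightarrow> u $$ (i, j) = (if i = j then 1 else 0)"
  shows "u \<in> U"
proof -
  have "det u = prod_list (diag_mat u)"
  proof (rule det_lower_triangular[OF _ assms(1)])
    fix i j assume ij: "i < j" "j < n"
    then have "\<not> cl i < cl j" using boxes_order[OF ij] by auto
    then show "u $$ (i, j) = 0" using assms(2)[of i j] ij by simp
  qed
  also have "diag_mat u = replicate n 1"
    using assms(1) assms(2)[of i i for i] by (intro nth_equalityI) (simp_all add: diag_mat_def)
  finally have "det u = 1" by simp
  then have "u \<in> carrier (GL n)" using assms(1) by (simp add: carrier_GL_det)
  then show ?thesis using assms(2) unfolding U_def by auto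
qed

text \<open>The character \<open>psi\<close> in coordinates: column \<open>k\<close> of
  \<open>u\<close> is the image of box \<open>k\<close>, and the entry at \<open>(lft k, k)\<close>
  is the coefficient of its left neighbour.\<close>

definition bchar :: "('f \<Rightarrow> 'k) \<Rightarrow> 'f::field mat \<Rightarrow> 'k::field" where
  "bchar \<theta> u = \<theta> (\<Sum>k | k < n \<and> 0 < cl k. u $$ (lft k, k))"

text \<open>If the character is trivial on \<open>U \<inter> g P g\<^sup>-\<^sup>1\<close>, testing it on transvections shows that the
  flag stabilised by \<open>g P g\<^sup>-\<^sup>1\<close> is lowered by the shift to the right, up to terms further left.\<close>

context
  fixes \<theta> :: "'f::{field,finite} \<Rightarrow> 'k::field" and \<kappa> :: "nat \<Rightarrow> nat" and g :: "'f mat"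
  assumes \<theta>_nontriv: "\<exists>x. \<theta> x \<noteq> 1"
    and G: "g \<in> carrier (GL n)"
    and trivial: "\<And>u. u \<in> U \<Longrightarrow> inv\<^bsub>GL n\<^esub> g * u * g \<in> block_parabolic n \<kappa> \<Longrightarrow> bchar \<theta> u = 1"
begin

lemma shift_flag:
  assumes x: "x \<in> flag n g (\<lambda>j. \<kappa> j \<le> a)" and supp: "\<And>i. i < n \<Longrightarrow> c < cl i \<Longrightarrow> x $ i = 0"
  shows "\<exists>y\<in>flag n g (\<lambda>j. \<kappa> j < a). \<forall>k<n. c < cl k \<longrightarrow> y $ k = x $ lft k"
proof (rule ccontr)
  assume no: "\<not> ?thesis"
  let ?F = "flag n g (\<lambda>j. \<kappa> j < a)" and ?gi = "inv\<^bsub>GL n\<^esub> g"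
  have g: "g \<in> carrier_mat n n" using G by (rule carrier_GL_mat)
  note gi = inv_GL[OF G]
  have xc: "x \<in> carrier_vec n" using flag_inv(1)[OF G x] .
  have F: "vec_subspace n ?F" using g by (rule vec_subspace_flag)
  \<comment> \<open>\<open>?W\<close> is the lower step of the flag modulo vectors in columns up to
    \<open>c\<close>, and \<open>?z\<close> is \<open>x\<close> moved one box to the right. Thus
    \<open>no\<close> says that \<open>?z\<close> lies outside \<open>?W\<close>.\<close>
  let ?W = "{v \<in> carrier_vec n. \<exists>y\<in>?F. \<forall>k<n. c < cl k \<longrightarrow> y $ k = v $ k}"
  let ?z = "vec n (\<lambda>k. if 0 < cl k then x $ lft k else 0)"
  have "vec_subspace n ?W" using F by (rule vec_subspace_modify)
  moreover have "?z \<notin> ?W" using no by fastforce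
  ultimately obtain w where w: "w \<in> carrier_vec n" "\<And>v. v \<in> ?W \<Longrightarrow> w \<bullet> v = 0" "w \<bullet> ?z \<noteq> 0"
    using exists_annihilator[of n ?W ?z] by auto
  have w_left: "w $ k = 0" if "k < n" "cl k \<le> c" for k
  proof -
    have "unit_vec n k \<in> ?W"
      using that F unfolding vec_subspace_def by (auto intro!: bexI[of _ "0\<^sub>v n"])
    then show ?thesis using w(1,2) that by fastforce
  qed
  have w_F: "w \<bullet> y = 0" if "y \<in> ?F" for y
    using that F unfolding vec_subspace_def by (intro w(2)) auto
  obtain t where t: "\<theta> t \<noteq> 1" using \<theta>_nontriv by auto
  \<comment> \<open>Scaled so that the character takes the value \<open>\<theta> t\<close>, which is
    not 1, at \<open>?u\<close>.\<close>
  define s where "s = t / (w \<bullet> ?z)"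
  \<comment> \<open>The column \<open>x\<close> times the row \<open>w\<close>. Since
    \<open>x\<close> lives in columns up to \<open>c\<close> and \<open>w\<close> in columns beyond
    \<open>c\<close>, adding the identity gives a member of \<open>U\<close>.\<close>
  let ?Y = "mat n n (\<lambda>(i, j). s * x $ i * w $ j)"
  let ?u = "1\<^sub>m n + ?Y"
  have "?u \<in> U"
  proof (rule U_I)
    fix i j assume ij: "i < n" "j < n" "\<not> cl i < cl j"
    then have "s * x $ i * w $ j = 0"
      using supp[of i] w_left[of j] by (cases "cl j \<le> c") auto
    then show "?u $$ (i, j) = (if i = j then 1 else 0)" using ij by simp
  qed auto
  moreover have "?gi * ?u * g \<in> block_parabolic n \<kappa>"
    unfolding block_parabolic_def
  proof (intro CollectI conjI allI impI)
    interpret group "GL n :: 'f mat monoid" by (rule group_GL)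
    have "?u \<in> carrier (GL n)" using \<open>?u \<in> U\<close> unfolding U_def by auto
    then have "?gi \<otimes>\<^bsub>GL n\<^esub> ?u \<otimes>\<^bsub>GL n\<^esub> g \<in> carrier (GL n)" using G by (intro m_closed inv_closed)
    then show "?gi * ?u * g \<in> carrier (GL n)" by simp
  next
    fix i j assume ij: "i < n" "j < n" "\<kappa> j < \<kappa> i"
    have "?gi * ?u * g = ?gi * g + ?gi * ?Y * g"
      using g gi(1) by (simp add: mult_add_distrib_mat[of _ n n _ n] add_mult_distrib_mat[of _ n n _ _ n])
    then have "(?gi * ?u * g) $$ (i, j) = (1\<^sub>m n) $$ (i, j) + (?gi * ?Y * g) $$ (i, j)"
      using g gi ij by simp
    also have "(1\<^sub>m n) $$ (i, j) = (0::'f)" using ij by auto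
    also have "(?gi * ?Y * g) $$ (i, j) =
        (\<Sum>b<n. (\<Sum>a<n. ?gi $$ (i, a) * (s * x $ a * w $ b)) * g $$ (b, j))"
      using g gi(1) ij by (auto simp: scalar_prod_def lessThan_atLeast0 intro!: sum.cong)
    also have "\<dots> = s * (\<Sum>a<n. ?gi $$ (i, a) * x $ a) * (\<Sum>b<n. w $ b * g $$ (b, j))"
      by (simp add: sum_distrib_left sum_distrib_right mult_ac) (rule sum.swap)
    also have "(\<Sum>a<n. ?gi $$ (i, a) * x $ a) = (?gi *\<^sub>v x) $ i"
      using gi(1) xc ij by (auto simp: scalar_prod_def lessThan_atLeast0 intro!: sum.cong)
    also have "(\<Sum>b<n. w $ b * g $$ (b, j)) = w \<bullet> (g *\<^sub>v unit_vec n j)"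
    proof -
      have "g *\<^sub>v unit_vec n j = col g j" using g ij by (intro eq_vecI) auto
      then show ?thesis using g ij by (auto simp: scalar_prod_def lessThan_atLeast0 intro!: sum.cong)
    qed
    \<comment> \<open>Of the two factors, \<open>?gi *\<^sub>v x\<close> vanishes at
      \<open>i\<close> if \<open>a < \<kappa> i\<close>, and \<open>w\<close> kills column
      \<open>j\<close> of \<open>g\<close> if \<open>\<kappa> j < a\<close>. One of these holds
      whenever \<open>\<kappa> j < \<kappa> i\<close>.\<close>
    also have "s * (?gi *\<^sub>v x) $ i * (w \<bullet> (g *\<^sub>v unit_vec n j)) = 0"
    proof (cases "\<kappa> i \<le> a")
      case True
      then have "g *\<^sub>v unit_vec n j \<in> ?F" unfolding flag_def
        using ij by (auto intro!: exI[of _ "unit_vec n j"] simp: unit_vec_def)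
      then show ?thesis using w_F by simp
    next
      case False
      then show ?thesis using flag_inv(2)[OF G x ij(1)] by simp
    qed
    finally show "(?gi * ?u * g) $$ (i, j) = 0" by simp
  qed
  moreover have "bchar \<theta> ?u = \<theta> t"
  proof -
    have "(\<Sum>k | k < n \<and> 0 < cl k. ?u $$ (lft k, k)) = (\<Sum>k | k < n \<and> 0 < cl k. s * (w $ k * x $ lft k))"
    proof (rule sum.cong[OF refl])
      fix k assume k: "k \<in> {k. k < n \<and> 0 < cl k}"
      then have "lft k \<noteq> k" using lft(3)[of k] by auto
      then show "?u $$ (lft k, k) = s * (w $ k * x $ lft k)" using k lft(1)[of k] by simp
    qed
    also have "\<dots> = s * (\<Sum>k<n. w $ k * ?z $ k)"
      unfolding sum_distrib_left by (rule sum.mono_neutral_cong_left) auto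
    also have "(\<Sum>k<n. w $ k * ?z $ k) = w \<bullet> ?z"
      by (auto simp: scalar_prod_def lessThan_atLeast0 intro!: sum.cong)
    also have "s * (w \<bullet> ?z) = t" using w(3) by (simp add: s_def)
    finally show ?thesis unfolding bchar_def by simp
  qed
  ultimately show False using trivial t by metis
qed

abbreviation lead :: "nat \<Rightarrow> nat \<Rightarrow> bool" where
  "lead a \<equiv> lead_index n (flag n g (\<lambda>j. \<kappa> j \<le> a))"

text \<open>Apply \<open>shift_flag\<close> with \<open>c\<close> the column of the leading box. The
  controlled part of \<open>y\<close> is \<open>x\<close> moved one box to the right, and since
  \<open>lft\<close> preserves the order, its leading entry moves from \<open>lft k\<close> to
  \<open>k\<close>.\<close>

lemma lead_shift:
  assumes "lead a (lft k)" "k < n" "0 < cl k"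
  shows "lead_index n (flag n g (\<lambda>j. \<kappa> j < a)) k"
proof -
  let ?i = "lft k"
  obtain x where x: "x \<in> flag n g (\<lambda>j. \<kappa> j \<le> a)" "x $ ?i \<noteq> 0" "\<And>l. l < ?i \<Longrightarrow> x $ l = 0"
    using assms(1) unfolding lead_index_def by auto
  have "x $ i = 0" if "i < n" "cl ?i < cl i" for i
    using x(3)[of i] boxes_order[of ?i i] that by (cases i ?i rule: linorder_cases) auto
  then obtain y where y: "y \<in> flag n g (\<lambda>j. \<kappa> j < a)" "\<And>l. l < n \<Longrightarrow> cl ?i < cl l \<Longrightarrow> y $ l = x $ lft l"
    using shift_flag[OF x(1), of "cl ?i"] by blast
  have "y $ k \<noteq> 0" using y(2)[of k] x(2) assms lft(3)[of k] by auto
  moreover have "y $ l = 0" if "l < k" for l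
  proof -
    have "cl k \<le> cl l" using boxes_order[OF that assms(2)] by auto
    then have "y $ l = x $ lft l" using y(2)[of l] that assms lft(3)[of k] by auto
    then show ?thesis using x(3) lft_order[of k l] that assms by auto
  qed
  ultimately show ?thesis unfolding lead_index_def using y(1) assms(2) by auto
qed

lemma lead_UNIV: "(\<And>j. j < n \<Longrightarrow> \<kappa> j \<le> a) \<Longrightarrow> i < n \<Longrightarrow> lead a i"
proof -
  assume "\<And>j. j < n \<Longrightarrow> \<kappa> j \<le> a" and i: "i < n"
  then have "flag n g (\<lambda>j. \<kappa> j \<le> a) = carrier_vec n"
    using flag_cong[of n "\<lambda>j. \<kappa> j \<le> a" "\<lambda>_. True" g] flag_UNIV[OF G] by simp
  then have "unit_vec n i \<in> flag n g (\<lambda>j. \<kappa> j \<le> a)" by simp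
  moreover have "unit_vec n i $ i \<noteq> (0::'f)" "\<forall>k<i. unit_vec n i $ k = (0::'f)" using i by auto
  ultimately show "lead a i" unfolding lead_index_def using i by blast
qed

text \<open>The level of a box: the first step of the flag in which its position is a pivot.\<close>

definition lev :: "nat \<Rightarrow> nat" where "lev i = (LEAST a. lead a i)"

lemma lead_lev:
  assumes "i < n" shows "lead a i \<longleftrightarrow> lev i \<le> a"
proof
  assume "lead a i" then show "lev i \<le> a" unfolding lev_def by (rule Least_le)
next
  assume a: "lev i \<le> a"
  \<comment> \<open>A crude bound for all block numbers; at this step the flag is the whole
    space.\<close>
  have "lead (\<Sum>j<n. \<kappa> j) i"
    using assms by (intro lead_UNIV) (auto intro: member_le_sum)
  then have "lead (lev i) i" unfolding lev_def by (rule LeastI)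
  then show "lead a i" using a by (elim lead_index_mono[OF flag_mono, rotated]) auto
qed

lemma lev_lft:
  assumes "k < n" "0 < cl k" shows "lev k < lev (lft k)"
proof -
  have l: "lft k < n" using lft(1) assms by simp
  then have "lead (lev (lft k)) (lft k)" by (simp add: lead_lev)
  then have *: "lead_index n (flag n g (\<lambda>j. \<kappa> j < lev (lft k))) k" by (rule lead_shift) fact+
  show ?thesis
  proof (cases "lev (lft k)")
    \<comment> \<open>Strictly below level 0 the flag is the zero space, which has no pivot.\<close>
    case 0
    have "flag n g (\<lambda>j. False) \<subseteq> {0\<^sub>v n}"
    proof
      fix v assume "v \<in> flag n g (\<lambda>j. False)"
      then obtain y where y: "v = g *\<^sub>v y" "y \<in> carrier_vec n" "\<forall>j<n. y $ j = 0"
        unfolding flag_def by auto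
      then have "y = 0\<^sub>v n" by (intro eq_vecI) auto
      then show "v \<in> {0\<^sub>v n}" using y carrier_GL_mat[OF G] by auto
    qed
    moreover obtain v where "v \<in> flag n g (\<lambda>j. False)" "v $ k \<noteq> 0"
      using * unfolding 0 lead_index_def by auto
    ultimately show ?thesis using assms(1) by auto
  next
    case (Suc a)
    then show ?thesis using * lead_lev[OF assms(1), of a] by (simp add: less_Suc_eq_le)
  qed
qed

lemma lev_row:
  assumes "i < n" "j < n" "rw i = rw j" "cl i < cl j" shows "lev j < lev i"
  using assms
proof (induction "cl j - cl i" arbitrary: j rule: less_induct)
  case less
  have l: "lft j < n" "rw (lft j) = rw j" "cl (lft j) = cl j - 1" using lft less.prems by auto
  have s: "lev j < lev (lft j)" using lev_lft less.prems by simp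
  show ?case
  proof (cases "cl i < cl j - 1")
    case True
    then have "lev (lft j) < lev i" using less.prems l by (intro less.hyps) auto
    then show ?thesis using s by simp
  next
    case False
    then have "lft j = i" using l less.prems by (subst box_inj[of "lft j" i]) auto
    then show ?thesis using s by simp
  qed
qed

text \<open>The pivots of each step of the flag are counted by its dimension. This gives the
  cumulative counts, and single levels follow by subtraction.\<close>

lemma card_lev: "card {i. i < n \<and> lev i = a} = card {i. i < n \<and> \<kappa> i = a}"
proof -
  have le: "card {i. i < n \<and> lev i \<le> a} = card {i. i < n \<and> \<kappa> i \<le> a}" for a
  proof -
    have "{i. i < n \<and> lev i \<le> a} = {i. lead a i}"
      using lead_lev by (auto simp: lead_index_def)
    then show ?thesis using card_lead_index[OF G] by simp
  qed
  have split: "card {i. i < n \<and> f i = Suc a} =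
      card {i. i < n \<and> f i \<le> Suc a} - card {i. i < n \<and> f i \<le> a}"
    for f :: "nat \<Rightarrow> nat" and a
    by (subst card_Diff_subset[symmetric]) (auto intro!: arg_cong[of _ _ card])
  show ?thesis
  proof (cases a)
    case 0
    then show ?thesis using le[of 0] by simp
  next
    case (Suc b)
    then show ?thesis using le split by simp
  qed
qed

text \<open>Levels are distinct along a row, so a row of length m has at most min(m,
  \<open>card S\<close>) boxes with level in \<open>S\<close>. This minimum is the number of its
  boxes in the first \<open>card S\<close> columns.\<close>

theorem card_levels_le:
  assumes "finite S"
  shows "card {i. i < n \<and> \<kappa> i \<in> S} \<le> card {i. i < n \<and> cl i < card S}"
proof -
  have fib: "card {i. i < n \<and> f i \<in> S} = (\<Sum>a\<in>S. card {i. i < n \<and> f i = a})" for f :: "nat \<Rightarrow> nat"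
  proof -
    have "{i. i < n \<and> f i \<in> S} = (\<Union>a\<in>S. {i. i < n \<and> f i = a})" by auto
    moreover have "card \<dots> = (\<Sum>a\<in>S. card {i. i < n \<and> f i = a})"
      by (rule card_UN_disjoint) (use assms in auto)
    ultimately show ?thesis by simp
  qed
  have row: "card {i. i < n \<and> P i} = (\<Sum>r\<in>rw ` {..<n}. card {i. i < n \<and> P i \<and> rw i = r})" for P
  proof -
    have "{i. i < n \<and> P i} = (\<Union>r\<in>rw ` {..<n}. {i. i < n \<and> P i \<and> rw i = r})" by auto
    moreover have "card \<dots> = (\<Sum>r\<in>rw ` {..<n}. card {i. i < n \<and> P i \<and> rw i = r})"
      by (rule card_UN_disjoint) auto
    ultimately show ?thesis by simp
  qed
  have "card {i. i < n \<and> lev i \<in> S \<and> rw i = r} \<le> card {i. i < n \<and> cl i < card S \<and> rw i = r}" for r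
  proof -
    let ?R = "{i. i < n \<and> lev i \<in> S \<and> rw i = r}" and ?C = "{i. i < n \<and> cl i < card S \<and> rw i = r}"
    have "card ?R \<le> card S"
    proof (rule card_inj_on_le[OF _ _ assms])
      show "inj_on lev ?R"
      proof (rule inj_onI, rule ccontr)
        fix i j assume ij: "i \<in> ?R" "j \<in> ?R" "lev i = lev j" "i \<noteq> j"
        then consider "cl i < cl j" | "cl j < cl i" using box_inj[of i j] by fastforce
        then show False using lev_row[of i j] lev_row[of j i] ij by cases auto
      qed
    qed auto
    moreover have "card ?R \<le> card {..<part lam r}"
      by (rule card_inj_on_le[of cl]) (auto simp: inj_on_def dest: box_inj box_in)
    ultimately have "card ?R \<le> card {..<min (part lam r) (card S)}" by simp
    also have "\<dots> \<le> card ?C"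
    proof (rule card_inj_on_le)
      show "inj_on (idx r) {..<min (part lam r) (card S)}"
        using idx(3) by (intro inj_onI) (metis lessThan_iff min_less_iff_conj)
      show "idx r ` {..<min (part lam r) (card S)} \<subseteq> ?C" using idx by auto
    qed auto
    finally show ?thesis .
  qed
  then have "card {i. i < n \<and> lev i \<in> S} \<le> card {i. i < n \<and> cl i < card S}"
    unfolding row[of "\<lambda>i. lev i \<in> S"] row[of "\<lambda>i. cl i < card S"] by (intro sum_mono)
  then show ?thesis unfolding fib[of lev] fib[of \<kappa>] using card_lev by simp
qed

end

section \<open>The parabolic subgroup of the columns and its cell\<close>

definition ncols :: nat where "ncols = (\<Sum>i<n. cl i)"

lemma cl_le: "i < n \<Longrightarrow> cl i \<le> ncols"
  unfolding ncols_def by (rule member_le_sum) auto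

text \<open>\<open>ncols\<close> is just an upper bound for the column indices. It keeps the
  subtraction from being truncated, so the blocks are the columns in reversed order.\<close>

definition P :: "'f::field mat set" where
  "P = block_parabolic n (\<lambda>i. ncols - cl i)"

text \<open>For \<open>P\<close> itself the flag is forced into general position with respect to the columns,
  which puts \<open>g\<close> into the cell \<open>U P\<close>.\<close>

theorem trivial_imp_cell:
  fixes \<theta> :: "'f::{field,finite} \<Rightarrow> 'k::field" and g :: "'f mat"
  assumes \<theta>: "\<exists>x. \<theta> x \<noteq> 1" and G: "g \<in> carrier (GL n)"
    and triv: "\<And>u. u \<in> U \<Longrightarrow> inv\<^bsub>GL n\<^esub> g * u * g \<in> P \<Longrightarrow> bchar \<theta> u = 1"
  shows "\<exists>u\<in>U. \<exists>p\<in>P. g = u * p"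
proof -
  let ?\<kappa> = "\<lambda>i. ncols - cl i"
  note triv' = triv[unfolded P_def]
  have g: "g \<in> carrier_mat n n" using G by (rule carrier_GL_mat)
  note gi = inv_GL[OF G]
  \<comment> \<open>In column 0 the step of the flag is the whole space, and each move to the right
    lowers the step by exactly one.\<close>
  have lead: "lead_index n (flag n g (\<lambda>j. ?\<kappa> j \<le> ?\<kappa> k)) k" if "k < n" for k
    using that
  proof (induction "cl k" arbitrary: k)
    case 0
    then show ?case by (intro lead_UNIV[OF \<theta> G triv']) auto
  next
    case (Suc c)
    have l: "lft k < n" "cl (lft k) = c" using lft[of k] Suc by auto
    then have "lead_index n (flag n g (\<lambda>j. ?\<kappa> j \<le> ?\<kappa> (lft k))) (lft k)" using Suc by auto
    then have "lead_index n (flag n g (\<lambda>j. ?\<kappa> j < ?\<kappa> (lft k))) k"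
      using Suc by (intro lead_shift[OF \<theta> G triv']) auto
    moreover have "?\<kappa> (lft k) = Suc (?\<kappa> k)" using l Suc cl_le[of k] by auto
    ultimately show ?case by (simp add: less_Suc_eq_le)
  qed
  \<comment> \<open>The wanted column \<open>i\<close> of \<open>u\<close>: free in the columns left
    of box \<open>i\<close>, a unit vector elsewhere. An obstruction is a functional
    \<open>w\<close> that lives on the columns from that of box \<open>i\<close> onwards to the
    right.\<close>
  have "\<exists>y\<in>flag n g (\<lambda>j. ?\<kappa> j \<le> ?\<kappa> i). \<forall>k<n. cl i \<le> cl k \<longrightarrow> y $ k = (if k = i then 1 else 0)"
    if i: "i < n" for i
  proof (rule ccontr)
    assume no: "\<not> ?thesis"
    let ?F = "flag n g (\<lambda>j. ?\<kappa> j \<le> ?\<kappa> i)"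
    have F: "vec_subspace n ?F" using g by (rule vec_subspace_flag)
    let ?W = "{v \<in> carrier_vec n. \<exists>y\<in>?F. \<forall>k<n. cl i \<le> cl k \<longrightarrow> y $ k = v $ k}"
    have "vec_subspace n ?W" using F by (rule vec_subspace_modify)
    moreover have "unit_vec n i \<notin> ?W" using no i by (auto simp: unit_vec_def)
    ultimately obtain w where w: "w \<in> carrier_vec n" "\<And>v. v \<in> ?W \<Longrightarrow> w \<bullet> v = 0"
      "w \<bullet> unit_vec n i \<noteq> 0"
      using exists_annihilator[of n ?W "unit_vec n i"] by auto
    have w_left: "w $ k = 0" if "k < n" "cl k < cl i" for k
    proof -
      have "unit_vec n k \<in> ?W"
        using that F unfolding vec_subspace_def by (auto intro!: bexI[of _ "0\<^sub>v n"])
      then show ?thesis using w(1,2) that by fastforce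
    qed
    let ?S = "{k. k < n \<and> w $ k \<noteq> 0}"
    have "i \<in> ?S" using w(1,3) i by auto
    then have ne: "?S \<noteq> {}" and fin: "finite ?S" by auto
    \<comment> \<open>A vector of the flag that leads at the last position \<open>k\<close> of the
      support of \<open>w\<close> meets this support in \<open>k\<close> only, so its product with
      \<open>w\<close> is nonzero.\<close>
    define k where "k = Max ?S"
    have k: "k < n" "w $ k \<noteq> 0" using Max_in[OF fin ne] unfolding k_def by auto
    have max: "w $ j = 0" if "j < n" "k < j" for j
    proof (rule ccontr)
      assume "w $ j \<noteq> 0"
      then have "j \<le> Max ?S" using that by (intro Max_ge[OF fin]) simp
      then show False using that unfolding k_def by simp
    qed
    have "cl i \<le> cl k" using w_left[of k] k by (cases "cl k < cl i") auto
    obtain v where v: "v \<in> flag n g (\<lambda>j. ?\<kappa> j \<le> ?\<kappa> k)" "v $ k \<noteq> 0" "\<And>j. j < k \<Longrightarrow> v $ j = 0"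
      using lead[OF k(1)] unfolding lead_index_def by auto
    have "v \<in> ?F" using v(1) \<open>cl i \<le> cl k\<close> by (elim subsetD[OF flag_mono, rotated]) auto
    then have "v \<in> ?W" using F unfolding vec_subspace_def by auto
    then have "0 = w \<bullet> v" using w(2) by simp
    also have "\<dots> = (\<Sum>j<n. w $ j * v $ j)"
      using flag_inv(1)[OF G v(1)] by (simp add: scalar_prod_def lessThan_atLeast0)
    also have "\<dots> = (\<Sum>j<n. if j = k then w $ k * v $ k else 0)"
    proof (rule sum.cong[OF refl])
      fix j assume "j \<in> {..<n}"
      then show "w $ j * v $ j = (if j = k then w $ k * v $ k else 0)"
        using max[of j] v(3)[of j] by (cases j k rule: linorder_cases) auto
    qed
    also have "\<dots> = w $ k * v $ k" using k(1) by simp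
    finally show False using k(2) v(2) by simp
  qed
  then have "\<forall>i\<in>{..<n}. \<exists>y. y \<in> flag n g (\<lambda>j. ?\<kappa> j \<le> ?\<kappa> i) \<and>
      (\<forall>k<n. cl i \<le> cl k \<longrightarrow> y $ k = (if k = i then 1 else 0))" by blast
  from bchoice[OF this] obtain y where y: "\<And>i. i < n \<Longrightarrow> y i \<in> flag n g (\<lambda>j. ?\<kappa> j \<le> ?\<kappa> i)"
    "\<And>i k. i < n \<Longrightarrow> k < n \<Longrightarrow> cl i \<le> cl k \<Longrightarrow> y i $ k = (if k = i then 1 else 0)" by auto
  \<comment> \<open>Column \<open>i\<close> of \<open>u\<close> lies in the step of the flag that
    belongs to box \<open>i\<close>, which makes \<open>inv g * u\<close> block triangular.\<close>
  define u where "u = mat n n (\<lambda>(k, i). y i $ k)"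
  have uU: "u \<in> U" by (rule U_I) (auto simp: u_def y(2))
  interpret group "GL n :: 'f mat monoid" by (rule group_GL)
  have uG: "u \<in> carrier (GL n)" using uU unfolding U_def by auto
  have "inv\<^bsub>GL n\<^esub> g \<otimes>\<^bsub>GL n\<^esub> u \<in> P"
    unfolding P_def block_parabolic_def
  proof (intro CollectI conjI allI impI)
    show "inv\<^bsub>GL n\<^esub> g \<otimes>\<^bsub>GL n\<^esub> u \<in> carrier (GL n)" using G uG by (intro m_closed inv_closed)
    fix j i assume ij: "j < n" "i < n" "?\<kappa> i < ?\<kappa> j"
    have yc: "dim_vec (y i) = n" using flag_inv(1)[OF G y(1)[OF ij(2)]] by auto
    have "(inv\<^bsub>GL n\<^esub> g * u) $$ (j, i) = (inv\<^bsub>GL n\<^esub> g *\<^sub>v y i) $ j"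
      using ij gi(1) yc by (auto simp: u_def scalar_prod_def intro!: sum.cong)
    also have "\<dots> = 0" using flag_inv(2)[OF G y(1)[OF ij(2)] ij(1)] ij(3) by auto
    finally show "(inv\<^bsub>GL n\<^esub> g \<otimes>\<^bsub>GL n\<^esub> u) $$ (j, i) = 0" by simp
  qed
  then have "inv\<^bsub>GL n\<^esub> (inv\<^bsub>GL n\<^esub> g \<otimes>\<^bsub>GL n\<^esub> u) \<in> P"
    unfolding P_def by (rule subgroup.m_inv_closed[OF subgroup_block_parabolic])
  moreover have "g = u \<otimes>\<^bsub>GL n\<^esub> inv\<^bsub>GL n\<^esub> (inv\<^bsub>GL n\<^esub> g \<otimes>\<^bsub>GL n\<^esub> u)"
    using G uG by (simp add: inv_mult_group del: GL_simps flip: m_assoc)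
  ultimately show ?thesis using uU by auto
qed

end

section \<open>Partitions\<close>

lemma part_simps: "i < length lam \<Longrightarrow> part lam i = lam ! i" "length lam \<le> i \<Longrightarrow> part lam i = 0"
  by (simp_all add: part_def)

lemma part_antimono:
  assumes "is_partition n lam" "i \<le> j" shows "part lam j \<le> part lam i"
proof (cases "i = j \<or> length lam \<le> j")
  case True then show ?thesis by (auto simp: part_simps)
next
  case False
  then show ?thesis
    using assms sorted_wrt_nth_less[of "(\<ge>)" lam i j] unfolding is_partition_def by (simp add: part_simps)
qed

lemma part_pos_iff:
  assumes "is_partition n lam" shows "0 < part lam i \<longleftrightarrow> i < length lam"
proof -
  have "lam ! i \<noteq> 0" if "i < length lam"
    using nth_mem[OF that] assms unfolding is_partition_def by metis
  then show ?thesis by (auto simp: part_def)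
qed

lemma part_eqI:
  assumes "is_partition n lam" "is_partition m mu" "\<And>i. part lam i = part mu i"
  shows "lam = mu"
proof (rule nth_equalityI)
  have e: "i < length lam \<longleftrightarrow> i < length mu" for i
    using part_pos_iff[OF assms(1), of i] part_pos_iff[OF assms(2), of i] assms(3)[of i] by simp
  show "length lam = length mu" using e[of "length lam"] e[of "length mu"] by linarith
  then show "lam ! i = mu ! i" if "i < length lam" for i
    using assms(3)[of i] that by (simp add: part_def)
qed

lemma partition_sum:
  assumes "is_partition n lam" shows "(\<Sum>i<length lam. part lam i) = n"
  using assms unfolding is_partition_def
  by (simp add: part_simps sum_list_sum_nth lessThan_atLeast0)

lemma is_partition_replicate: "is_partition n (replicate n 1)"
  unfolding is_partition_def by (simp add: sorted_wrt_iff_nth_less sum_list_replicate)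

lemma partition_length_le:
  assumes "is_partition n lam" shows "length lam \<le> n"
proof -
  have "(\<Sum>i<length lam. 1) \<le> (\<Sum>i<length lam. part lam i)"
    using part_pos_iff[OF assms] by (intro sum_mono) (simp add: Suc_leI)
  then show ?thesis using partition_sum[OF assms] by simp
qed

lemma finite_partitions: "finite {lam. is_partition n lam}"
proof (rule finite_subset)
  show "finite {xs. set xs \<subseteq> {..n} \<and> length xs \<le> n}" by (rule finite_lists_length_le) simp
  show "{lam. is_partition n lam} \<subseteq> {xs. set xs \<subseteq> {..n} \<and> length xs \<le> n}"
    using partition_length_le by (auto simp: is_partition_def intro: member_le_sum_list)
qed

section \<open>Young diagrams and conjugate partitions\<close>

definition diagram :: "nat list \<Rightarrow> (nat \<times> nat) set" where
  "diagram lam = {(r, c). c < part lam r}"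

lemma diagram_Sigma: "diagram lam = Sigma {..<length lam} (\<lambda>r. {..<part lam r})"
proof -
  have "r < length lam" if "c < part lam r" for r c
    using that part_simps(2)[of lam r] by (cases "r < length lam") auto
  then show ?thesis unfolding diagram_def by auto
qed

lemma finite_diagram: "finite (diagram lam)"
  unfolding diagram_Sigma by (intro finite_SigmaI) auto

lemma card_diagram: "is_partition n lam \<Longrightarrow> card (diagram lam) = n"
  unfolding diagram_Sigma by (subst card_SigmaI) (auto simp: partition_sum)

lemma finite_column: "finite {r. c < part lam r}"
proof (rule finite_subset)
  show "{r. c < part lam r} \<subseteq> fst ` diagram lam" unfolding diagram_def by force
qed (simp add: finite_diagram)

lemma part_conj:
  assumes "is_partition n lam"
  shows "part (conj_partition lam) c = card {r. c < part lam r}"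
proof (cases "c < part lam 0")
  case True
  then show ?thesis unfolding conj_partition_def part_def[of "map _ _"] by (simp add: Suc_le_eq)
next
  case False
  then have "{r. c < part lam r} = {}"
    using part_antimono[OF assms, of 0] by (auto simp: not_less intro: le_trans)
  then show ?thesis using False unfolding conj_partition_def part_def[of "map _ _"] by simp
qed

text \<open>Columns are initial segments because parts do not increase, so a column is determined by
  its height. This is what makes conjugation an involution.\<close>

lemma column_lessThan:
  assumes "is_partition n lam" shows "{r. c < part lam r} = {..<card {r. c < part lam r}}"
proof -
  let ?S = "{r. c < part lam r}"
  define m where "m = (LEAST r. r \<notin> ?S)"
  have "\<exists>r. r \<notin> ?S" using ex_new_if_finite[OF infinite_UNIV_nat finite_column[of c lam]] by auto
  then have m: "m \<notin> ?S" unfolding m_def by (metis LeastI)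
  have "r \<in> ?S \<longleftrightarrow> r < m" for r
  proof
    assume "r \<in> ?S"
    then show "r < m" using m part_antimono[OF assms, of m r] by (cases "r < m") auto
  next
    assume "r < m"
    then show "r \<in> ?S" unfolding m_def using not_less_Least by blast
  qed
  then have "?S = {..<m}" by auto
  then show ?thesis by simp
qed

lemma less_card_column_iff:
  "is_partition n lam \<Longrightarrow> r < card {r. c < part lam r} \<longleftrightarrow> c < part lam r"
  using column_lessThan[of n lam c] by blast

lemma is_partition_conj:
  assumes "is_partition n lam" shows "is_partition n (conj_partition lam)"
proof -
  have c: "conj_partition lam = map (\<lambda>c. card {r. c < part lam r}) [0..<part lam 0]"
    unfolding conj_partition_def by (simp add: Suc_le_eq)
  have "sorted_wrt (\<ge>) (conj_partition lam)"
    unfolding c sorted_wrt_iff_nth_less by (auto intro!: card_mono finite_column)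
  moreover have "0 \<notin> set (conj_partition lam)"
  proof
    assume "0 \<in> set (conj_partition lam)"
    then obtain k where k: "k < part lam 0" "card {r. k < part lam r} = 0" unfolding c by auto
    then show False using less_card_column_iff[OF assms, of 0 k] by simp
  qed
  moreover have "sum_list (conj_partition lam) = n"
  proof -
    have sub: "r < length lam \<and> c < part lam 0" if "c < part lam r" for r c
      using that part_simps(2)[of lam r] part_antimono[OF assms, of 0 r] by (cases "r < length lam") auto
    have "sum_list (conj_partition lam) = (\<Sum>c<part lam 0. card {r. c < part lam r})"
      unfolding c by (simp add: interv_sum_list_conv_sum_set_nat lessThan_atLeast0)
    also have "\<dots> = card (Sigma {..<part lam 0} (\<lambda>c. {r. c < part lam r}))"
      by (rule card_SigmaI[symmetric]) (auto simp: finite_column)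
    also have "Sigma {..<part lam 0} (\<lambda>c. {r. c < part lam r}) = prod.swap ` diagram lam"
      unfolding diagram_def using sub by force
    also have "card \<dots> = n" using card_diagram[OF assms] by (simp add: card_image)
    finally show ?thesis .
  qed
  ultimately show ?thesis unfolding is_partition_def by simp
qed

lemma conj_conj:
  assumes "is_partition n lam" shows "conj_partition (conj_partition lam) = lam"
proof (rule part_eqI[OF is_partition_conj[OF is_partition_conj[OF assms]] assms])
  fix r
  show "part (conj_partition (conj_partition lam)) r = part lam r"
    unfolding part_conj[OF is_partition_conj[OF assms]] part_conj[OF assms] less_card_column_iff[OF assms]
    by simp
qed

section \<open>The dominance order\<close>

lemma dominates_antisym:
  assumes "is_partition n lam" "is_partition m mu" "dominates lam mu" "dominates mu lam"
  shows "lam = mu"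
proof (rule part_eqI[OF assms(1,2)])
  have e: "(\<Sum>i<k. part lam i) = (\<Sum>i<k. part mu i)" for k
    using assms(3,4) unfolding dominates_def by (meson antisym)
  show "part lam i = part mu i" for i using e[of i] e[of "Suc i"] by simp
qed

text \<open>The weight \<open>w\<close> adds up all partial sums and hence cannot increase under
  \<open>f\<close>. As \<open>f\<close> permutes the finite set of partitions, the total weight is
  unchanged; so equality holds for every partition and then for every partial sum.\<close>

lemma injective_dominated_imp_identity:
  assumes f: "\<And>lam. is_partition n lam \<Longrightarrow> is_partition n (f lam)"
    and inj: "inj_on f {lam. is_partition n lam}"
    and dom: "\<And>lam. is_partition n lam \<Longrightarrow> dominates lam (f lam)"
    and lam: "is_partition n lam"
  shows "f lam = lam"
proof -
  define w where "w lam = (\<Sum>k\<le>n. \<Sum>i<k. part lam i)" for lam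
  let ?P = "{lam. is_partition n lam}"
  have le: "w (f l) \<le> w l" if "l \<in> ?P" for l
    unfolding w_def
  proof (rule sum_mono)
    have "dominates l (f l)" using dom that by simp
    then show "(\<Sum>i<k. part (f l) i) \<le> (\<Sum>i<k. part l i)" for k by (simp add: dominates_def)
  qed
  have "f ` ?P = ?P" using inj f by (intro endo_inj_surj finite_partitions) auto
  then have "(\<Sum>l\<in>?P. w l) = (\<Sum>l\<in>?P. w (f l))" using sum.reindex[OF inj, of w] by simp
  then have "w (f lam) = w lam"
    using sum_mono_inv[of "\<lambda>l. w (f l)" ?P w lam] le lam finite_partitions by simp
  then have "(\<Sum>i<k. part (f lam) i) = (\<Sum>i<k. part lam i)" if "k \<le> n" for k
    unfolding w_def using that dom[OF lam]
    by (rule_tac sum_mono_inv[of "\<lambda>k. \<Sum>i<k. part (f lam) i" "{..n}" "\<lambda>k. \<Sum>i<k. part lam i"])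
      (auto simp: dominates_def)
  note e = this
  show ?thesis
  proof (rule part_eqI[OF f[OF lam] lam])
    fix i
    show "part (f lam) i = part lam i"
    proof (cases "i < n")
      case True
      then show ?thesis using e[of i] e[of "Suc i"] by simp
    next
      case False
      then show ?thesis using partition_length_le[OF lam] partition_length_le[OF f[OF lam]]
        by (simp add: part_simps)
    qed
  qed
qed

section \<open>Block sizes and the numbering of boxes\<close>

lemma row_of_box_less_iff:
  assumes "is_partition n lam" "i < n"
  shows "row_of_box lam i < k \<longleftrightarrow> i < (\<Sum>j<k. part lam j)"
proof
  have ex: "i < (\<Sum>j\<le>length lam. part lam j)"
    using assms partition_sum[OF assms(1)] by (simp add: lessThan_Suc_atMost[symmetric])
  assume r: "row_of_box lam i < k"
  have "i < (\<Sum>j\<le>row_of_box lam i. part lam j)"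
    unfolding row_of_box_def by (rule LeastI[of "\<lambda>r. i < (\<Sum>j\<le>r. part lam j)", OF ex])
  also have "\<dots> \<le> (\<Sum>j<k. part lam j)" using r by (intro sum_mono2) auto
  finally show "i < (\<Sum>j<k. part lam j)" .
next
  assume i: "i < (\<Sum>j<k. part lam j)"
  then obtain k' where k: "k = Suc k'" by (cases k) auto
  then have "i < (\<Sum>j\<le>k'. part lam j)" using i by (simp add: lessThan_Suc_atMost)
  then have "row_of_box lam i \<le> k'" unfolding row_of_box_def by (rule Least_le)
  then show "row_of_box lam i < k" using k by simp
qed

lemma card_row_of_box_less:
  assumes "is_partition n lam"
  shows "card {i. i < n \<and> row_of_box lam i < k} = (\<Sum>j<k. part lam j)"
proof -
  have "(\<Sum>j<k. part lam j) = (\<Sum>j\<in>{..<k} \<inter> {..<length lam}. part lam j)"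
    by (rule sum.mono_neutral_right) (auto simp: part_def)
  also have "\<dots> \<le> (\<Sum>j<length lam. part lam j)" by (intro sum_mono2) auto
  finally have le: "(\<Sum>j<k. part lam j) \<le> n" using partition_sum[OF assms] by simp
  have "{i. i < n \<and> row_of_box lam i < k} = {..<(\<Sum>j<k. part lam j)}"
    using row_of_box_less_iff[OF assms] le by auto
  then show ?thesis by simp
qed

lemma exists_young_boxes:
  assumes "is_partition n lam" shows "\<exists>rw cl. young_boxes n lam rw cl"
proof -
  let ?A = "diagram lam"
  obtain M where M: "\<And>r c. (r, c) \<in> ?A \<Longrightarrow> r < M \<and> c < M"
  proof -
    have "finite (fst ` ?A \<union> snd ` ?A)" using finite_diagram by auto
    then obtain M where "\<forall>x\<in>fst ` ?A \<union> snd ` ?A. x < M" by (auto simp: finite_nat_set_iff_bounded)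
    then show thesis by (intro that[of M]) force
  qed
  \<comment> \<open>A lexicographic rank: columns from right to left come first, rows second.
    \<open>M\<close> exceeds all coordinates, so the row never carries over into the next
    column.\<close>
  define key where "key b = (M - snd b) * M + fst b" for b :: "nat \<times> nat"
  have key: "c' < c \<or> c' = c \<and> r < r'"
    if "(r, c) \<in> ?A" "(r', c') \<in> ?A" "key (r, c) < key (r', c')" for r c r' c'
  proof (rule ccontr)
    assume no: "\<not> ?thesis"
    have "c \<noteq> c'" using no that(3) unfolding key_def by auto
    then have "c < c'" using no by simp
    then have "M - c' + 1 \<le> M - c" using M[OF that(2)] by linarith
    then have "(M - c' + 1) * M \<le> (M - c) * M" by (rule mult_le_mono1)
    then show False using that(3) M[OF that(2)] unfolding key_def by simp
  qed
  have inj: "inj_on key ?A"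
  proof (rule inj_onI, rule ccontr)
    fix b b' assume b: "b \<in> ?A" "b' \<in> ?A" "key b = key b'" "b \<noteq> b'"
    obtain r c r' c' where rc: "b = (r, c)" "b' = (r', c')" by (metis prod.exhaust)
    have *: "(M - y + 1) * M \<le> (M - x) * M" if "x < y" "y < M" for x y
      using that by (intro mult_le_mono1) linarith
    have "c = c'" using b(3) *[of c c'] *[of c' c] M b(1,2) unfolding key_def rc
      by (cases c c' rule: linorder_cases) fastforce+
    then show False using b(3,4) unfolding key_def rc by simp
  qed
  obtain e where e: "bij_betw e {..<card (key ` ?A)} (key ` ?A)" "strict_mono_on {..<card (key ` ?A)} e"
    using ex_bij_betw_strict_mono_card[of "key ` ?A"] finite_diagram by blast
  have n: "card (key ` ?A) = n" using card_image[OF inj] card_diagram[OF assms] by simp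
  define b where "b i = inv_into ?A key (e i)" for i
  have bij: "bij_betw b {..<n} ?A"
    using bij_betw_trans[OF e(1) bij_betw_inv_into[OF inj_on_imp_bij_betw[OF inj]]]
    unfolding n b_def by (simp add: comp_def)
  have keyb: "key (b i) = e i" if "i < n" for i
    using that e(1) unfolding b_def n by (intro f_inv_into_f) (auto simp: bij_betw_def)
  have "young_boxes n lam (\<lambda>i. fst (b i)) (\<lambda>i. snd (b i))"
  proof
    show "bij_betw (\<lambda>i. (fst (b i), snd (b i))) {..<n} {(r, c). c < part lam r}"
      using bij unfolding diagram_def by simp
  next
    fix i j assume ij: "i < j" "j < n"
    have "key (b i) < key (b j)" using keyb ij e(2) unfolding n by (auto simp: strict_mono_on_def)
    moreover have "b i \<in> ?A" "b j \<in> ?A" using bij ij by (auto simp: bij_betw_def)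
    ultimately show "snd (b j) < snd (b i) \<or> snd (b j) = snd (b i) \<and> fst (b i) < fst (b j)"
      using key[of "fst (b i)" "snd (b i)" "fst (b j)" "snd (b j)"] by simp
  qed
  then show ?thesis by blast
qed

lemma (in young_boxes) card_cols:
  assumes "is_partition n lam"
  shows "card {i. i < n \<and> cl i < k} = (\<Sum>c<k. part (conj_partition lam) c)"
proof -
  have col: "card {i. i < n \<and> cl i = c} = part (conj_partition lam) c" for c
  proof -
    have "bij_betw rw {i. i < n \<and> cl i = c} {r. c < part lam r}"
      by (rule bij_betwI[of _ _ _ "\<lambda>r. idx r c"]) (auto simp: idx idx_box dest: box_in)
    then show ?thesis unfolding part_conj[OF assms] by (rule bij_betw_same_card)
  qed
  have "{i. i < n \<and> cl i < k} = (\<Union>c\<in>{..<k}. {i. i < n \<and> cl i = c})" by auto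
  moreover have "card \<dots> = (\<Sum>c<k. card {i. i < n \<and> cl i = c})" by (rule card_UN_disjoint) auto
  ultimately show ?thesis using col by simp
qed

section \<open>The characters of the unipotent groups\<close>

text \<open>In characteristic p the p-th power is additive, so a p-th root of unity \<zeta>
  satisfies (\<zeta> - 1)^p = 0.\<close>

lemma of_nat_prime_nonzero:
  assumes "prime p" "\<exists>\<zeta>::'k::field. \<zeta> ^ p = 1 \<and> \<zeta> \<noteq> 1"
  shows "of_nat p \<noteq> (0::'k)"
proof
  assume "of_nat p = (0::'k)"
  then have "CHAR('k) dvd p" by (simp add: of_nat_eq_0_iff_char_dvd)
  moreover have "CHAR('k) \<noteq> 1" by simp
  ultimately have char: "CHAR('k) = p" using assms(1) by (auto simp: prime_nat_iff)
  obtain \<zeta> :: 'k where \<zeta>: "\<zeta> ^ p = 1" "\<zeta> \<noteq> 1" using assms(2) by auto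
  have dream: "(x + y) ^ p = x ^ p + y ^ p" for x y :: 'k
    using assms(1) char by (intro freshmans_dream) auto
  \<comment> \<open>Additivity on the sum of -1 and 1 treats odd p and p = 2 alike.\<close>
  have "(- 1 :: 'k) ^ p = - 1"
    using dream[of "- 1" 1] assms(1) by (simp add: prime_gt_0_nat add_eq_0_iff2 zero_power)
  then have "(\<zeta> - 1) ^ p = 0" using dream[of \<zeta> "- 1"] \<zeta> by simp
  then show False using \<zeta> by simp
qed

locale add_char =
  fixes \<theta> :: "'f::{field,finite} \<Rightarrow> 'k::field"
  assumes \<theta>_nonzero: "\<theta> x \<noteq> 0" and \<theta>_add: "\<theta> (x + y) = \<theta> x * \<theta> y" and \<theta>_nontrivial: "\<exists>x. \<theta> x \<noteq> 1"
    and card_field: "of_nat (card (UNIV :: 'f set)) \<noteq> (0::'k)"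
begin

lemma \<theta>_zero: "\<theta> 0 = 1" using \<theta>_add[of 0 0] \<theta>_nonzero[of 0] by simp

lemma \<theta>_minus: "\<theta> (- x) * \<theta> x = 1" using \<theta>_add[of "- x" x] \<theta>_zero by simp

end

context young_boxes
begin

lemma U_carrier: "U \<subseteq> carrier (GL n :: 'f::field mat monoid)"
  unfolding U_def by auto

lemma U_entry: "u \<in> U \<Longrightarrow> i < n \<Longrightarrow> j < n \<Longrightarrow> \<not> cl i < cl j \<Longrightarrow> u $$ (i, j) = (if i = j then 1 else 0)"
  unfolding U_def by auto

lemma U_mat: "u \<in> U \<Longrightarrow> u \<in> carrier_mat n n"
  unfolding U_def using carrier_GL_mat by auto

lemma U_mult:
  fixes u v :: "'f::field mat"
  assumes "u \<in> U" "v \<in> U" shows "u * v \<in> U"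
proof (rule U_I)
  show "u * v \<in> carrier_mat n n" using assms U_mat by (intro mult_carrier_mat) auto
  fix i j assume ij: "i < n" "j < n" "\<not> cl i < cl j"
  have "(u * v) $$ (i, j) = (\<Sum>k<n. u $$ (i, k) * v $$ (k, j))"
    using ij U_mat[OF assms(1)] U_mat[OF assms(2)] by (simp add: scalar_prod_def lessThan_atLeast0)
  also have "\<dots> = (\<Sum>k<n. if k = i then if i = j then 1 else 0 else 0)"
  proof (rule sum.cong[OF refl])
    fix k assume "k \<in> {..<n}"
    then show "u $$ (i, k) * v $$ (k, j) = (if k = i then if i = j then 1 else 0 else 0)"
      using U_entry[OF assms(1), of i k] U_entry[OF assms(2), of k j] ij by (cases "cl i < cl k") auto
  qed
  also have "\<dots> = (if i = j then 1 else 0)" using ij by simp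
  finally show "(u * v) $$ (i, j) = (if i = j then 1 else 0)" .
qed

lemma one_U: "1\<^sub>m n \<in> U" by (rule U_I) auto

lemma subgroup_U: "subgroup (U :: 'f::{field,finite} mat set) (GL n)"
  by (rule subgroup_finiteI[OF group_GL])
    (auto simp: one_U U_mult intro: finite_subset[OF U_carrier finite_GL] dest: subsetD[OF U_carrier])

text \<open>The entries at \<open>(i, j)\<close> with \<open>cl i < cl j\<close> are free. As a
  power of q, the order is invertible in the coefficient field.\<close>

lemma card_U: "\<exists>m. card (U :: 'f::{field,finite} mat set) = card (UNIV :: 'f set) ^ m"
proof -
  let ?D = "{(i, j). i < n \<and> j < n \<and> cl i < cl j}"
  let ?h = "\<lambda>f. mat n n (\<lambda>(i, j). if cl i < cl j then f (i, j) else if i = j then 1 else 0) :: 'f mat"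
  have fin: "finite ?D" by (rule finite_subset[of _ "{..<n} \<times> {..<n}"]) auto
  have "bij_betw ?h (?D \<rightarrow>\<^sub>E UNIV) U"
  proof (rule bij_betwI[of _ _ _ "\<lambda>u. restrict (\<lambda>ij. u $$ ij) ?D"])
    show "?h \<in> (?D \<rightarrow>\<^sub>E UNIV) \<rightarrow> U" by (intro funcsetI U_I) auto
    show "?h (restrict (\<lambda>ij. u $$ ij) ?D) = u" if "u \<in> U" for u
      using U_entry[OF that] U_mat[OF that] by (intro eq_matI) auto
    show "restrict (\<lambda>ij. ?h f $$ ij) ?D = f" if "f \<in> ?D \<rightarrow>\<^sub>E UNIV" for f
      using that by (auto simp: PiE_def extensional_def fun_eq_iff)
  qed auto
  from bij_betw_same_card[OF this] have "card (U :: 'f mat set) = card (UNIV :: 'f set) ^ card ?D"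
    unfolding card_funcsetE[OF fin] by (rule sym)
  then show ?thesis by (rule exI)
qed

text \<open>A diagonal involution whose conjugation changes the sign of the entries between adjacent
  columns and so inverts the character. In characteristic 2 it is the identity, in accordance with
  \<theta> being its own inverse there.\<close>

definition torus :: "'f::field mat" where
  "torus = mat n n (\<lambda>(i, j). if i = j then (- 1) ^ cl i else 0)"

lemma torus_mat [simp]: "torus \<in> carrier_mat n n" "dim_row torus = n" "dim_col torus = n"
  unfolding torus_def by auto

lemma torus_mult:
  assumes "(A :: 'f::field mat) \<in> carrier_mat n n" "i < n" "j < n"
  shows "(torus * A) $$ (i, j) = (- 1) ^ cl i * A $$ (i, j)"
    and "(A * torus) $$ (i, j) = A $$ (i, j) * (- 1) ^ cl j"
proof -
  show "(torus * A) $$ (i, j) = (- 1) ^ cl i * A $$ (i, j)"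
    using assms by (simp add: torus_def scalar_prod_def if_distrib[of "\<lambda>x. x * _"] cong: if_cong)
  show "(A * torus) $$ (i, j) = A $$ (i, j) * (- 1) ^ cl j"
    using assms by (simp add: torus_def scalar_prod_def if_distrib[of "\<lambda>x. _ * x"] cong: if_cong)
qed

lemma minus1_power_square: "(- 1) ^ c * (- 1) ^ c = (1 :: 'f::field)"
  by (simp flip: power_mult_distrib)

lemma torus_torus: "torus * torus = (1\<^sub>m n :: 'f::field mat)"
proof (rule eq_matI)
  fix i j assume "i < dim_row (1\<^sub>m n :: 'f mat)" "j < dim_col (1\<^sub>m n :: 'f mat)"
  then have ij: "i < n" "j < n" by auto
  show "(torus * torus) $$ (i, j) = (1\<^sub>m n :: 'f mat) $$ (i, j)"
    unfolding torus_mult(1)[OF torus_mat(1) ij] using ij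
    by (simp add: torus_def minus1_power_square)
qed auto

lemma torus_P: "torus \<in> P"
proof -
  have "torus \<in> carrier (GL n)" unfolding carrier_GL_iff using torus_torus torus_mat(1) by blast
  then show ?thesis unfolding P_def block_parabolic_def by (auto simp: torus_def)
qed

lemma torus_conj_entry:
  assumes "(u :: 'f::field mat) \<in> carrier_mat n n" "i < n" "j < n"
  shows "(torus * u * torus) $$ (i, j) = (- 1) ^ cl i * u $$ (i, j) * (- 1) ^ cl j"
proof -
  have "torus * u \<in> carrier_mat n n" using assms by (intro mult_carrier_mat[of _ n n]) auto
  from torus_mult(2)[OF this assms(2,3)] show ?thesis unfolding torus_mult(1)[OF assms] .
qed

lemma torus_U:
  assumes "(u :: 'f::field mat) \<in> U" shows "torus * u * torus \<in> U"
proof (rule U_I)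
  show "torus * u * torus \<in> carrier_mat n n"
    using U_mat[OF assms] by (intro mult_carrier_mat[of _ n n]) auto
  fix i j assume ij: "i < n" "j < n" "\<not> cl i < cl j"
  show "(torus * u * torus) $$ (i, j) = (if i = j then 1 else 0)"
    unfolding torus_conj_entry[OF U_mat[OF assms] ij(1,2)] using U_entry[OF assms ij]
    by (simp add: minus1_power_square)
qed

lemma U_P: "U \<inter> P = {1\<^sub>m n :: 'f::field mat}"
proof
  show "U \<inter> P \<subseteq> {1\<^sub>m n :: 'f mat}"
  proof
    fix u :: "'f mat" assume u: "u \<in> U \<inter> P"
    have "u $$ (i, j) = (1\<^sub>m n) $$ (i, j)" if ij: "i < n" "j < n" for i j
    proof (cases "cl i < cl j")
      case True
      then have "ncols - cl j < ncols - cl i" using cl_le[OF ij(2)] by simp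
      then have "u $$ (i, j) = 0" using u ij unfolding P_def block_parabolic_def by auto
      then show ?thesis using ij True by auto
    next
      case False
      then show ?thesis using U_entry[of u i j] u ij by simp
    qed
    then show "u \<in> {1\<^sub>m n}" using U_mat[of u] u by (auto intro!: eq_matI)
  qed
  have "1\<^sub>m n \<in> carrier (GL n :: 'f mat monoid)" using one_U U_carrier by blast
  then show "{1\<^sub>m n :: 'f mat} \<subseteq> U \<inter> P" using one_U unfolding P_def block_parabolic_def by auto
qed

lemma char_cell_U:
  fixes \<theta> :: "'f::{field,finite} \<Rightarrow> 'k::field"
  assumes "add_char \<theta>"
  shows "char_cell (GL n) (U :: 'f mat set) (bchar \<theta>) P torus"
proof -
  interpret add_char \<theta> by fact
  interpret G: group "GL n :: 'f mat monoid" by (rule group_GL)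
  let ?K = "{k. k < n \<and> 0 < cl k}"
  show ?thesis
  proof (intro char_cell.intro lin_char.intro char_cell_axioms.intro lin_char_axioms.intro)
    show "group (GL n :: 'f mat monoid)" by (rule group_GL)
    show "subgroup (U :: 'f mat set) (GL n)" by (rule subgroup_U)
    show "finite (U :: 'f mat set)" by (rule finite_subset[OF U_carrier finite_GL])
    obtain m where "card (U :: 'f mat set) = card (UNIV :: 'f set) ^ m" using card_U by auto
    then show "of_nat (card (U :: 'f mat set)) \<noteq> (0::'k)" using card_field by simp
    show "bchar \<theta> u \<noteq> 0" for u :: "'f mat" unfolding bchar_def by (rule \<theta>_nonzero)
    show "bchar \<theta> (u \<otimes>\<^bsub>GL n\<^esub> v) = bchar \<theta> u * bchar \<theta> v" if uv: "u \<in> U" "v \<in> U" for u v :: "'f mat"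
    proof -
      \<comment> \<open>No column lies strictly between those of \<open>lft k\<close> and
        \<open>k\<close>, so only the diagonal entries of one factor contribute to the
        product.\<close>
      have "(u * v) $$ (lft k, k) = u $$ (lft k, k) + v $$ (lft k, k)" if k: "k \<in> ?K" for k
      proof -
        have l: "lft k < n" "cl (lft k) = cl k - 1" "lft k \<noteq> k" using lft[of k] k by auto
        have "(u * v) $$ (lft k, k) = (\<Sum>m<n. u $$ (lft k, m) * v $$ (m, k))"
          using k l U_mat[OF uv(1)] U_mat[OF uv(2)] by (simp add: scalar_prod_def lessThan_atLeast0)
        also have "\<dots> =
            (\<Sum>m<n. (if m = k then u $$ (lft k, k) else 0) + (if m = lft k then v $$ (lft k, k) else 0))"
        proof (rule sum.cong[OF refl])
          fix m assume "m \<in> {..<n}"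
          then show "u $$ (lft k, m) * v $$ (m, k) =
              (if m = k then u $$ (lft k, k) else 0) + (if m = lft k then v $$ (lft k, k) else 0)"
            using U_entry[OF uv(1), of "lft k" m] U_entry[OF uv(2), of m k] k l
            by (cases "cl (lft k) < cl m") auto
        qed
        also have "\<dots> = u $$ (lft k, k) + v $$ (lft k, k)" using k l by (simp add: sum.distrib)
        finally show ?thesis .
      qed
      then have "bchar \<theta> (u * v) = \<theta> (\<Sum>k\<in>?K. u $$ (lft k, k) + v $$ (lft k, k))"
        unfolding bchar_def by (intro arg_cong[of _ _ \<theta>] sum.cong) auto
      then show ?thesis by (simp add: bchar_def sum.distrib \<theta>_add)
    qed
    show "subgroup (P :: 'f mat set) (GL n)" unfolding P_def by (rule subgroup_block_parabolic)
    show "U \<inter> P = {\<one>\<^bsub>GL n\<^esub> :: 'f mat}" using U_P by simp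
    show "(torus :: 'f mat) \<in> P" by (rule torus_P)
    show "(torus :: 'f mat) \<otimes>\<^bsub>GL n\<^esub> torus = \<one>\<^bsub>GL n\<^esub>" using torus_torus by simp
    show "torus \<otimes>\<^bsub>GL n\<^esub> u \<otimes>\<^bsub>GL n\<^esub> torus \<in> U" if "u \<in> U" for u :: "'f mat" using torus_U[OF that] by simp
    show "bchar \<theta> (torus \<otimes>\<^bsub>GL n\<^esub> u \<otimes>\<^bsub>GL n\<^esub> torus) * bchar \<theta> u = 1" if u: "u \<in> U" for u :: "'f mat"
    proof -
      have "(torus * u * torus) $$ (lft k, k) = - u $$ (lft k, k)" if k: "k \<in> ?K" for k
      proof -
        have "cl k = Suc (cl (lft k))" "lft k < n" using lft[of k] k by auto
        then show ?thesis
          using torus_conj_entry[OF U_mat[OF u], of "lft k" k] k minus1_power_square[of "cl (lft k)"]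
          by (simp add: mult_ac)
      qed
      then have "bchar \<theta> (torus * u * torus) = \<theta> (- (\<Sum>k\<in>?K. u $$ (lft k, k)))"
        unfolding bchar_def sum_negf[symmetric] by (intro arg_cong[of _ _ \<theta>] sum.cong) auto
      then show ?thesis by (simp add: bchar_def \<theta>_minus)
    qed
    show "\<exists>u\<in>U. \<exists>p\<in>P. h = u \<otimes>\<^bsub>GL n\<^esub> p" if "h \<in> carrier (GL n)"
      "\<And>u. u \<in> U \<Longrightarrow> inv\<^bsub>GL n\<^esub> h \<otimes>\<^bsub>GL n\<^esub> u \<otimes>\<^bsub>GL n\<^esub> h \<in> P \<Longrightarrow> bchar \<theta> u = 1" for h :: "'f mat"
      using trivial_imp_cell[OF \<theta>_nontrivial that(1)] that(2) by simp
  qed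
qed

text \<open>Joins the support argument with the flag bound: an eigenfunction on flags with blocks
  \<open>\<kappa>\<close> limits the sizes of these blocks.\<close>

lemma eigenvector_levels:
  fixes \<theta> :: "'f::{field,finite} \<Rightarrow> 'k::field"
  assumes "add_char \<theta>" "f \<in> coset_functions (GL n) (block_parabolic n \<kappa> :: 'f mat set)" "f \<noteq> 0"
    and "\<And>u. u \<in> U \<Longrightarrow> ltrans (GL n) u f = fscale (bchar \<theta> u) f" "finite S"
  shows "card {i. i < n \<and> \<kappa> i \<in> S} \<le> card {i. i < n \<and> cl i < card S}"
proof -
  interpret add_char \<theta> by fact
  have lin: "lin_char (GL n :: 'f mat monoid) U (bchar \<theta>)"
    using char_cell_U[OF assms(1)] by (rule char_cell.axioms(1))
  have "\<exists>h\<in>carrier (GL n). \<forall>u\<in>U. inv\<^bsub>GL n\<^esub> h \<otimes>\<^bsub>GL n\<^esub> u \<otimes>\<^bsub>GL n\<^esub> h \<in> block_parabolic n \<kappa>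
      \<longrightarrow> bchar \<theta> u = 1"
    using lin subgroup_block_parabolic assms(2,3,4) by (rule lin_char.eigenvector_coset_functions)
  then obtain h where h: "h \<in> carrier (GL n)"
    "\<forall>u\<in>U. inv\<^bsub>GL n\<^esub> h \<otimes>\<^bsub>GL n\<^esub> u \<otimes>\<^bsub>GL n\<^esub> h \<in> block_parabolic n \<kappa> \<longrightarrow> bchar \<theta> u = 1"
    by (rule bexE)
  show ?thesis
  proof (rule card_levels_le[OF \<theta>_nontrivial h(1) _ assms(5)])
    fix u assume "u \<in> U" "inv\<^bsub>GL n\<^esub> h * u * h \<in> block_parabolic n \<kappa>"
    then show "bchar \<theta> u = 1" using h(2) by simp
  qed
qed

end

section \<open>Tableaux as matrices\<close>

lemma flag_iff:
  fixes g :: "'f::field mat"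
  assumes "g \<in> carrier (GL n)" "v \<in> carrier_vec n"
  shows "v \<in> flag n g D \<longleftrightarrow> (\<forall>i<n. \<not> D i \<longrightarrow> (inv\<^bsub>GL n\<^esub> g *\<^sub>v v) $ i = 0)"
proof
  assume "v \<in> flag n g D"
  then show "\<forall>i<n. \<not> D i \<longrightarrow> (inv\<^bsub>GL n\<^esub> g *\<^sub>v v) $ i = 0" using flag_inv(2)[OF assms(1)] by blast
next
  assume a: "\<forall>i<n. \<not> D i \<longrightarrow> (inv\<^bsub>GL n\<^esub> g *\<^sub>v v) $ i = 0"
  have g: "g \<in> carrier_mat n n" using assms(1) by (rule carrier_GL_mat)
  have "v = g *\<^sub>v (inv\<^bsub>GL n\<^esub> g *\<^sub>v v)"
    using inv_GL[OF assms(1)] g assms(2) by (simp flip: assoc_mult_mat_vec)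
  then show "v \<in> flag n g D"
    unfolding flag_def using a inv_GL(1)[OF assms(1)] assms(2) by auto
qed

lemma GL_cols_inj:
  fixes g :: "'f::field mat"
  assumes "g \<in> carrier (GL n)" shows "inj_on (col g) {..<n}"
proof (rule inj_onI)
  fix i j assume ij: "i \<in> {..<n}" "j \<in> {..<n}" "col g i = col g j"
  have g: "g \<in> carrier_mat n n" using assms by (rule carrier_GL_mat)
  have u: "inv\<^bsub>GL n\<^esub> g *\<^sub>v col g k = unit_vec n k" if "k < n" for k
    using col_mult2[OF inv_GL(1)[OF assms] g that] inv_GL(2)[OF assms] that by simp
  have "unit_vec n i = inv\<^bsub>GL n\<^esub> g *\<^sub>v col g i" using u[of i] ij(1) by simp
  also have "\<dots> = unit_vec n j" unfolding ij(3) using u[of j] ij(2) by simp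
  finally have "unit_vec n i = (unit_vec n j :: 'f vec)" .
  then have "unit_vec n i $ i = (unit_vec n j $ i :: 'f)" by simp
  then show "i = j" using ij(1) by (auto simp: unit_vec_def split: if_splits)
qed

lemma lincomb_cols:
  fixes g :: "'f::field mat"
  assumes "g \<in> carrier (GL n)" "J \<subseteq> {..<n}"
  shows "LinearCombinations.module.lincomb (module_vec TYPE('f) n) a (col g ` J)
    = g *\<^sub>v vec n (\<lambda>j. if j \<in> J then a (col g j) else 0)"
proof -
  interpret V: vec_space "TYPE('f)" n .
  have g: "g \<in> carrier_mat n n" using assms(1) by (rule carrier_GL_mat)
  have sub: "col g ` J \<subseteq> carrier_vec n" using g by auto
  have inj: "inj_on (col g) J" using GL_cols_inj[OF assms(1)] assms(2) by (rule inj_on_subset)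
  have d: "dim_vec (V.lincomb a (col g ` J)) = n"
    using V.lincomb_closed[OF sub, of a] by auto
  show ?thesis
  proof (rule eq_vecI)
    fix i assume "i < dim_vec (g *\<^sub>v vec n (\<lambda>j. if j \<in> J then a (col g j) else 0))"
    then have i: "i < n" using g by simp
    have "V.lincomb a (col g ` J) $ i = (\<Sum>j\<in>J. a (col g j) * col g j $ i)"
      unfolding V.lincomb_index[OF i sub] using sum.reindex[OF inj] by simp
    also have "\<dots> = (\<Sum>j<n. g $$ (i, j) * (if j \<in> J then a (col g j) else 0))"
      using assms(2) g i by (intro sum.mono_neutral_cong_left) (auto simp: mult.commute)
    also have "\<dots> = (g *\<^sub>v vec n (\<lambda>j. if j \<in> J then a (col g j) else 0)) $ i"
      using g i by (auto simp: scalar_prod_def lessThan_atLeast0 intro!: sum.cong)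
    finally show "V.lincomb a (col g ` J) $ i =
      (g *\<^sub>v vec n (\<lambda>j. if j \<in> J then a (col g j) else 0)) $ i" .
  qed (use d g in auto)
qed

lemma vec_span_cols:
  fixes g :: "'f::field mat"
  assumes "g \<in> carrier (GL n)"
  shows "vec_span n (col g ` {j. j < n \<and> D j}) = flag n g D"
proof -
  interpret V: vec_space "TYPE('f)" n .
  let ?J = "{j. j < n \<and> D j}"
  have g: "g \<in> carrier_mat n n" using assms by (rule carrier_GL_mat)
  have sub: "col g ` ?J \<subseteq> carrier_vec n" using g by auto
  have "vec_span n (col g ` ?J) = range (\<lambda>a. V.lincomb a (col g ` ?J))"
    unfolding vec_span_def using V.finite_span[OF _ sub] by auto
  also have "\<dots> = range (\<lambda>a. g *\<^sub>v vec n (\<lambda>j. if j \<in> ?J then a (col g j) else 0))"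
    by (rule image_cong[OF refl], rule lincomb_cols[OF assms]) auto
  also have "\<dots> = flag n g D"
  proof
    show "range (\<lambda>a. g *\<^sub>v vec n (\<lambda>j. if j \<in> ?J then a (col g j) else 0)) \<subseteq> flag n g D"
      unfolding flag_def by auto
    show "flag n g D \<subseteq> range (\<lambda>a. g *\<^sub>v vec n (\<lambda>j. if j \<in> ?J then a (col g j) else 0))"
    proof
      fix v assume "v \<in> flag n g D"
      then obtain y where y: "v = g *\<^sub>v y" "y \<in> carrier_vec n" "\<forall>j<n. \<not> D j \<longrightarrow> y $ j = 0"
        unfolding flag_def by auto
      let ?a = "\<lambda>x. y $ the_inv_into {..<n} (col g) x"
      have "?a (col g j) = y $ j" if "j < n" for j
        using the_inv_into_f_f[OF GL_cols_inj[OF assms], of j] that by simp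
      then have "vec n (\<lambda>j. if j \<in> ?J then ?a (col g j) else 0) = y" using y by (intro eq_vecI) auto
      then show "v \<in> range (\<lambda>a. g *\<^sub>v vec n (\<lambda>j. if j \<in> ?J then a (col g j) else 0))"
        using y(1) by (auto intro!: image_eqI[of _ _ ?a])
    qed
  qed
  finally show ?thesis .
qed

section \<open>Tableaux of a fixed shape as a regular orbit\<close>

locale young_tableau = young_boxes +
  assumes partition: "is_partition n lam"
begin

text \<open>A bijection from the invertible matrices onto the tableaux of shape \<open>lam\<close>,
  see \<open>tab_inj\<close> and \<open>tableaux_eq\<close>. It turns the action into left
  multiplication, and functions on tableaux into functions on the group.\<close>

definition tab :: "'f::field mat \<Rightarrow> 'f tableau" where
  "tab g = map (\<lambda>r. map (\<lambda>c. col g (idx r c)) [0..<lam ! r]) [0..<length lam]"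

lemma part_less_iff: "c < part lam r \<longleftrightarrow> r < length lam \<and> c < lam ! r"
  by (auto simp: part_def)

lemma boxes_tab: "boxes (tab g) = {(r, c). c < part lam r}"
  by (auto simp: boxes_def tab_def part_less_iff)

lemma boxes_tab_image: "boxes (tab g) = (\<lambda>i. (rw i, cl i)) ` {..<n}"
  unfolding boxes_tab using boxes_bij by (simp add: bij_betw_def)

lemma entry_tab: "i < n \<Longrightarrow> entry (tab g) (rw i, cl i) = col g i"
  using box_in[of i] idx_box[of i] by (simp add: tab_def part_less_iff)

lemma nth_tab: "i < n \<Longrightarrow> tab g ! rw i ! cl i = col g i"
  using entry_tab[of i g] by simp

lemma set_tab: "set (concat (tab g)) = col g ` {..<n}"
proof -
  have "set (concat (tab g)) = {col g (idx r c) | r c. c < part lam r}"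
    by (auto simp: tab_def part_less_iff) (intro exI conjI, rule refl, assumption+)
  also have "\<dots> = col g ` {..<n}"
  proof (intro equalityI subsetI)
    fix x assume "x \<in> col g ` {..<n}"
    then obtain i where "i < n" "x = col g i" by auto
    then show "x \<in> {col g (idx r c) | r c. c < part lam r}"
      using box_in[of i] idx_box[of i] by (intro CollectI exI[of _ "rw i"] exI[of _ "cl i"]) simp
  qed (auto simp: idx(1))
  finally show ?thesis .
qed

lemma length_concat_lam: "map length T = lam \<Longrightarrow> length (concat T) = n"
  using partition by (simp add: length_concat is_partition_def)

lemma tab_mem:
  fixes g :: "'f::field mat"
  assumes "g \<in> carrier (GL n)" shows "tab g \<in> tableaux n lam"
proof -
  interpret V: vec_space "TYPE('f)" n .
  have g: "g \<in> carrier_mat n n" using assms by (rule carrier_GL_mat)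
  have len: "map length (tab g) = lam" by (auto simp: tab_def intro: nth_equalityI)
  have sub: "set (concat (tab g)) \<subseteq> carrier_vec n" unfolding set_tab using g by auto
  have "card (set (concat (tab g))) = length (concat (tab g))"
    unfolding length_concat_lam[OF len] set_tab using card_image[OF GL_cols_inj[OF assms]] by simp
  then have dist: "distinct (concat (tab g))" by (rule card_distinct)
  have "V.lin_indpt (set (concat (tab g)))"
  proof (rule V.finite_lin_indpt2)
    fix a assume "V.lincomb a (set (concat (tab g))) = 0\<^sub>v n"
    then have z: "g *\<^sub>v vec n (\<lambda>j. if j \<in> {..<n} then a (col g j) else 0) = 0\<^sub>v n"
      unfolding set_tab using lincomb_cols[OF assms, of "{..<n}" a] by simp
    define y where "y = vec n (\<lambda>j. if j \<in> {..<n} then a (col g j) else 0)"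
    have "y = inv\<^bsub>GL n\<^esub> g *\<^sub>v (g *\<^sub>v y)"
      using inv_GL[OF assms] g by (simp add: y_def flip: assoc_mult_mat_vec)
    also have "\<dots> = inv\<^bsub>GL n\<^esub> g *\<^sub>v 0\<^sub>v n" using z unfolding y_def by simp
    also have "\<dots> = 0\<^sub>v n" using inv_GL(1)[OF assms] by (intro eq_vecI) auto
    finally have y0: "y = 0\<^sub>v n" .
    have "a (col g j) = 0" if "j < n" for j
    proof -
      have "y $ j = a (col g j)" using that by (simp add: y_def)
      then show ?thesis using y0 that by simp
    qed
    then show "\<forall>v\<in>set (concat (tab g)). a v = 0" unfolding set_tab by auto
  qed (use sub in auto)
  then show ?thesis unfolding tableaux_def using len sub dist by simp
qed

lemma tableaux_tab:
  fixes T :: "'f::field tableau"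
  assumes "T \<in> tableaux n lam" shows "\<exists>g\<in>carrier (GL n). T = tab g"
proof -
  interpret V: vec_space "TYPE('f)" n .
  have len: "map length T = lam" and sub: "set (concat T) \<subseteq> carrier_vec n"
    and dist: "distinct (concat T)" and indpt: "V.lin_indpt (set (concat T))"
    using assms unfolding tableaux_def by auto
  have lenT: "length T = length lam" using len by (metis length_map)
  have lenr: "length (T ! r) = lam ! r" if "r < length lam" for r
    using len lenT that by (metis nth_map)
  have mem: "entry T (rw i, cl i) \<in> set (concat T)" if "i < n" for i
  proof -
    have "rw i < length T" "cl i < length (T ! rw i)"
      using box_in[OF that] lenT lenr[of "rw i"] unfolding part_less_iff by auto
    then have "T ! rw i \<in> set T" "T ! rw i ! cl i \<in> set (T ! rw i)" by simp_all
    then show ?thesis by auto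
  qed
  define g where "g = mat n n (\<lambda>(k, i). entry T (rw i, cl i) $ k)"
  have g: "g \<in> carrier_mat n n" unfolding g_def by simp
  have col: "col g i = entry T (rw i, cl i)" if "i < n" for i
    using that mem[OF that] sub unfolding g_def by (intro eq_vecI) auto
  have T: "T = tab g"
  proof (rule nth_equalityI)
    show "length T = length (tab g)" by (simp add: tab_def lenT)
    fix r assume r: "r < length T"
    show "T ! r = tab g ! r"
    proof (rule nth_equalityI)
      show "length (T ! r) = length (tab g ! r)" using r lenr lenT by (simp add: tab_def)
      fix c assume c: "c < length (T ! r)"
      then have rc: "c < part lam r" using r lenr lenT by (simp add: part_less_iff)
      show "T ! r ! c = tab g ! r ! c"
        using col[OF idx(1)[OF rc]] idx[OF rc] rc by (simp add: tab_def part_less_iff)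
    qed
  qed
  have setT: "set (concat T) = col g ` {..<n}" unfolding T by (rule set_tab)
  have "card (col g ` {..<n}) = card {..<n}"
    using distinct_card[OF dist] length_concat_lam[OF len] unfolding setT by simp
  then have inj: "inj_on (col g) {..<n}" by (intro eq_card_imp_inj_on) auto
  have "det g \<noteq> 0"
  proof
    assume "det g = 0"
    then obtain v where v: "v \<in> carrier_vec n" "v \<noteq> 0\<^sub>v n" "g *\<^sub>v v = 0\<^sub>v n"
      using det_0_iff_vec_prod_zero_field[OF g] by auto
    let ?a = "\<lambda>x. v $ the_inv_into {..<n} (col g) x"
    have a: "?a (col g j) = v $ j" if "j < n" for j
      using the_inv_into_f_f[OF inj, of j] that by simp
    obtain j where j: "j < n" "v $ j \<noteq> 0"
    proof (rule ccontr)
      assume "\<not> thesis"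
      then have "v = 0\<^sub>v n" using v(1) that by (intro eq_vecI) auto
      then show False using v(2) by simp
    qed
    have "V.lincomb ?a (set (concat T)) = 0\<^sub>v n"
    proof (rule eq_vecI)
      fix i assume "i < dim_vec (0\<^sub>v n :: 'f vec)"
      then have i: "i < n" by simp
      have "V.lincomb ?a (set (concat T)) $ i = (\<Sum>j<n. ?a (col g j) * col g j $ i)"
        by (subst V.lincomb_index[OF i sub]) (simp only: setT sum.reindex[OF inj] comp_def)
      also have "\<dots> = (\<Sum>j<n. g $$ (i, j) * v $ j)"
        using a g i by (intro sum.cong) auto
      also have "\<dots> = (g *\<^sub>v v) $ i"
        using g v(1) i by (auto simp: scalar_prod_def lessThan_atLeast0 intro!: sum.cong)
      finally show "V.lincomb ?a (set (concat T)) $ i = 0\<^sub>v n $ i" using v(3) by simp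
    qed (use V.lincomb_closed[OF sub, of ?a] in auto)
    then have "V.lin_dep (set (concat T))"
      unfolding setT using a[OF j(1)] j
      by (intro V.lin_dep_crit[of "col g ` {..<n}" _ "col g j" ?a]) auto
    then show False using indpt by simp
  qed
  then show ?thesis using T g by (auto simp: carrier_GL_det)
qed

lemma tableaux_eq: "tableaux n lam = tab ` (carrier (GL n) :: 'f::field mat set)"
  using tab_mem tableaux_tab by auto

lemma tab_inj: "inj_on tab (carrier (GL n :: 'f::field mat monoid))"
proof (rule inj_onI)
  fix g h :: "'f mat" assume gh: "g \<in> carrier (GL n)" "h \<in> carrier (GL n)" "tab g = tab h"
  have "g \<in> carrier_mat n n" "h \<in> carrier_mat n n" using gh by (auto intro: carrier_GL_mat)
  moreover have "col g i = col h i" if "i < n" for i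
    using gh(3) entry_tab[OF that, of g] entry_tab[OF that, of h] by simp
  ultimately show "g = h" by (intro mat_col_eqI) auto
qed

lemma tab_act_tab:
  assumes "(h :: 'f::field mat) \<in> carrier (GL n)" "g \<in> carrier (GL n)"
  shows "tab_act h (tab g) = tab (h * g)"
  using idx(1) carrier_GL_mat[OF assms(1)] carrier_GL_mat[OF assms(2)]
  by (auto simp: tab_act_def tab_def part_less_iff intro!: nth_equalityI)

lemma GL_mult: "g \<in> carrier (GL n) \<Longrightarrow> h \<in> carrier (GL n) \<Longrightarrow> g * h \<in> carrier (GL n :: 'f::field mat monoid)"
  using monoid.m_closed[OF group.is_monoid[OF group_GL], of g n h] by simp

lemma GL_inv: "g \<in> carrier (GL n) \<Longrightarrow> inv\<^bsub>GL n\<^esub> g \<in> carrier (GL n :: 'f::field mat monoid)"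
  by (rule group.inv_closed[OF group_GL])

lemma inv_mult_col:
  assumes g: "(g :: 'f::field mat) \<in> carrier (GL n)" and h: "h \<in> carrier_mat n n" and j: "j < n"
  shows "inv\<^bsub>GL n\<^esub> g *\<^sub>v (h *\<^sub>v col g j) = col (inv\<^bsub>GL n\<^esub> g * h * g) j"
proof -
  have g': "g \<in> carrier_mat n n" using g by (rule carrier_GL_mat)
  note gi = inv_GL(1)[OF g]
  have "col (inv\<^bsub>GL n\<^esub> g * h * g) j = (inv\<^bsub>GL n\<^esub> g * h) *\<^sub>v col g j"
    using gi h g' j by (intro col_mult2[of _ n n _ n]) auto
  also have "\<dots> = inv\<^bsub>GL n\<^esub> g *\<^sub>v (h *\<^sub>v col g j)"
    using gi h g' by (intro assoc_mult_mat_vec[of _ n n _ n]) auto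
  finally show ?thesis by simp
qed

lemma span_tab:
  fixes g :: "'f::field mat"
  assumes "g \<in> carrier (GL n)"
  shows "vec_span n {entry (tab g) b' | b'. b' \<in> boxes (tab g) \<and> R (snd b')} = flag n g (\<lambda>j. R (cl j))"
proof -
  have "{entry (tab g) b' | b'. b' \<in> boxes (tab g) \<and> R (snd b')} = col g ` {j. j < n \<and> R (cl j)}"
    unfolding boxes_tab_image
  proof (intro equalityI subsetI)
    fix x assume "x \<in> col g ` {j. j < n \<and> R (cl j)}"
    then obtain j where "j < n" "R (cl j)" "x = col g j" by auto
    then show "x \<in> {entry (tab g) b' | b'. b' \<in> (\<lambda>i. (rw i, cl i)) ` {..<n} \<and> R (snd b')}"
      using entry_tab[of j g] by (intro CollectI exI[of _ "(rw j, cl j)"]) auto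
  qed (auto simp: nth_tab)
  then show ?thesis using vec_span_cols[OF assms, of "\<lambda>j. R (cl j)"] by simp
qed

text \<open>Conjugation by \<open>g\<close> expresses \<open>h\<close> in the basis formed by the
  entries of \<open>tab g\<close>, which reduces every tableau to the tableau of the identity
  matrix.\<close>

lemma U_grp_tab:
  assumes g: "(g :: 'f::field mat) \<in> carrier (GL n)"
  shows "h \<in> U_grp n (tab g) \<longleftrightarrow> h \<in> carrier (GL n) \<and> inv\<^bsub>GL n\<^esub> g * h * g \<in> U"
proof (cases "h \<in> carrier (GL n)")
  case h: True
  let ?c = "inv\<^bsub>GL n\<^esub> g * h * g"
  have hm: "h \<in> carrier_mat n n" and gm: "g \<in> carrier_mat n n"
    using h g by (auto intro: carrier_GL_mat)
  have cm: "?c \<in> carrier_mat n n" using inv_GL(1)[OF g] hm gm by auto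
  have cG: "?c \<in> carrier (GL n)" using g h by (intro GL_mult GL_inv)
  have col: "(inv\<^bsub>GL n\<^esub> g *\<^sub>v (h *\<^sub>v col g j - col g j)) $ i = ?c $$ (i, j) - (if i = j then 1 else 0)"
    if ij: "i < n" "j < n" for i j
  proof -
    have "inv\<^bsub>GL n\<^esub> g *\<^sub>v (h *\<^sub>v col g j - col g j)
        = inv\<^bsub>GL n\<^esub> g *\<^sub>v (h *\<^sub>v col g j) - inv\<^bsub>GL n\<^esub> g *\<^sub>v col g j"
      using inv_GL(1)[OF g] hm gm by (intro mult_minus_distrib_mat_vec[of _ n n]) auto
    also have "inv\<^bsub>GL n\<^esub> g *\<^sub>v col g j = unit_vec n j"
      using col_mult2[OF inv_GL(1)[OF g] gm ij(2)] inv_GL(2)[OF g] ij by simp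
    finally show ?thesis
      using ij carrier_matD[OF inv_GL(1)[OF g]] carrier_matD[OF gm]
      unfolding inv_mult_col[OF g hm ij(2)] by (simp add: unit_vec_def)
  qed
  have "h \<in> U_grp n (tab g) \<longleftrightarrow> (\<forall>j<n. h *\<^sub>v col g j - col g j \<in> flag n g (\<lambda>i. cl i < cl j))"
    unfolding U_grp_def using h span_tab[OF g, of "\<lambda>c. c < _"] unfolding boxes_tab_image
    by (auto simp: nth_tab)
  also have "\<dots> \<longleftrightarrow> (\<forall>j<n. \<forall>i<n. \<not> cl i < cl j \<longrightarrow> ?c $$ (i, j) = (if i = j then 1 else 0))"
    using flag_iff[OF g, of "h *\<^sub>v col g _ - col g _"] hm gm col by auto
  also have "\<dots> \<longleftrightarrow> ?c \<in> U" unfolding U_def using cG by auto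
  finally show ?thesis using h by simp
qed (simp add: U_grp_def)

lemma P_grp_tab:
  assumes g: "(g :: 'f::field mat) \<in> carrier (GL n)"
  shows "h \<in> P_grp n (tab g) \<longleftrightarrow> h \<in> carrier (GL n) \<and> inv\<^bsub>GL n\<^esub> g * h * g \<in> P"
proof (cases "h \<in> carrier (GL n)")
  case h: True
  let ?c = "inv\<^bsub>GL n\<^esub> g * h * g"
  have hm: "h \<in> carrier_mat n n" and gm: "g \<in> carrier_mat n n"
    using h g by (auto intro: carrier_GL_mat)
  have cm: "?c \<in> carrier_mat n n" using inv_GL(1)[OF g] hm gm by auto
  have cG: "?c \<in> carrier (GL n)" using g h by (intro GL_mult GL_inv)
  have "h \<in> P_grp n (tab g) \<longleftrightarrow> (\<forall>j<n. h *\<^sub>v col g j \<in> flag n g (\<lambda>i. cl j \<le> cl i))"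
    unfolding P_grp_def using h span_tab[OF g, of "\<lambda>c. _ \<le> c"] unfolding boxes_tab_image
    by (auto simp: nth_tab)
  also have "\<dots> \<longleftrightarrow> (\<forall>j<n. \<forall>i<n. \<not> cl j \<le> cl i \<longrightarrow> ?c $$ (i, j) = 0)"
    using flag_iff[OF g, of "h *\<^sub>v col g _"] hm gm cm inv_mult_col[OF g hm] by auto
  also have "\<dots> \<longleftrightarrow> ?c \<in> P"
  proof -
    have "ncols - cl j < ncols - cl i \<longleftrightarrow> \<not> cl j \<le> cl i" if "i < n" "j < n" for i j
      using cl_le[OF that(1)] cl_le[OF that(2)] by linarith
    then show ?thesis unfolding P_def block_parabolic_def using cG by auto
  qed
  finally show ?thesis using h by simp
qed (simp add: P_grp_def)

lemma tab_coeff_tab: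
  assumes g: "(g :: 'f::field mat) \<in> carrier (GL n)" and w: "w \<in> carrier_vec n" and i: "i < n"
  shows "tab_coeff n (tab g) (rw i, cl i) w = (inv\<^bsub>GL n\<^esub> g *\<^sub>v w) $ i"
proof -
  have gm: "g \<in> carrier_mat n n" using g by (rule carrier_GL_mat)
  let ?y = "inv\<^bsub>GL n\<^esub> g *\<^sub>v w"
  have lin: "LinearCombinations.module.lincomb (module_vec TYPE('f) n) a (set (concat (tab g)))
      = g *\<^sub>v vec n (\<lambda>j. a (col g j))" for a
  proof -
    have "vec n (\<lambda>j. if j \<in> {..<n} then a (col g j) else 0) = vec n (\<lambda>j. a (col g j))"
      by (intro eq_vecI) auto
    then show ?thesis unfolding set_tab using lincomb_cols[OF g, of "{..<n}" a] by simp
  qed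
  show ?thesis
    unfolding tab_coeff_def entry_tab[OF i] lin
  proof (rule the_equality)
    let ?a = "\<lambda>x. ?y $ the_inv_into {..<n} (col g) x"
    have a: "?a (col g j) = ?y $ j" if "j < n" for j
      using the_inv_into_f_f[OF GL_cols_inj[OF g], of j] that by simp
    then have "vec n (\<lambda>j. ?a (col g j)) = ?y" using inv_GL(1)[OF g] by (intro eq_vecI) auto
    moreover have "w = g *\<^sub>v ?y" using inv_GL[OF g] gm w by (simp flip: assoc_mult_mat_vec)
    ultimately show "\<exists>a. w = g *\<^sub>v vec n (\<lambda>j. a (col g j)) \<and> ?y $ i = a (col g i)"
      using a[OF i] by (intro exI[of _ ?a]) simp
  next
    fix c assume "\<exists>a. w = g *\<^sub>v vec n (\<lambda>j. a (col g j)) \<and> c = a (col g i)"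
    then obtain a where a: "w = g *\<^sub>v vec n (\<lambda>j. a (col g j))" "c = a (col g i)" by auto
    have "?y = vec n (\<lambda>j. a (col g j))" unfolding a(1)
      using inv_GL[OF g] gm by (simp flip: assoc_mult_mat_vec)
    then show "c = ?y $ i" using a(2) i by simp
  qed
qed

lemma psi_tab:
  assumes g: "(g :: 'f::field mat) \<in> carrier (GL n)" and h: "h \<in> carrier (GL n)"
  shows "psi n \<theta> (tab g) h = bchar \<theta> (inv\<^bsub>GL n\<^esub> g * h * g)"
proof -
  have hm: "h \<in> carrier_mat n n" and gm: "g \<in> carrier_mat n n"
    using h g by (auto intro: carrier_GL_mat)
  have cm: "inv\<^bsub>GL n\<^esub> g * h * g \<in> carrier_mat n n" using inv_GL(1)[OF g] hm gm by auto
  have "(\<Sum>(r, c) \<in> {(r, c). (r, c) \<in> boxes (tab g) \<and> (r, Suc c) \<in> boxes (tab g)}.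
      tab_coeff n (tab g) (r, c) (h *\<^sub>v entry (tab g) (r, Suc c)))
    = (\<Sum>k | k < n \<and> 0 < cl k. (inv\<^bsub>GL n\<^esub> g * h * g) $$ (lft k, k))"
  proof (rule sum.reindex_bij_witness[of _ "\<lambda>k. (rw k, cl k - 1)" "\<lambda>(r, c). idx r (Suc c)"])
    fix b assume "b \<in> {(r, c). (r, c) \<in> boxes (tab g) \<and> (r, Suc c) \<in> boxes (tab g)}"
    then obtain r c where b: "b = (r, c)" "c < part lam r" "Suc c < part lam r"
      by (auto simp: boxes_tab)
    let ?k = "idx r (Suc c)"
    have k: "?k < n" "rw ?k = r" "cl ?k = Suc c" using idx[OF b(3)] by auto
    show "(rw (case b of (r, c) \<Rightarrow> idx r (Suc c)), cl (case b of (r, c) \<Rightarrow> idx r (Suc c)) - 1) = b"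
      "(case b of (r, c) \<Rightarrow> idx r (Suc c)) \<in> {k. k < n \<and> 0 < cl k}" using b k by auto
    have l: "lft ?k < n" "rw (lft ?k) = r" "cl (lft ?k) = c" using lft[OF k(1)] k by auto
    have "tab_coeff n (tab g) (r, c) (h *\<^sub>v entry (tab g) (r, Suc c))
        = tab_coeff n (tab g) (rw (lft ?k), cl (lft ?k)) (h *\<^sub>v entry (tab g) (rw ?k, cl ?k))"
      unfolding k l ..
    also have "\<dots> = (inv\<^bsub>GL n\<^esub> g *\<^sub>v (h *\<^sub>v col g ?k)) $ lft ?k"
      unfolding entry_tab[OF k(1)] using hm gm by (intro tab_coeff_tab[OF g _ l(1)]) auto
    also have "\<dots> = (inv\<^bsub>GL n\<^esub> g * h * g) $$ (lft ?k, ?k)"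
      unfolding inv_mult_col[OF g hm k(1)]
      using k(1) l(1) carrier_matD[OF inv_GL(1)[OF g]] carrier_matD[OF gm] by (intro index_col) auto
    finally show "(inv\<^bsub>GL n\<^esub> g * h * g) $$
        (lft (case b of (r, c) \<Rightarrow> idx r (Suc c)), case b of (r, c) \<Rightarrow> idx r (Suc c))
        = (case b of (r, c) \<Rightarrow> tab_coeff n (tab g) (r, c) (h *\<^sub>v entry (tab g) (r, Suc c)))"
      using b by simp
  next
    fix k assume k: "k \<in> {k. k < n \<and> 0 < cl k}"
    then show "(case (rw k, cl k - 1) of (r, c) \<Rightarrow> idx r (Suc c)) = k" using idx_box[of k] by simp
    show "(rw k, cl k - 1) \<in> {(r, c). (r, c) \<in> boxes (tab g) \<and> (r, Suc c) \<in> boxes (tab g)}"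
      using k box_in[of k] by (auto simp: boxes_tab)
  qed
  then show ?thesis unfolding psi_def bchar_def by simp
qed

end

section \<open>The modules spanned by tableaux\<close>

text \<open>The last clause is the induction principle for spans: a property that defines a subspace
  and holds for the generators holds throughout.\<close>

lemma span_fun_gmod:
  assumes V: "fun_rep G act V" and A: "A \<subseteq> V"
  defines "sp \<equiv> LinearCombinations.module.span class_ring (fun_gmod act V) A"
  shows "A \<subseteq> sp" "sp \<subseteq> V" "0 \<in> sp" "\<And>x y. x \<in> sp \<Longrightarrow> y \<in> sp \<Longrightarrow> x + y \<in> sp"
    "\<And>c x. x \<in> sp \<Longrightarrow> fscale c x \<in> sp"
    "\<And>N. A \<subseteq> N \<Longrightarrow> N \<subseteq> V \<Longrightarrow> 0 \<in> N \<Longrightarrow> (\<And>x y. x \<in> N \<Longrightarrow> y \<in> N \<Longrightarrow> x + y \<in> N) \<Longrightarrow>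
      (\<And>c x. x \<in> N \<Longrightarrow> fscale c x \<in> N) \<Longrightarrow> sp \<subseteq> N"
proof -
  interpret K: kg_module G "fun_gmod act V" by (rule fun_rep.kg_module[OF V])
  have A': "A \<subseteq> carrier (fun_gmod act V)" using A by simp
  show "A \<subseteq> sp" unfolding sp_def using K.V.in_own_span[OF A'] .
  have sub: "LinearCombinations.submodule class_ring sp (fun_gmod act V)"
    unfolding sp_def using K.V.span_is_submodule[OF A'] .
  show "sp \<subseteq> V" "0 \<in> sp" "\<And>x y. x \<in> sp \<Longrightarrow> y \<in> sp \<Longrightarrow> x + y \<in> sp"
    "\<And>c x. x \<in> sp \<Longrightarrow> fscale c x \<in> sp"
    using sub unfolding LinearCombinations.submodule_def by simp_all
  fix N assume N: "A \<subseteq> N" "N \<subseteq> V" "0 \<in> N" "\<And>x y. x \<in> N \<Longrightarrow> y \<in> N \<Longrightarrow> x + y \<in> N"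
    "\<And>c x. x \<in> N \<Longrightarrow> fscale c x \<in> N"
  have "LinearCombinations.submodule class_ring N (fun_gmod act V)"
    unfolding LinearCombinations.submodule_def using N(2-5) K.V.module_axioms by simp
  with N(1) show "sp \<subseteq> N" unfolding sp_def by (rule K.V.span_is_subset)
qed

section \<open>Functions on tableaux\<close>

definition tact :: "nat \<Rightarrow> nat list \<Rightarrow> 'f::field mat \<Rightarrow> ('f tableau \<Rightarrow> 'k) \<Rightarrow> 'f tableau \<Rightarrow> 'k::field" where
  "tact n lam g f = (\<lambda>T. if T \<in> tableaux n lam then f (tab_act (inv\<^bsub>GL n\<^esub> g) T) else 0)"

definition tfuns :: "nat \<Rightarrow> nat list \<Rightarrow> ('f::field tableau \<Rightarrow> 'k::field) set" where
  "tfuns n lam = {f. \<forall>T. T \<notin> tableaux n lam \<longrightarrow> f T = 0}"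

lemma tab_module_fun_gmod: "tab_module n lam = fun_gmod (tact n lam) (tfuns n lam)"
  unfolding tab_module_def perm_module_def fun_gmod_def tact_def tfuns_def fscale_def
  by (auto simp: fun_eq_iff)

locale tableau_char = young_tableau n lam rw cl + add_char \<theta>
  for n lam rw cl and \<theta> :: "'f::{field,finite} \<Rightarrow> 'k::field"
begin

sublocale C: char_cell "GL n :: 'f mat monoid" U "bchar \<theta>" P torus
  by (rule char_cell_U[OF add_char_axioms])

lemma one_GL: "1\<^sub>m n \<in> carrier (GL n :: 'f mat monoid)"
  using C.one_closed by simp

lemma tact_tab:
  assumes "(g :: 'f mat) \<in> carrier (GL n)" "h \<in> carrier (GL n)"
  shows "tact n lam g x (tab h) = x (tab (inv\<^bsub>GL n\<^esub> g * h))"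
  using tab_mem[OF assms(2)] tab_act_tab[OF GL_inv[OF assms(1)] assms(2)] by (simp add: tact_def)

lemma tfuns_eqI:
  fixes x y :: "'f tableau \<Rightarrow> 'a::field"
  assumes "x \<in> tfuns n lam" "y \<in> tfuns n lam"
    and "\<And>h. h \<in> carrier (GL n) \<Longrightarrow> x (tab h) = y (tab h)"
  shows "x = y"
proof
  fix T :: "'f tableau"
  show "x T = y T" using assms tableaux_tab[of T] unfolding tfuns_def by (cases "T \<in> tableaux n lam") auto
qed

lemma fun_rep_tfuns: "fun_rep (GL n :: 'f mat monoid) (tact n lam) (tfuns n lam :: ('f tableau \<Rightarrow> 'k) set)"
proof -
  have mem: "tact n lam g x \<in> tfuns n lam" for g :: "'f mat" and x :: "'f tableau \<Rightarrow> 'k"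
    by (simp add: tact_def tfuns_def)
  show ?thesis
  proof (intro fun_rep.intro fun_rep_axioms.intro)
    show "group (GL n :: 'f mat monoid)" by (rule group_GL)
    fix x :: "'f tableau \<Rightarrow> 'k" assume x: "x \<in> tfuns n lam"
    show "tact n lam \<one>\<^bsub>GL n\<^esub> x = x"
    proof (rule tfuns_eqI[OF mem x])
      fix h :: "'f mat" assume h: "h \<in> carrier (GL n)"
      have "inv\<^bsub>GL n\<^esub> (1\<^sub>m n) * h = h" using C.inv_one C.l_one[OF h] by simp
      then show "tact n lam \<one>\<^bsub>GL n\<^esub> x (tab h) = x (tab h)" using tact_tab[OF one_GL h, of x] by simp
    qed
    fix g h :: "'f mat" assume gh: "g \<in> carrier (GL n)" "h \<in> carrier (GL n)"
    show "tact n lam (g \<otimes>\<^bsub>GL n\<^esub> h) x = tact n lam g (tact n lam h x)"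
    proof (rule tfuns_eqI[OF mem mem])
      fix k :: "'f mat" assume k: "k \<in> carrier (GL n)"
      have "inv\<^bsub>GL n\<^esub> (g \<otimes>\<^bsub>GL n\<^esub> h) \<otimes>\<^bsub>GL n\<^esub> k = inv\<^bsub>GL n\<^esub> h \<otimes>\<^bsub>GL n\<^esub> (inv\<^bsub>GL n\<^esub> g \<otimes>\<^bsub>GL n\<^esub> k)"
        using gh k by (simp add: C.inv_mult_group C.m_assoc del: GL_simps)
      then have "inv\<^bsub>GL n\<^esub> (g * h) * k = inv\<^bsub>GL n\<^esub> h * (inv\<^bsub>GL n\<^esub> g * k)" by simp
      then show "tact n lam (g \<otimes>\<^bsub>GL n\<^esub> h) x (tab k) = tact n lam g (tact n lam h x) (tab k)"
        using gh k by (simp add: tact_tab GL_mult GL_inv)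
    qed
  qed (auto simp: mem tfuns_def tact_def fun_eq_iff)
qed

interpretation W: fun_rep "GL n :: 'f mat monoid" "tact n lam" "tfuns n lam :: ('f tableau \<Rightarrow> 'k) set"
  by (rule fun_rep_tfuns)

lemma P_grp_finite: "finite (P_grp n T :: 'f mat set)"
  by (rule finite_subset[OF _ finite_GL[of n]]) (auto simp: P_grp_def)

text \<open>So \<open>m_vec\<close> is the indicator function of the coset of \<open>g\<close>
  modulo \<open>P\<close>: \<open>P_grp\<close> is the conjugate of \<open>P\<close> by
  \<open>g\<close>, and applied to \<open>tab g\<close> it sweeps out this coset once.\<close>

lemma m_vec_tab:
  assumes "(g :: 'f mat) \<in> carrier (GL n)" "h \<in> carrier (GL n)"
  shows "m_vec n (tab g) (tab h) = (if inv\<^bsub>GL n\<^esub> g * h \<in> P then 1 else (0::'k))"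
proof -
  let ?p = "h * inv\<^bsub>GL n\<^esub> g"
  have pG: "?p \<in> carrier (GL n)" using assms by (intro GL_mult GL_inv)
  have "inv\<^bsub>GL n\<^esub> g \<otimes>\<^bsub>GL n\<^esub> (h \<otimes>\<^bsub>GL n\<^esub> inv\<^bsub>GL n\<^esub> g) \<otimes>\<^bsub>GL n\<^esub> g = inv\<^bsub>GL n\<^esub> g \<otimes>\<^bsub>GL n\<^esub> h"
    using assms by (simp add: C.m_assoc del: GL_simps)
  then have pP: "?p \<in> P_grp n (tab g) \<longleftrightarrow> inv\<^bsub>GL n\<^esub> g * h \<in> P"
    using pG unfolding P_grp_tab[OF assms(1)] by simp
  have "tab h = tab_act p (tab g) \<longleftrightarrow> p = ?p" if "p \<in> P_grp n (tab g)" for p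
  proof -
    have p: "p \<in> carrier (GL n)" using that by (simp add: P_grp_def)
    have "tab h = tab_act p (tab g) \<longleftrightarrow> h = p \<otimes>\<^bsub>GL n\<^esub> g"
      using inj_on_eq_iff[OF tab_inj assms(2) GL_mult[OF p assms(1)]] tab_act_tab[OF p assms(1)] by simp
    also have "\<dots> \<longleftrightarrow> p = h \<otimes>\<^bsub>GL n\<^esub> inv\<^bsub>GL n\<^esub> g"
      using C.inv_solve_right[of p h g] p assms by auto
    finally show ?thesis by simp
  qed
  then have "m_vec n (tab g) (tab h) = (\<Sum>p\<in>P_grp n (tab g). if p = ?p then 1 else (0::'k))"
    unfolding m_vec_def by (intro sum.cong) auto
  then show ?thesis using pP P_grp_finite by simp
qed

lemma m_vec_mem:
  assumes "T \<in> tableaux n lam" shows "(m_vec n T :: 'f tableau \<Rightarrow> 'k) \<in> tfuns n lam"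
proof -
  obtain g where g: "g \<in> carrier (GL n)" "T = tab g" using tableaux_tab[OF assms] by auto
  have "tab_act p T \<in> tableaux n lam" if "p \<in> P_grp n T" for p
    using that g tab_act_tab[of p g] tab_mem[OF GL_mult[of p g]] by (simp add: P_grp_def)
  then show ?thesis unfolding tfuns_def m_vec_def by (auto intro!: sum.neutral)
qed

lemma m_vec_eq_iff:
  assumes "(g :: 'f mat) \<in> carrier (GL n)" "h \<in> carrier (GL n)"
  shows "(m_vec n (tab h) :: _ \<Rightarrow> 'k) = m_vec n (tab g) \<longleftrightarrow> inv\<^bsub>GL n\<^esub> g * h \<in> P"
proof
  assume e: "(m_vec n (tab h) :: _ \<Rightarrow> 'k) = m_vec n (tab g)"
  have "inv\<^bsub>GL n\<^esub> h * h \<in> P" using inv_GL(2)[OF assms(2)] C.P_closed(1) by simp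
  then have "(m_vec n (tab g) (tab h) :: 'k) = 1" using m_vec_tab[OF assms(2,2)] e by simp
  then show "inv\<^bsub>GL n\<^esub> g * h \<in> P" unfolding m_vec_tab[OF assms] by (auto split: if_splits)
next
  assume gh: "inv\<^bsub>GL n\<^esub> g * h \<in> P"
  show "(m_vec n (tab h) :: _ \<Rightarrow> 'k) = m_vec n (tab g)"
  proof (rule tfuns_eqI[OF m_vec_mem[OF tab_mem[OF assms(2)]] m_vec_mem[OF tab_mem[OF assms(1)]]])
    fix k :: "'f mat" assume k: "k \<in> carrier (GL n)"
    let ?a = "inv\<^bsub>GL n\<^esub> g \<otimes>\<^bsub>GL n\<^esub> h" and ?b = "inv\<^bsub>GL n\<^esub> h \<otimes>\<^bsub>GL n\<^esub> k"
    have a: "?a \<in> P" using gh by simp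
    have cancel: "inv\<^bsub>GL n\<^esub> x \<otimes>\<^bsub>GL n\<^esub> (x \<otimes>\<^bsub>GL n\<^esub> y) = y" "x \<otimes>\<^bsub>GL n\<^esub> (inv\<^bsub>GL n\<^esub> x \<otimes>\<^bsub>GL n\<^esub> y) = y"
      if "x \<in> carrier (GL n)" "y \<in> carrier (GL n)" for x y :: "'f mat"
      using that by (simp_all del: GL_simps flip: C.m_assoc)
    have ab: "?a \<otimes>\<^bsub>GL n\<^esub> ?b = inv\<^bsub>GL n\<^esub> g \<otimes>\<^bsub>GL n\<^esub> k"
      using assms k by (simp add: C.m_assoc cancel del: GL_simps)
    have ba: "inv\<^bsub>GL n\<^esub> ?a \<otimes>\<^bsub>GL n\<^esub> (inv\<^bsub>GL n\<^esub> g \<otimes>\<^bsub>GL n\<^esub> k) = ?b"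
      unfolding ab[symmetric] using assms k by (intro cancel C.m_closed C.inv_closed)
    have "?b \<in> P \<longleftrightarrow> inv\<^bsub>GL n\<^esub> g \<otimes>\<^bsub>GL n\<^esub> k \<in> P"
      using C.P_closed(4)[OF a, of ?b] C.P_closed(4)[OF C.P_closed(3)[OF a], of "inv\<^bsub>GL n\<^esub> g \<otimes>\<^bsub>GL n\<^esub> k"]
      unfolding ab ba by blast
    then show "(m_vec n (tab h) (tab k) :: 'k) = m_vec n (tab g) (tab k)"
      unfolding m_vec_tab[OF assms(2) k] m_vec_tab[OF assms(1) k] by simp
  qed
qed

lemma sum_U_grp:
  assumes g: "(g :: 'f mat) \<in> carrier (GL n)"
  shows "(\<Sum>u\<in>U_grp n (tab g). F u) = (\<Sum>u\<in>U. F (g * u * inv\<^bsub>GL n\<^esub> g))"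
proof (rule sum.reindex_bij_witness[of _ "\<lambda>u. g * u * inv\<^bsub>GL n\<^esub> g" "\<lambda>u. inv\<^bsub>GL n\<^esub> g * u * g"])
  note gi = GL_inv[OF g]
  have 1: "g * (inv\<^bsub>GL n\<^esub> g * u * g) * inv\<^bsub>GL n\<^esub> g = u" if u: "u \<in> carrier (GL n)" for u
  proof -
    have "g \<otimes>\<^bsub>GL n\<^esub> (inv\<^bsub>GL n\<^esub> g \<otimes>\<^bsub>GL n\<^esub> u \<otimes>\<^bsub>GL n\<^esub> g) \<otimes>\<^bsub>GL n\<^esub> inv\<^bsub>GL n\<^esub> g
      = (g \<otimes>\<^bsub>GL n\<^esub> inv\<^bsub>GL n\<^esub> g) \<otimes>\<^bsub>GL n\<^esub> u \<otimes>\<^bsub>GL n\<^esub> (g \<otimes>\<^bsub>GL n\<^esub> inv\<^bsub>GL n\<^esub> g)"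
      using g u by (simp only: C.m_assoc C.m_closed gi)
    then show ?thesis using C.r_inv[OF g] C.l_one[OF u] C.r_one[OF u] by simp
  qed
  have 2: "inv\<^bsub>GL n\<^esub> g * (g * u * inv\<^bsub>GL n\<^esub> g) * g = u" if u: "u \<in> carrier (GL n)" for u
  proof -
    have "inv\<^bsub>GL n\<^esub> g \<otimes>\<^bsub>GL n\<^esub> (g \<otimes>\<^bsub>GL n\<^esub> u \<otimes>\<^bsub>GL n\<^esub> inv\<^bsub>GL n\<^esub> g) \<otimes>\<^bsub>GL n\<^esub> g
      = (inv\<^bsub>GL n\<^esub> g \<otimes>\<^bsub>GL n\<^esub> g) \<otimes>\<^bsub>GL n\<^esub> u \<otimes>\<^bsub>GL n\<^esub> (inv\<^bsub>GL n\<^esub> g \<otimes>\<^bsub>GL n\<^esub> g)"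
      using g u by (simp only: C.m_assoc C.m_closed gi)
    then show ?thesis using C.l_inv[OF g] C.l_one[OF u] C.r_one[OF u] by simp
  qed
  show "g * (inv\<^bsub>GL n\<^esub> g * u * g) * inv\<^bsub>GL n\<^esub> g = u" "inv\<^bsub>GL n\<^esub> g * u * g \<in> U"
    if "u \<in> U_grp n (tab g)" for u
    using that 1 unfolding U_grp_tab[OF g] by auto
  show "F (g * (inv\<^bsub>GL n\<^esub> g * u * g) * inv\<^bsub>GL n\<^esub> g) = F u" if "u \<in> U_grp n (tab g)" for u
    using that 1 unfolding U_grp_tab[OF g] by auto
  show "inv\<^bsub>GL n\<^esub> g * (g * u * inv\<^bsub>GL n\<^esub> g) * g = u" "g * u * inv\<^bsub>GL n\<^esub> g \<in> U_grp n (tab g)"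
    if "u \<in> U" for u
    using that 2[OF C.U_closed(2)[OF that]] GL_mult[OF GL_mult[OF g C.U_closed(2)[OF that]] gi]
    unfolding U_grp_tab[OF g] by simp_all
qed

text \<open>In the basis of \<open>tab g\<close> the group becomes the fixed \<open>U\<close>, which
  then multiplies \<open>g\<close> from the right.\<close>

lemma e_vec_sum:
  assumes g: "(g :: 'f mat) \<in> carrier (GL n)"
  shows "e_vec n \<theta> (tab g) = (\<Sum>u\<in>U. fscale (inverse (bchar \<theta> u)) (m_vec n (tab (g * u))))"
proof -
  have "psi n \<theta> (tab g) (inv\<^bsub>GL n\<^esub> (g * u * inv\<^bsub>GL n\<^esub> g)) *
       m_vec n (tab_act (g * u * inv\<^bsub>GL n\<^esub> g) (tab g)) S = inverse (bchar \<theta> u) * m_vec n (tab (g * u)) S" if u: "u \<in> U" for u S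
  proof -
    have uG: "u \<in> carrier (GL n)" using u by simp
    note gi = GL_inv[OF g]
    have conj: "g * u * inv\<^bsub>GL n\<^esub> g \<in> carrier (GL n)" using g uG gi by (intro GL_mult)
    have "inv\<^bsub>GL n\<^esub> g \<otimes>\<^bsub>GL n\<^esub> inv\<^bsub>GL n\<^esub> (g \<otimes>\<^bsub>GL n\<^esub> u \<otimes>\<^bsub>GL n\<^esub> inv\<^bsub>GL n\<^esub> g) \<otimes>\<^bsub>GL n\<^esub> g
       = (inv\<^bsub>GL n\<^esub> g \<otimes>\<^bsub>GL n\<^esub> g) \<otimes>\<^bsub>GL n\<^esub> inv\<^bsub>GL n\<^esub> u \<otimes>\<^bsub>GL n\<^esub> (inv\<^bsub>GL n\<^esub> g \<otimes>\<^bsub>GL n\<^esub> g)"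
      using g uG by (simp only: C.inv_mult_group C.m_assoc C.m_closed gi C.inv_closed C.inv_inv)
    then have 1: "inv\<^bsub>GL n\<^esub> g * inv\<^bsub>GL n\<^esub> (g * u * inv\<^bsub>GL n\<^esub> g) * g = inv\<^bsub>GL n\<^esub> u"
      using C.l_inv[OF g] C.l_one[OF C.inv_closed[OF uG]] C.r_one[OF C.inv_closed[OF uG]] by simp
    have "(g \<otimes>\<^bsub>GL n\<^esub> u \<otimes>\<^bsub>GL n\<^esub> inv\<^bsub>GL n\<^esub> g) \<otimes>\<^bsub>GL n\<^esub> g = (g \<otimes>\<^bsub>GL n\<^esub> u) \<otimes>\<^bsub>GL n\<^esub> (inv\<^bsub>GL n\<^esub> g \<otimes>\<^bsub>GL n\<^esub> g)"
      using g uG by (simp only: C.m_assoc C.m_closed gi)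
    then have 2: "(g * u * inv\<^bsub>GL n\<^esub> g) * g = g * u"
      using C.l_inv[OF g] C.r_one[OF C.m_closed[OF g uG]] by simp
    show ?thesis
      unfolding psi_tab[OF g GL_inv[OF conj]] tab_act_tab[OF conj g] 1 2 C.char_inv[OF u] ..
  qed
  then show ?thesis
    unfolding e_vec_def sum_U_grp[OF g] by (auto simp: sum_fun_apply fun_eq_iff intro!: sum.cong)
qed

lemma m_vec_tact:
  assumes "(k :: 'f mat) \<in> carrier (GL n)" "g \<in> carrier (GL n)"
  shows "tact n lam k (m_vec n (tab g)) = (m_vec n (tab (k * g)) :: _ \<Rightarrow> 'k)"
proof (rule tfuns_eqI)
  show "tact n lam k (m_vec n (tab g)) \<in> (tfuns n lam :: ('f tableau \<Rightarrow> 'k) set)"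
    using assms by (intro W.act_mem m_vec_mem tab_mem)
  show "m_vec n (tab (k * g)) \<in> (tfuns n lam :: ('f tableau \<Rightarrow> 'k) set)"
    using assms by (intro m_vec_mem tab_mem GL_mult)
  fix h :: "'f mat" assume h: "h \<in> carrier (GL n)"
  have "inv\<^bsub>GL n\<^esub> g \<otimes>\<^bsub>GL n\<^esub> (inv\<^bsub>GL n\<^esub> k \<otimes>\<^bsub>GL n\<^esub> h) = inv\<^bsub>GL n\<^esub> (k \<otimes>\<^bsub>GL n\<^esub> g) \<otimes>\<^bsub>GL n\<^esub> h"
    using assms h by (simp add: C.m_assoc C.inv_mult_group del: GL_simps)
  then have e: "inv\<^bsub>GL n\<^esub> g * (inv\<^bsub>GL n\<^esub> k * h) = inv\<^bsub>GL n\<^esub> (k * g) * h" by simp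
  show "tact n lam k (m_vec n (tab g)) (tab h) = (m_vec n (tab (k * g)) (tab h) :: 'k)"
    unfolding tact_tab[OF assms(1) h] m_vec_tab[OF assms(2) GL_mult[OF GL_inv[OF assms(1)] h]]
      m_vec_tab[OF GL_mult[OF assms] h] e ..
qed

lemma e_vec_mem:
  assumes "(g :: 'f mat) \<in> carrier (GL n)" shows "e_vec n \<theta> (tab g) \<in> tfuns n lam"
  unfolding e_vec_sum[OF assms] using assms
  by (intro W.sum_mem W.scale_mem m_vec_mem tab_mem GL_mult) auto

lemma e_vec_tact:
  assumes k: "(k :: 'f mat) \<in> carrier (GL n)" and g: "g \<in> carrier (GL n)"
  shows "tact n lam k (e_vec n \<theta> (tab g)) = e_vec n \<theta> (tab (k * g))"
proof -
  have mem: "m_vec n (tab (g * u)) \<in> (tfuns n lam :: ('f tableau \<Rightarrow> 'k) set)" if "u \<in> U" for u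
    using g that by (intro m_vec_mem tab_mem GL_mult) auto
  have "tact n lam k (e_vec n \<theta> (tab g)) =
      (\<Sum>u\<in>U. tact n lam k (fscale (inverse (bchar \<theta> u)) (m_vec n (tab (g * u)))))"
    unfolding e_vec_sum[OF g] using k by (intro W.act_sum W.scale_mem mem)
  also have "\<dots> = (\<Sum>u\<in>U. fscale (inverse (bchar \<theta> u)) (m_vec n (tab (k * g * u))))"
  proof (rule sum.cong[OF refl])
    fix u :: "'f mat" assume u: "u \<in> U"
    have gu: "g * u \<in> carrier (GL n)" using GL_mult[OF g C.U_closed(2)[OF u]] .
    have "k * (g * u) = k * g * u" using C.m_assoc[OF k g C.U_closed(2)[OF u]] by simp
    then show "tact n lam k (fscale (inverse (bchar \<theta> u)) (m_vec n (tab (g * u))))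
        = fscale (inverse (bchar \<theta> u)) (m_vec n (tab (k * g * u)))"
      unfolding W.act_scale[OF k mem[OF u]] m_vec_tact[OF k gu] by simp
  qed
  finally show ?thesis unfolding e_vec_sum[OF GL_mult[OF k g]] .
qed

section \<open>The modules M and S and the bilinear form\<close>

abbreviation M :: "('f tableau \<Rightarrow> 'k) set" where "M \<equiv> M_space n lam"
abbreviation S :: "('f tableau \<Rightarrow> 'k) set" where "S \<equiv> S_space n \<theta> lam"
abbreviation Sp :: "('f tableau \<Rightarrow> 'k) set" where "Sp \<equiv> S_perp n \<theta> lam"

lemma m_vecs_sub: "m_vec n ` tableaux n lam \<subseteq> (tfuns n lam :: ('f tableau \<Rightarrow> 'k) set)"
  using m_vec_mem by auto

lemma e_vecs_sub: "e_vec n \<theta> ` tableaux n lam \<subseteq> tfuns n lam"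
  using e_vec_mem tableaux_tab by force

lemmas M_facts = span_fun_gmod[OF fun_rep_tfuns m_vecs_sub, folded tab_module_fun_gmod, folded M_space_def]
lemmas S_facts = span_fun_gmod[OF fun_rep_tfuns e_vecs_sub, folded tab_module_fun_gmod, folded S_space_def]

lemma m_in_M: "T \<in> tableaux n lam \<Longrightarrow> m_vec n T \<in> M"
  using M_facts(1) by auto

lemma e_in_S: "(g :: 'f mat) \<in> carrier (GL n) \<Longrightarrow> e_vec n \<theta> (tab g) \<in> S"
  using S_facts(1) tab_mem by auto

lemma sum_in_M: "(\<And>a. a \<in> A \<Longrightarrow> f a \<in> M) \<Longrightarrow> sum f A \<in> M"
  by (induction A rule: infinite_finite_induct) (auto simp: M_facts(3,4))

lemma e_in_M:
  assumes g: "(g :: 'f mat) \<in> carrier (GL n)" shows "e_vec n \<theta> (tab g) \<in> M"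
  unfolding e_vec_sum[OF g]
proof (intro sum_in_M M_facts(5))
  fix u :: "'f mat" assume "u \<in> U"
  then show "m_vec n (tab (g * u)) \<in> M" using g by (intro m_in_M tab_mem GL_mult) auto
qed

lemma S_sub_M: "S \<subseteq> M"
proof (rule S_facts(6)[OF _ M_facts(2) M_facts(3)])
  show "e_vec n \<theta> ` tableaux n lam \<subseteq> M" using e_in_M tableaux_tab by force
qed (auto intro: M_facts(4,5))

text \<open>Existence has to be shown because \<open>tab_form\<close> is a choice. The
  \<open>m_vec\<close> are indicators of disjoint cosets, so summing products of values over one
  tableau \<open>rep m\<close> per coset makes them orthonormal.\<close>

lemma is_tab_form_ex: "\<exists>B. is_tab_form n lam (B :: ('f tableau \<Rightarrow> 'k) \<Rightarrow> ('f tableau \<Rightarrow> 'k) \<Rightarrow> 'k)"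
proof -
  let ?I = "m_vec n ` tableaux n lam :: ('f tableau \<Rightarrow> 'k) set"
  define rep where "rep m = (SOME T. T \<in> tableaux n lam \<and> m_vec n T = m)" for m :: "'f tableau \<Rightarrow> 'k"
  have rep: "rep m \<in> tableaux n lam \<and> m_vec n (rep m) = m" if "m \<in> ?I" for m
  proof -
    have "\<exists>T. T \<in> tableaux n lam \<and> m_vec n T = m" using that by auto
    then show ?thesis unfolding rep_def by (rule someI_ex)
  qed
  define B where "B x y = (\<Sum>m\<in>?I. x (rep m) * y (rep m))" for x y :: "'f tableau \<Rightarrow> 'k"
  have fin: "finite ?I" unfolding tableaux_eq using finite_GL by auto
  have mrep: "m_vec n T (rep m) = (if m = m_vec n T then 1 else (0::'k))"
    if T: "T \<in> tableaux n lam" and m: "m \<in> ?I" for T m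
  proof -
    obtain g where g: "g \<in> carrier (GL n)" "T = tab g" using tableaux_tab[OF T] by auto
    obtain h where h: "h \<in> carrier (GL n)" "rep m = tab h" using tableaux_tab[of "rep m"] rep[OF m] by auto
    have mh: "m_vec n (tab h) = m" using rep[OF m] h by simp
    show ?thesis
      unfolding g(2) h(2) m_vec_tab[OF g(1) h(1)] using m_vec_eq_iff[OF g(1) h(1)] unfolding mh by simp
  qed
  have "is_tab_form n lam B"
    unfolding is_tab_form_def
  proof (intro conjI ballI allI)
    fix x y z :: "'f tableau \<Rightarrow> 'k" and a b
    show "B (\<lambda>S. a * x S + b * y S) z = a * B x z + b * B y z"
      "B z (\<lambda>S. a * x S + b * y S) = a * B z x + b * B z y"
      unfolding B_def by (simp_all add: algebra_simps sum.distrib sum_distrib_left)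
  next
    fix T T' :: "'f tableau" assume T: "T \<in> tableaux n lam" "T' \<in> tableaux n lam"
    have "B (m_vec n T) (m_vec n T') =
        (\<Sum>m\<in>?I. if m = m_vec n T then if m = m_vec n T' then 1 else 0 else 0)"
      unfolding B_def using T by (intro sum.cong refl) (simp add: mrep)
    then show "B (m_vec n T) (m_vec n T') = (if (m_vec n T :: _ \<Rightarrow> 'k) = m_vec n T' then 1 else 0)"
      using fin T by simp
  qed
  then show ?thesis by blast
qed

lemma tab_form:
  fixes x y z :: "'f tableau \<Rightarrow> 'k"
  shows "x \<in> M \<Longrightarrow> y \<in> M \<Longrightarrow> z \<in> M \<Longrightarrow> tab_form n lam (x + y) z = tab_form n lam x z + tab_form n lam y z"
    and "x \<in> M \<Longrightarrow> y \<in> M \<Longrightarrow> z \<in> M \<Longrightarrow> tab_form n lam z (x + y) = tab_form n lam z x + tab_form n lam z y"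
    and "x \<in> M \<Longrightarrow> z \<in> M \<Longrightarrow> tab_form n lam (fscale c x) z = c * tab_form n lam x z"
    and "x \<in> M \<Longrightarrow> z \<in> M \<Longrightarrow> tab_form n lam z (fscale c x) = c * tab_form n lam z x"
    and "z \<in> M \<Longrightarrow> tab_form n lam 0 z = 0"
    and "z \<in> M \<Longrightarrow> tab_form n lam z 0 = 0"
    and "T \<in> tableaux n lam \<Longrightarrow> T' \<in> tableaux n lam \<Longrightarrow> tab_form n lam (m_vec n T) (m_vec n T')
      = (if (m_vec n T :: 'f tableau \<Rightarrow> 'k) = m_vec n T' then 1 else (0::'k))"
proof -
  let ?B = "tab_form n lam :: ('f tableau \<Rightarrow> 'k) \<Rightarrow> ('f tableau \<Rightarrow> 'k) \<Rightarrow> 'k"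
  have B: "is_tab_form n lam ?B" unfolding tab_form_def using is_tab_form_ex by (rule someI_ex)
  have lin1: "?B (\<lambda>S. a * x S + b * y S) z = a * ?B x z + b * ?B y z"
    and lin2: "?B z (\<lambda>S. a * x S + b * y S) = a * ?B z x + b * ?B z y"
    if "x \<in> M" "y \<in> M" "z \<in> M" for x y z a b
    using B that unfolding is_tab_form_def by blast+
  have eqs: "(\<lambda>S. 1 * x S + 1 * y S) = x + y" "(\<lambda>S. c * x S + 0 * y S) = fscale c x"
    "(\<lambda>S. 0 * x S + 0 * y S) = 0" for x y :: "'f tableau \<Rightarrow> 'k" and c
    by (auto simp: fun_eq_iff)
  show "x \<in> M \<Longrightarrow> y \<in> M \<Longrightarrow> z \<in> M \<Longrightarrow> ?B (x + y) z = ?B x z + ?B y z"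
    "x \<in> M \<Longrightarrow> y \<in> M \<Longrightarrow> z \<in> M \<Longrightarrow> ?B z (x + y) = ?B z x + ?B z y"
    using lin1[of x y z 1 1] lin2[of x y z 1 1] unfolding eqs by auto
  show "x \<in> M \<Longrightarrow> z \<in> M \<Longrightarrow> ?B (fscale c x) z = c * ?B x z"
    "x \<in> M \<Longrightarrow> z \<in> M \<Longrightarrow> ?B z (fscale c x) = c * ?B z x"
    using lin1[of x x z c 0] lin2[of x x z c 0] unfolding eqs by auto
  show "z \<in> M \<Longrightarrow> ?B 0 z = 0" "z \<in> M \<Longrightarrow> ?B z 0 = 0"
    using lin1[of z z z 0 0] lin2[of z z z 0 0] unfolding eqs by auto
  show "T \<in> tableaux n lam \<Longrightarrow> T' \<in> tableaux n lam \<Longrightarrow> ?B (m_vec n T) (m_vec n T')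
      = (if (m_vec n T :: 'f tableau \<Rightarrow> 'k) = m_vec n T' then 1 else (0::'k))"
    using B unfolding is_tab_form_def by blast
qed

text \<open>Both sides are linear in \<open>x\<close> and agree on the generators, which are
  indicators of cosets. The form thus reduces to evaluation at tableaux.\<close>

lemma tab_form_m_vec:
  assumes x: "x \<in> M" and T: "T \<in> tableaux n lam" shows "tab_form n lam x (m_vec n T) = x T"
proof -
  let ?N = "{x \<in> M. tab_form n lam x (m_vec n T) = x T}"
  have "M \<subseteq> ?N"
  proof (rule M_facts(6))
    show "m_vec n ` tableaux n lam \<subseteq> ?N"
    proof clarify
      fix T' :: "'f tableau" assume T': "T' \<in> tableaux n lam"
      obtain g where g: "g \<in> carrier (GL n)" "T' = tab g" using tableaux_tab[OF T'] by auto
      obtain h where h: "h \<in> carrier (GL n)" "T = tab h" using tableaux_tab[OF T] by auto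
      have "(m_vec n T' T :: 'k) = (if (m_vec n T' :: 'f tableau \<Rightarrow> 'k) = m_vec n T then 1 else 0)"
        unfolding g(2) h(2) m_vec_tab[OF g(1) h(1)] using m_vec_eq_iff[OF g(1) h(1)]
        by (simp add: eq_commute[of "m_vec n (tab g)"])
      then show "m_vec n T' \<in> M \<and> tab_form n lam (m_vec n T') (m_vec n T) = (m_vec n T' T :: 'k)"
        using tab_form(7)[OF T' T] m_in_M[OF T'] by simp
    qed
    show "?N \<subseteq> tfuns n lam" using M_facts(2) by auto
  qed (auto simp: M_facts(3,4,5) tab_form(1,3,5) m_in_M[OF T])
  then show ?thesis using x by auto
qed

lemma tab_form_e_vec:
  assumes x: "x \<in> M" and g: "(g :: 'f mat) \<in> carrier (GL n)"
  shows "tab_form n lam x (e_vec n \<theta> (tab g)) = (\<Sum>u\<in>U. inverse (bchar \<theta> u) * x (tab (g * u)))"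
proof -
  have T: "tab (g * u) \<in> tableaux n lam" if "u \<in> U" for u
    using tab_mem[OF GL_mult[OF g C.U_closed(2)[OF that]]] .
  have sum: "tab_form n lam x (sum f A) = (\<Sum>a\<in>A. tab_form n lam x (f a))"
    if "\<And>a. a \<in> A \<Longrightarrow> f a \<in> M" for A :: "'f mat set" and f
    using that by (induction A rule: infinite_finite_induct) (simp_all add: tab_form(2,6) x sum_in_M)
  have "tab_form n lam x (e_vec n \<theta> (tab g))
      = (\<Sum>u\<in>U. tab_form n lam x (fscale (inverse (bchar \<theta> u)) (m_vec n (tab (g * u)))))"
    unfolding e_vec_sum[OF g] by (intro sum M_facts(5) m_in_M T)
  also have "\<dots> = (\<Sum>u\<in>U. inverse (bchar \<theta> u) * x (tab (g * u)))"
    using T by (intro sum.cong refl) (simp add: tab_form(4) m_in_M x tab_form_m_vec)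
  finally show ?thesis .
qed

text \<open>The sum is the pairing of \<open>x\<close> with \<open>e_vec\<close> at
  \<open>tab g\<close>. In this shape, failure of orthogonality is the hypothesis \<open>nz\<close>
  of \<open>C.cell_vec_mem\<close>.\<close>

lemma S_perp_iff:
  "x \<in> Sp \<longleftrightarrow> x \<in> M \<and> (\<forall>g\<in>carrier (GL n). (\<Sum>u\<in>U. inverse (bchar \<theta> u) * x (tab (g * u))) = 0)"
proof
  assume x: "x \<in> Sp"
  then have "x \<in> M" unfolding S_perp_def by simp
  moreover have "tab_form n lam x (e_vec n \<theta> (tab g)) = 0" if "g \<in> carrier (GL n)" for g
    using x e_in_S[OF that] unfolding S_perp_def by simp
  ultimately show "x \<in> M \<and> (\<forall>g\<in>carrier (GL n). (\<Sum>u\<in>U. inverse (bchar \<theta> u) * x (tab (g * u))) = 0)"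
    using tab_form_e_vec by simp
next
  assume a: "x \<in> M \<and> (\<forall>g\<in>carrier (GL n). (\<Sum>u\<in>U. inverse (bchar \<theta> u) * x (tab (g * u))) = 0)"
  then have x: "x \<in> M" by simp
  let ?N = "{s \<in> M. tab_form n lam x s = 0}"
  have "S \<subseteq> ?N"
  proof (rule S_facts(6))
    show "e_vec n \<theta> ` tableaux n lam \<subseteq> ?N"
    proof clarify
      fix T :: "'f tableau" assume "T \<in> tableaux n lam"
      then obtain g where g: "g \<in> carrier (GL n)" "T = tab g" using tableaux_tab by blast
      then show "e_vec n \<theta> T \<in> M \<and> tab_form n lam x (e_vec n \<theta> T) = 0"
        using a tab_form_e_vec[OF x g(1)] e_in_M[OF g(1)] by simp
    qed
    show "?N \<subseteq> tfuns n lam" using M_facts(2) by auto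
  qed (auto simp: M_facts(3,4,5) tab_form(2,4,6) x)
  then show "x \<in> Sp" unfolding S_perp_def using x by auto
qed

end

section \<open>Irreducibility of the quotient and its eigenvectors\<close>

context tableau_char
begin

abbreviation R :: "('f tableau \<Rightarrow> 'k) set" where "R \<equiv> S \<inter> Sp"

lemma D_module_quot: "D_module n \<theta> lam = kg_quot (fun_gmod (tact n lam) S) R"
  unfolding D_module_def tab_module_fun_gmod by simp

lemma fun_rep_S: "fun_rep (GL n) (tact n lam) S"
proof (rule fun_rep_subset[OF fun_rep_tfuns S_facts(2,3,4,5)])
  interpret W: fun_rep "GL n :: 'f mat monoid" "tact n lam" "tfuns n lam :: ('f tableau \<Rightarrow> 'k) set"
    by (rule fun_rep_tfuns)
  fix k :: "'f mat" and x assume k: "k \<in> carrier (GL n)" and x: "x \<in> S"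
  have "S \<subseteq> {x \<in> tfuns n lam. tact n lam k x \<in> S}"
  proof (rule S_facts(6))
    show "e_vec n \<theta> ` tableaux n lam \<subseteq> {x \<in> tfuns n lam. tact n lam k x \<in> S}"
    proof clarify
      fix T :: "'f tableau" assume "T \<in> tableaux n lam"
      then obtain g where g: "g \<in> carrier (GL n)" "T = tab g" using tableaux_tab[of T] by auto
      show "e_vec n \<theta> T \<in> tfuns n lam \<and> tact n lam k (e_vec n \<theta> T) \<in> S"
        unfolding g(2) e_vec_tact[OF k g(1)] using e_vec_mem[OF g(1)] e_in_S[OF GL_mult[OF k g(1)]] by simp
    qed
  qed (auto simp: W.zero_mem W.add_mem W.scale_mem W.act_zero[OF k] W.act_add[OF k] W.act_scale[OF k]
      S_facts(3,4,5))
  then show "tact n lam k x \<in> S" using x by auto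
qed auto

lemma fun_rep_R: "fun_rep (GL n) (tact n lam) R"
proof (rule fun_rep_subset[OF fun_rep_S])
  interpret W: fun_rep "GL n :: 'f mat monoid" "tact n lam" S by (rule fun_rep_S)
  have SM: "x \<in> S \<Longrightarrow> x \<in> M" for x using S_sub_M by auto
  show "R \<subseteq> S" by simp
  show "0 \<in> R" using W.zero_mem SM by (simp add: S_perp_iff)
  show "x + y \<in> R" if "x \<in> R" "y \<in> R" for x y
    using that by (simp add: S_perp_iff W.add_mem M_facts(4) distrib_left sum.distrib)
  show "fscale c x \<in> R" if "x \<in> R" for c x
    using that by (simp add: S_perp_iff W.scale_mem M_facts(5) mult.left_commute flip: sum_distrib_left)
  show "tact n lam k x \<in> R" if k: "k \<in> carrier (GL n)" and x: "x \<in> R" for k :: "'f mat" and x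
  proof -
    have kx: "tact n lam k x \<in> S" using k x by (intro W.act_mem) auto
    have "(\<Sum>u\<in>U. inverse (bchar \<theta> u) * tact n lam k x (tab (g * u))) = 0" if g: "g \<in> carrier (GL n)" for g
    proof -
      note kg = GL_mult[OF GL_inv[OF k] g]
      have "tact n lam k x (tab (g * u)) = x (tab (inv\<^bsub>GL n\<^esub> k * g * u))" if u: "u \<in> U" for u
      proof -
        have uG: "u \<in> carrier (GL n)" using u by simp
        have "inv\<^bsub>GL n\<^esub> k * (g * u) = inv\<^bsub>GL n\<^esub> k * g * u"
          using C.m_assoc[OF GL_inv[OF k] g uG] by simp
        then show ?thesis unfolding tact_tab[OF k GL_mult[OF g uG]] by simp
      qed
      then show ?thesis using x kg by (simp add: S_perp_iff)
    qed
    then show ?thesis using kx SM[OF kx] by (simp add: S_perp_iff)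
  qed
qed

text \<open>Pulls functions on tableaux back along \<open>tab\<close>; the image of \<open>M\<close>
  consists of functions on G/P, where the results on \<open>cell_vec\<close> apply.\<close>

definition to_GL :: "('f tableau \<Rightarrow> 'k) \<Rightarrow> 'f mat \<Rightarrow> 'k" where
  "to_GL x = (\<lambda>g. if g \<in> carrier (GL n) then x (tab g) else 0)"

lemma to_GL_simps:
  "to_GL (x + y) = to_GL x + to_GL y" "to_GL (fscale c x) = fscale c (to_GL x)" "to_GL 0 = 0"
  by (auto simp: to_GL_def fun_eq_iff)

lemma to_GL_tact: "g \<in> carrier (GL n) \<Longrightarrow> to_GL (tact n lam g x) = ltrans (GL n) g (to_GL x)"
  using GL_mult[OF GL_inv] by (auto simp: to_GL_def ltrans_def tact_tab fun_eq_iff)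

lemma to_GL_inj:
  assumes "x \<in> tfuns n lam" "y \<in> tfuns n lam" "to_GL x = to_GL y" shows "x = y"
proof (rule tfuns_eqI[OF assms(1,2)])
  fix h :: "'f mat" assume "h \<in> carrier (GL n)"
  then show "x (tab h) = y (tab h)" using fun_cong[OF assms(3), of h] by (simp add: to_GL_def)
qed

lemma to_GL_e_vec: "to_GL (e_vec n \<theta> (tab (1\<^sub>m n))) = C.cell_vec"
proof
  fix h :: "'f mat"
  have "m_vec n (tab (1\<^sub>m n * u)) (tab h) = (if inv\<^bsub>GL n\<^esub> u * h \<in> P then 1 else (0::'k))"
    if "u \<in> U" "h \<in> carrier (GL n)" for u
  proof -
    have uG: "u \<in> carrier (GL n)" using that by simp
    then have "1\<^sub>m n * u = u" using C.l_one by simp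
    then show ?thesis using m_vec_tab[OF uG that(2)] by simp
  qed
  then show "to_GL (e_vec n \<theta> (tab (1\<^sub>m n))) h = C.cell_vec h"
    unfolding to_GL_def C.cell_vec_def e_vec_sum[OF one_GL] sum_fun_apply by (auto intro!: sum.cong)
qed

lemma to_GL_M:
  assumes "x \<in> M" shows "to_GL x \<in> coset_functions (GL n) P"
proof -
  let ?N = "{x \<in> tfuns n lam. \<forall>g\<in>carrier (GL n). \<forall>p\<in>P. x (tab (g * p)) = x (tab g)} :: ('f tableau \<Rightarrow> 'k) set"
  have "M \<subseteq> ?N"
  proof (rule M_facts(6))
    show "m_vec n ` tableaux n lam \<subseteq> ?N"
    proof clarify
      fix T :: "'f tableau" assume T: "T \<in> tableaux n lam"
      obtain k where k: "k \<in> carrier (GL n)" "T = tab k" using tableaux_tab[OF T] by auto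
      have "m_vec n T (tab (g * p)) = (m_vec n T (tab g) :: 'k)"
        if g: "g \<in> carrier (GL n)" and p: "p \<in> P" for g p
      proof -
        have pG: "p \<in> carrier (GL n)" using p by simp
        let ?a = "inv\<^bsub>GL n\<^esub> k \<otimes>\<^bsub>GL n\<^esub> g"
        have aG: "?a \<in> carrier (GL n)" using k g by (intro C.m_closed C.inv_closed)
        have a: "inv\<^bsub>GL n\<^esub> k * (g * p) = ?a \<otimes>\<^bsub>GL n\<^esub> p" using C.m_assoc[OF GL_inv[OF k(1)] g pG] by simp
        have "?a \<otimes>\<^bsub>GL n\<^esub> p \<otimes>\<^bsub>GL n\<^esub> inv\<^bsub>GL n\<^esub> p = ?a"
          using aG pG by (simp add: C.m_assoc[of ?a] C.r_inv[OF pG] del: GL_simps)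
        then have "?a \<otimes>\<^bsub>GL n\<^esub> p \<in> P \<longleftrightarrow> ?a \<in> P"
          using C.P_closed(4)[of ?a p] C.P_closed(4)[of "?a \<otimes>\<^bsub>GL n\<^esub> p" "inv\<^bsub>GL n\<^esub> p"]
            C.P_closed(3)[OF p] p by auto
        then show ?thesis
          unfolding k(2) m_vec_tab[OF k(1) GL_mult[OF g pG]] m_vec_tab[OF k(1) g] a by simp
      qed
      then show "(m_vec n T :: 'f tableau \<Rightarrow> 'k) \<in> tfuns n lam \<and>
          (\<forall>g\<in>carrier (GL n). \<forall>p\<in>P. m_vec n T (tab (g * p)) = (m_vec n T (tab g) :: 'k))"
        using m_vec_mem[OF T] by simp
    qed
  qed (auto simp: tfuns_def)
  moreover have "g * p \<in> carrier (GL n)" if "g \<in> carrier (GL n)" "p \<in> P" for g p :: "'f mat"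
    using that by (intro GL_mult) auto
  ultimately show ?thesis using assms unfolding coset_functions_def to_GL_def by auto
qed

lemma e_vec_not_perp: "e_vec n \<theta> (tab (1\<^sub>m n)) \<notin> Sp"
proof
  let ?e = "e_vec n \<theta> (tab (1\<^sub>m n))"
  assume "?e \<in> Sp"
  \<comment> \<open>Orthogonality is tested on the translate of \<open>e_vec\<close> by
    \<open>torus\<close>, where \<open>sum_cell_vec\<close> evaluates the pairing to the nonzero
    number \<open>card U\<close>.\<close>
  then have "(\<Sum>u\<in>U. inverse (bchar \<theta> u) * ?e (tab (torus * u))) = 0"
    using C.t_carrier(1) unfolding S_perp_iff by blast
  moreover have "?e (tab (torus * u)) = C.cell_vec (torus \<otimes>\<^bsub>GL n\<^esub> u)" if "u \<in> U" for u
    using that GL_mult[OF C.t_carrier(1) C.U_closed(2)[OF that]]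
    unfolding to_GL_e_vec[symmetric] by (simp add: to_GL_def)
  ultimately show False using C.sum_cell_vec C.card_U by simp
qed

lemma fun_subrep_SR: "fun_subrep (GL n) (tact n lam) S R"
  unfolding fun_subrep_iff using fun_rep_S fun_rep_R by simp

lemma R_neq_S: "R \<noteq> S"
  using e_vec_not_perp e_in_S[OF one_GL] by auto

lemma fun_rep_cosets: "fun_rep (GL n) (ltrans (GL n)) (coset_functions (GL n) P :: ('f mat \<Rightarrow> 'k) set)"
  by (rule fun_rep_coset_functions[OF group_GL]) auto

text \<open>The submodule theorem: if \<open>N\<close> contains \<open>e_vec\<close>, its translates
  generate \<open>S\<close>. If not, a member of \<open>N\<close> outside the orthogonal space would
  bring \<open>e_vec\<close> into \<open>N\<close> by \<open>C.cell_vec_mem\<close>.\<close>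

lemma SR_irreducible:
  assumes N: "fun_rep (GL n) (tact n lam) N" "R \<subseteq> N" "N \<subseteq> S"
  shows "N = R \<or> N = S"
proof (rule disjCI)
  assume "N \<noteq> S"
  interpret N: fun_rep "GL n :: 'f mat monoid" "tact n lam" N by fact
  have NM: "x \<in> M" if "x \<in> N" for x using that N(3) S_sub_M by auto
  let ?e = "e_vec n \<theta> (tab (1\<^sub>m n))"
  have sub: "to_GL ` N \<subseteq> coset_functions (GL n) P" using NM to_GL_M by auto
  have rep: "fun_rep (GL n) (ltrans (GL n)) (to_GL ` N)"
  proof (rule fun_rep_subset[OF fun_rep_cosets sub])
    show "0 \<in> to_GL ` N" using N.zero_mem to_GL_simps(3) by force
    show "x + y \<in> to_GL ` N" if "x \<in> to_GL ` N" "y \<in> to_GL ` N" for x y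
      using that N.add_mem by (auto simp flip: to_GL_simps)
    show "fscale c x \<in> to_GL ` N" if "x \<in> to_GL ` N" for c x
      using that N.scale_mem by (auto simp flip: to_GL_simps)
    show "ltrans (GL n) g x \<in> to_GL ` N" if "g \<in> carrier (GL n)" "x \<in> to_GL ` N" for g x
      using that N.act_mem by (auto simp flip: to_GL_tact)
  qed
  have "?e \<notin> N"
  proof
    assume e: "?e \<in> N"
    have "S \<subseteq> N"
    proof (rule S_facts(6))
      show "e_vec n \<theta> ` tableaux n lam \<subseteq> N"
      proof clarify
        fix T :: "'f tableau" assume "T \<in> tableaux n lam"
        then obtain g where g: "g \<in> carrier (GL n)" "T = tab g" using tableaux_tab[of T] by auto
        have "g * 1\<^sub>m n = g" using carrier_GL_mat[OF g(1)] by simp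
        then have "e_vec n \<theta> T = tact n lam g ?e" using e_vec_tact[OF g(1) one_GL] g(2) by simp
        then show "e_vec n \<theta> T \<in> N" using N.act_mem[OF g(1) e] by simp
      qed
      show "N \<subseteq> tfuns n lam" using N(3) S_facts(2) by auto
    qed (auto intro: N.zero_mem N.add_mem N.scale_mem)
    then show False using N(3) \<open>N \<noteq> S\<close> by auto
  qed
  have "x \<in> Sp" if x: "x \<in> N" for x
  proof (rule ccontr)
    assume "x \<notin> Sp"
    then obtain g where g: "g \<in> carrier (GL n)"
      "(\<Sum>u\<in>U. inverse (bchar \<theta> u) * x (tab (g * u))) \<noteq> 0"
      using NM[OF x] unfolding S_perp_iff by auto
    have "to_GL x (g \<otimes>\<^bsub>GL n\<^esub> u) = x (tab (g * u))" if "u \<in> U" for u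
      using GL_mult[OF g(1) C.U_closed(2)[OF that]] by (simp add: to_GL_def)
    then have "(\<Sum>u\<in>U. inverse (bchar \<theta> u) * to_GL x (g \<otimes>\<^bsub>GL n\<^esub> u)) \<noteq> 0" using g(2) by simp
    then have "C.cell_vec \<in> to_GL ` N" using C.cell_vec_mem[OF rep sub _ g(1)] x by blast
    then obtain y where y: "y \<in> N" "to_GL y = to_GL ?e" unfolding to_GL_e_vec[symmetric] by auto
    have "y = ?e" using y N(3) S_facts(2) e_vec_mem[OF one_GL] by (intro to_GL_inj) auto
    then show False using y(1) \<open>?e \<notin> N\<close> by simp
  qed
  then show "N = R" using N by auto
qed

text \<open>Invariance under \<open>P\<close> implies invariance under \<open>H\<close>, so
  \<open>to_GL\<close> embeds \<open>S\<close> into the module induced from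
  \<open>H\<close>.\<close>

lemma D_module_composition_factor:
  assumes "H \<subseteq> P"
    and "composition_series (GL n) (ind_trivial n H :: ('k, 'f mat \<Rightarrow> 'k, 'f mat) gmodule) Ws"
  shows "\<exists>C \<in> composition_factors (GL n) (ind_trivial n H :: ('k, 'f mat \<Rightarrow> 'k, 'f mat) gmodule).
    kg_iso (GL n) (D_module n \<theta> lam) C"
  unfolding D_module_quot ind_trivial_def ind_module_trivial
proof (rule irreducible_subquotient_composition_factor[OF fun_subrep_SR R_neq_S SR_irreducible,
      where T = to_GL])
  have H: "H \<subseteq> carrier (GL n)" using assms(1) by auto
  show "fun_rep (GL n) (ltrans (GL n)) (coset_functions (GL n) H :: ('f mat \<Rightarrow> 'k) set)"
    by (rule fun_rep_coset_functions[OF group_GL H])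
  show "composition_series (GL n) (fun_gmod (ltrans (GL n)) (coset_functions (GL n) H)) Ws"
    using assms(2) unfolding ind_trivial_def ind_module_trivial .
  show "to_GL x \<in> coset_functions (GL n) H" if "x \<in> S" for x
  proof -
    have "to_GL x \<in> coset_functions (GL n) P" using to_GL_M that S_sub_M by auto
    then show ?thesis using assms(1) unfolding coset_functions_def by blast
  qed
  show "x = 0" if "x \<in> S" "to_GL x = 0" for x
    using that S_facts(2,3) to_GL_simps(3) by (intro to_GL_inj) auto
qed (auto simp: to_GL_simps to_GL_tact)

lemma D_module_eigenvector: "has_eigenvector (D_module n \<theta> lam) U (bchar \<theta>)"
proof -
  interpret Q: fun_subrep "GL n :: 'f mat monoid" "tact n lam" S R by (rule fun_subrep_SR)
  let ?e = "e_vec n \<theta> (tab (1\<^sub>m n))"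
  have e: "?e \<in> S" by (rule e_in_S[OF one_GL])
  have "tact n lam u ?e = fscale (bchar \<theta> u) ?e" if u: "u \<in> U" for u
  proof (rule to_GL_inj)
    have uG: "u \<in> carrier (GL n)" using u by simp
    show "tact n lam u ?e \<in> tfuns n lam" "fscale (bchar \<theta> u) ?e \<in> tfuns n lam"
      using Q.V.act_mem[OF uG e] Q.V.scale_mem[OF e] S_facts(2) by auto
    show "to_GL (tact n lam u ?e) = to_GL (fscale (bchar \<theta> u) ?e)"
      unfolding to_GL_tact[OF uG] to_GL_simps to_GL_e_vec by (rule C.cell_vec_eigenvector[OF u])
  qed
  moreover have "Q.cs ?e \<noteq> Q.cs 0"
    unfolding Q.cs_eq using e_vec_not_perp by simp
  ultimately show ?thesis
    unfolding has_eigenvector_def D_module_quot using e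
    by (intro bexI[of _ "Q.cs ?e"]) (auto simp: Q.carrier_Q Q.zero_Q(2) Q.gact_Q Q.smult_Q)
qed

text \<open>\<open>U'\<close> is independent of \<open>lam\<close>: it will be the group of another
  shape, whose character is tested against the flags of this one.\<close>

lemma D_module_eigenvectorD:
  assumes "lin_char (GL n) U' \<chi>" "has_eigenvector (D_module n \<theta> lam) U' \<chi>"
  shows "\<exists>f\<in>coset_functions (GL n) P. f \<noteq> 0 \<and> (\<forall>u\<in>U'. ltrans (GL n) u f = fscale (\<chi> u) f)"
proof -
  interpret L: lin_char "GL n :: 'f mat monoid" U' \<chi> by fact
  obtain x where x: "x \<in> S" "x \<noteq> 0" "\<forall>u\<in>U'. tact n lam u x = fscale (\<chi> u) x"
    using L.eigenvector_lift[OF fun_subrep_SR] assms(2) unfolding D_module_quot by blast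
  have "to_GL x \<in> coset_functions (GL n) P" using x(1) S_sub_M by (intro to_GL_M) auto
  moreover have "to_GL x \<noteq> 0"
    using to_GL_inj[of x 0] x(1,2) S_facts(2,3) to_GL_simps(3) by auto
  moreover have "ltrans (GL n) u (to_GL x) = fscale (\<chi> u) (to_GL x)" if "u \<in> U'" for u
    using x(3) that to_GL_tact[of u x] L.U_closed(2)[OF that] by (simp add: to_GL_simps)
  ultimately show ?thesis by blast
qed

end

lemma (in young_boxes) borel_subset_P: "borel_subgroup n \<subseteq> P"
proof
  fix g :: "'f::field mat" assume g: "g \<in> borel_subgroup n"
  have row: "row_of_box (replicate n 1) i = i" if "i < n" for i
  proof -
    have "row_of_box (replicate n 1) i < k \<longleftrightarrow> i < k" if "k \<le> n" for k
      using row_of_box_less_iff[OF is_partition_replicate \<open>i < n\<close>, of k] that by (simp add: part_def)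
    from this[of i] this[of "Suc i"] show ?thesis using that by simp
  qed
  have "g $$ (i, j) = 0" if "i < n" "j < n" "ncols - cl j < ncols - cl i" for i j
  proof -
    have "cl i < cl j" using that(3) by simp
    then have "j < i" using boxes_order[of i j] that by (cases i j rule: linorder_cases) auto
    then show ?thesis using g that row unfolding borel_subgroup_def parabolic_def by auto
  qed
  then show "g \<in> P" using g unfolding P_def block_parabolic_def borel_subgroup_def parabolic_def by auto
qed

section \<open>Comparison with James' modules\<close>

lemma exists_tableau_char:
  assumes "add_char \<theta>" "is_partition n lam" obtains rw cl where "tableau_char n lam rw cl \<theta>"
  using exists_young_boxes[OF assms(2)] assms
  unfolding tableau_char_def young_tableau_def young_tableau_axioms_def by blast

text \<open>The eigenvector for the shape \<open>lam\<close> is carried to the module of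
  \<open>mu\<close>, which is a subquotient of functions on flags whose block sizes are the column
  heights of \<open>mu\<close>.\<close>

lemma D_module_iso_dominates:
  fixes \<theta> :: "'f::{field,finite} \<Rightarrow> 'k::field"
  assumes "add_char \<theta>" "is_partition n lam" "is_partition n mu"
    and iso: "kg_iso (GL n) (D_module n \<theta> lam) (D_module n \<theta> mu)"
  shows "dominates (conj_partition lam) (conj_partition mu)"
proof -
  obtain rwA clA where A: "tableau_char n lam rwA clA \<theta>" using exists_tableau_char assms by blast
  obtain rwB clB where B: "tableau_char n mu rwB clB \<theta>" using exists_tableau_char assms by blast
  interpret A: tableau_char n lam rwA clA \<theta> by (rule A)
  interpret B: tableau_char n mu rwB clB \<theta> by (rule B)
  have "has_eigenvector (D_module n \<theta> mu) A.U (A.bchar \<theta>)"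
    using iso A.U_carrier A.D_module_eigenvector by (rule has_eigenvector_iso)
  from B.D_module_eigenvectorD[OF A.C.lin_char_axioms this]
  obtain f where f: "f \<in> coset_functions (GL n) B.P" "f \<noteq> 0"
    "\<forall>u\<in>A.U. ltrans (GL n) u f = fscale (A.bchar \<theta> u) f" by blast
  have "(\<Sum>c<k. part (conj_partition mu) c) \<le> (\<Sum>c<k. part (conj_partition lam) c)" for k
  proof -
    \<comment> \<open>The block numbers of the first \<open>k\<close> columns. Truncated subtraction
      may identify some of them, so only an upper bound on their number is available, which is the
      direction used here.\<close>
    let ?S = "(\<lambda>c. B.ncols - c) ` {..<k}"
    have S: "card ?S \<le> k" using card_image_le[of "{..<k}"] by simp
    have "card {i. i < n \<and> clB i < k} \<le> card {i. i < n \<and> B.ncols - clB i \<in> ?S}"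
      by (rule card_mono) auto
    also have "\<dots> \<le> card {i. i < n \<and> clA i < card ?S}"
      using f(3) by (intro A.eigenvector_levels[OF assms(1) f(1)[unfolded B.P_def] f(2)]) auto
    also have "\<dots> \<le> card {i. i < n \<and> clA i < k}" using S by (intro card_mono) auto
    finally show ?thesis unfolding A.card_cols[OF assms(2)] B.card_cols[OF assms(3)] .
  qed
  then show ?thesis unfolding dominates_def by blast
qed

text \<open>A composition factor is a subquotient of the coset functions, so its eigenvector lifts
  to an eigenfunction on flags of type \<open>nu\<close>, and the flag bound applies to the first k
  blocks.\<close>

lemma D_module_composition_factor_dominates:
  fixes \<theta> :: "'f::{field,finite} \<Rightarrow> 'k::field"
  assumes "add_char \<theta>" "is_partition n lam" "is_partition n nu"
    and C: "C \<in> composition_factors (GL n)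
      (ind_trivial n (parabolic n nu) :: ('k, 'f mat \<Rightarrow> 'k, 'f mat) gmodule)"
    and iso: "kg_iso (GL n) (D_module n \<theta> lam) C"
  shows "dominates (conj_partition lam) nu"
proof -
  obtain rw cl where A: "tableau_char n lam rw cl \<theta>" using exists_tableau_char assms by blast
  interpret A: tableau_char n lam rw cl \<theta> by (rule A)
  let ?H = "block_parabolic n (row_of_box nu) :: 'f mat set"
  let ?V = "coset_functions (GL n) ?H :: ('f mat \<Rightarrow> 'k) set"
  have V: "fun_rep (GL n) (ltrans (GL n)) ?V"
    by (rule fun_rep_coset_functions[OF group_GL]) (auto simp: block_parabolic_def)
  have ind: "ind_trivial n (parabolic n nu) = fun_gmod (ltrans (GL n)) ?V"
    unfolding ind_trivial_def ind_module_trivial parabolic_block ..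
  obtain Ws i where Ws: "composition_series (GL n) (fun_gmod (ltrans (GL n)) ?V) Ws" "Suc i < length Ws"
    "C = kg_quot (fun_gmod (ltrans (GL n)) (Ws ! Suc i)) (Ws ! i)"
    using C unfolding composition_factors_def ind by auto
  have rep: "fun_rep (GL n) (ltrans (GL n)) W" "W \<subseteq> ?V" if "W \<in> set Ws" for W
    using Ws(1) that unfolding composition_series_def kg_submodule_fun_gmod[OF V] by auto
  have sub: "fun_subrep (GL n) (ltrans (GL n)) (Ws ! Suc i) (Ws ! i)"
    unfolding fun_subrep_iff using rep Ws(1,2) unfolding composition_series_def by auto
  have "has_eigenvector C A.U (A.bchar \<theta>)"
    using iso A.U_carrier A.D_module_eigenvector by (rule has_eigenvector_iso)
  from A.C.eigenvector_lift[OF sub this[unfolded Ws(3)]]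
  obtain f where f: "f \<in> Ws ! Suc i" "f \<noteq> 0" "\<forall>u\<in>A.U. ltrans (GL n) u f = fscale (A.bchar \<theta> u) f" by blast
  have fV: "f \<in> ?V" using rep(2)[of "Ws ! Suc i"] f(1) Ws(2) by auto
  have "(\<Sum>j<k. part nu j) \<le> (\<Sum>c<k. part (conj_partition lam) c)" for k
  proof -
    have "card {i. i < n \<and> row_of_box nu i \<in> {..<k}} \<le> card {i. i < n \<and> cl i < card {..<k}}"
      using f(3) by (intro A.eigenvector_levels[OF assms(1) fV f(2)]) auto
    then show ?thesis using card_row_of_box_less[OF assms(3), of k] A.card_cols[OF assms(2), of k] by simp
  qed
  then show ?thesis unfolding dominates_def by blast
qed

theorem corollary2p14:
  fixes n p k :: nat
    and \<theta> :: "'f::{field,finite} \<Rightarrow> 'k::field"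
    and D :: "nat list \<Rightarrow> ('k, 'd, 'f mat) gmodule"
  assumes "n > 0"
    and "prime p" and "k > 0" and "card (UNIV :: 'f set) = p ^ k"
    and "\<exists>\<zeta>::'k. \<zeta> ^ p = 1 \<and> \<zeta> \<noteq> 1"
    and "\<forall>x. \<theta> x \<noteq> 0" and "\<forall>x y. \<theta> (x + y) = \<theta> x * \<theta> y" and "\<exists>x. \<theta> x \<noteq> 1"
    and "james_modules n D"
  shows "(\<forall>lam. is_partition n lam \<longrightarrow> kg_iso (GL n) (D_module n \<theta> lam) (D (conj_partition lam))) \<and>
    (\<forall>lam. is_partition n lam \<longrightarrow> irreducible_unipotent n (D_module n \<theta> lam)) \<and>
    (\<forall>lam mu. is_partition n lam \<and> is_partition n mu \<and>
       kg_iso (GL n) (D_module n \<theta> lam) (D_module n \<theta> mu) \<longrightarrow> lam = mu) \<and>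
    (\<forall>V :: ('k, 'v, 'f mat) gmodule. irreducible_unipotent n V \<longrightarrow>
       (\<exists>lam. is_partition n lam \<and> kg_iso (GL n) V (D_module n \<theta> lam)))"
proof -
  have "of_nat (card (UNIV :: 'f set)) \<noteq> (0::'k)"
    using of_nat_prime_nonzero[OF assms(2,5)] assms(4) by simp
  then have \<theta>: "add_char \<theta>" using assms(6-8) by unfold_locales auto
  let ?B = "borel_subgroup n :: 'f mat set"
  let ?I = "ind_trivial n ?B :: ('k, 'f mat \<Rightarrow> 'k, 'f mat) gmodule"
  have B: "?B = parabolic n (replicate n 1)" by (rule borel_subgroup_def)
  note one = is_partition_replicate[of n]
  note james = assms(9)[unfolded james_modules_def]
  have J1: "kg_irreducible (GL n) (D lam)" if "is_partition n lam" for lam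
    using james that by blast
  have J3: "\<exists>C \<in> composition_factors (GL n) (ind_trivial n (parabolic n lam)). kg_iso (GL n) (D lam) C"
    if "is_partition n lam" for lam
    using james that by blast
  have J4: "\<exists>lam. is_partition n lam \<and> kg_iso (GL n) C (D lam)" if "C \<in> composition_factors (GL n) ?I" for C
    using james one that unfolding B by blast
  \<comment> \<open>The mere existence of a composition factor of the module induced from the Borel
    subgroup provides a composition series.\<close>
  obtain Ws where Ws: "composition_series (GL n) ?I Ws"
    using J3[OF one] unfolding B composition_factors_def by blast
  have factor: "\<exists>C \<in> composition_factors (GL n) ?I. kg_iso (GL n) (D_module n \<theta> lam) C"
    if lam: "is_partition n lam" for lam
  proof -
    obtain rw cl where "tableau_char n lam rw cl \<theta>" using exists_tableau_char[OF \<theta> lam] by blast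
    then interpret tableau_char n lam rw cl \<theta> .
    show ?thesis using borel_subset_P Ws by (rule D_module_composition_factor)
  qed
  have "\<exists>nu. is_partition n nu \<and> kg_iso (GL n) (D_module n \<theta> lam) (D nu)"
    if lam: "is_partition n lam" for lam
  proof -
    obtain C where "C \<in> composition_factors (GL n) ?I" "kg_iso (GL n) (D_module n \<theta> lam) C"
      using factor[OF lam] by blast
    then show ?thesis using J4[of C] kg_iso_trans by blast
  qed
  then obtain f where f: "is_partition n (f lam)" "kg_iso (GL n) (D_module n \<theta> lam) (D (f lam))"
    if "is_partition n lam" for lam by metis
  \<comment> \<open>Isomorphism is symmetric, so the two conjugate partitions dominate each
    other.\<close>
  have f_inj: "lam = mu" if lm: "is_partition n lam" "is_partition n mu" and
    iso: "kg_iso (GL n) (D_module n \<theta> lam) (D_module n \<theta> mu)" for lam mu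
  proof -
    have "dominates (conj_partition lam) (conj_partition mu)"
      "dominates (conj_partition mu) (conj_partition lam)"
      using D_module_iso_dominates[OF \<theta>] lm iso kg_iso_sym[OF iso] by blast+
    then have "conj_partition lam = conj_partition mu"
      using dominates_antisym is_partition_conj lm by blast
    then show ?thesis using conj_conj lm by metis
  qed
  have f_dom: "dominates (conj_partition lam) (f lam)" if lam: "is_partition n lam" for lam
  proof -
    obtain C where C: "C \<in> composition_factors (GL n) (ind_trivial n (parabolic n (f lam)))"
      "kg_iso (GL n) (D (f lam)) C" using J3[OF f(1)[OF lam]] by blast
    show ?thesis
      using kg_iso_trans[OF f(2)[OF lam] C(2)]
      by (rule D_module_composition_factor_dominates[OF \<theta> lam f(1)[OF lam] C(1)])
  qed
  \<comment> \<open>Conjugating first turns \<open>f_dom\<close> into the statement that every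
    partition dominates its image.\<close>
  have "f (conj_partition lam) = lam" if lam: "is_partition n lam" for lam
  proof (rule injective_dominated_imp_identity[of n "\<lambda>lam. f (conj_partition lam)", OF _ _ _ lam])
    show "is_partition n (f (conj_partition lam))" if "is_partition n lam" for lam
      using f(1) is_partition_conj that by blast
    show "dominates lam (f (conj_partition lam))" if "is_partition n lam" for lam
      using f_dom[OF is_partition_conj[OF that]] conj_conj[OF that] by simp
    show "inj_on (\<lambda>lam. f (conj_partition lam)) {lam. is_partition n lam}"
    proof (rule inj_onI)
      fix a b assume ab: "a \<in> {lam. is_partition n lam}" "b \<in> {lam. is_partition n lam}"
        "f (conj_partition a) = f (conj_partition b)"
      have pa: "is_partition n (conj_partition a)" and pb: "is_partition n (conj_partition b)"
        using ab is_partition_conj by auto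
      have "kg_iso (GL n) (D_module n \<theta> (conj_partition a)) (D_module n \<theta> (conj_partition b))"
        using kg_iso_trans[OF f(2)[OF pa] kg_iso_sym[OF f(2)[OF pb, folded ab(3)]]] .
      then have "conj_partition a = conj_partition b" using f_inj pa pb by blast
      then show "a = b" using conj_conj ab(1,2) by (metis mem_Collect_eq)
    qed
  qed
  then have f_conj: "f lam = conj_partition lam" if "is_partition n lam" for lam
    using that is_partition_conj conj_conj by metis
  have iso: "kg_iso (GL n) (D_module n \<theta> lam) (D (conj_partition lam))" if "is_partition n lam" for lam
    using f(2)[OF that] f_conj[OF that] by simp
  show ?thesis
  proof (intro conjI allI impI)
    fix lam assume lam: "is_partition n lam"
    show "kg_iso (GL n) (D_module n \<theta> lam) (D (conj_partition lam))" by (rule iso[OF lam])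
    show "irreducible_unipotent n (D_module n \<theta> lam)"
      unfolding irreducible_unipotent_def
      using kg_irreducible_iso[OF iso[OF lam] J1[OF is_partition_conj[OF lam]]] factor[OF lam] by blast
  next
    fix lam mu assume "is_partition n lam \<and> is_partition n mu \<and>
      kg_iso (GL n) (D_module n \<theta> lam) (D_module n \<theta> mu)"
    then show "lam = mu" using f_inj by blast
  next
    fix V :: "('k, 'v, 'f mat) gmodule" assume "irreducible_unipotent n V"
    then obtain C where C: "C \<in> composition_factors (GL n) ?I" "kg_iso (GL n) V C"
      unfolding irreducible_unipotent_def by blast
    obtain nu where nu: "is_partition n nu" "kg_iso (GL n) C (D nu)" using J4[OF C(1)] by blast
    have c: "is_partition n (conj_partition nu)" by (rule is_partition_conj[OF nu(1)])
    have "kg_iso (GL n) (D_module n \<theta> (conj_partition nu)) (D nu)"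
      using iso[OF c] unfolding conj_conj[OF nu(1)] .
    then have "kg_iso (GL n) V (D_module n \<theta> (conj_partition nu))"
      using kg_iso_trans[OF kg_iso_trans[OF C(2) nu(2)] kg_iso_sym] by blast
    then show "\<exists>lam. is_partition n lam \<and> kg_iso (GL n) V (D_module n \<theta> lam)" using c by blast
  qed
qed

end
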